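(* Let $\{f_1,\ldots,f_n\}$ be a fast set of positive bumps of $[0,1]$. Then there exist a finite semigroup presentation $\mathcal{P}$ and a word $w$ in the generators of $\mathcal{P}$ such that the fast group $\langle f_1,\ldots,f_n\rangle$ (the subgroup of the homeomorphism group of $[0,1]$ generated by $f_1,\ldots,f_n$) is isomorphic to the diagram group $\Delta(\mathcal{P},w)$.
   Context: **Fast sets.** If $f$ is a homeomorphism of $[0,1]$, an *orbital* of $f$ is a maximal open interval on which $f$ has no fixed points. A *bump* is an orientation-preserving homeomorphism of $[0,1]$ with exactly one orbital; it is *positive* if $f(x)\ge x$ for all $x\in[0,1]$. If $f$ is a positive bump with orbital $(a,b)$, a *pair of feet* for $f$ is a pair of intervals $L=(a,c)$, $R=(f(c),b)$ for some chosen $c\in(a,b)$. A set $\{f_1,\ldots,f_n\}$ of positive bumps is *fast* if one can choose a pair of feet $L_i,R_i$ for each $f_i$ so that $L_1,R_1,\ldots,L_n,R_n$ are pairwise disjoint. The group $\langle f_1,\dots,f_n\rangle$ is then called a *fast group*. **Diagram groups.** Let $\mathcal{P}=\langle \Sigma\mid u_1=v_1,\ldots,u_m=v_m\rangle$ be a semigroup presentation. Diagrams over $\mathcal P$ are directed plane graphs (up to isotopy) with edges labelled by $\Sigma$, each with a top path and a bottom path, both directed from a common leftmost (initial) vertex to a common rightmost (terminal) vertex. For a nonempty word $w$, the *trivial diagram* $\varepsilon_w$ is a directed path labelled $w$, with top and bottom path equal to the whole path. For a relation $u=v$ of $\mathcal P$, read in either direction, the *cell* $\pi_{u,v}$ is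 the diagram with a single bounded face, top path labelled $u$ and bottom path labelled $v$. Diagrams are built from these by *addition* $\Delta_1+\Delta_2$ (identify the terminal vertex of $\Delta_1$ with the initial vertex of $\Delta_2$) and *concatenation* $\Delta_1\circ\Delta_2$ (if the bottom path of $\Delta_1$ and the top path of $\Delta_2$ have the same label, identify these two paths). A $(u,v)$-diagram is a diagram whose top path has label $u$ and whose bottom path has label $v$. A *dipole* is a pair of cells $\pi_1,\pi_2$ such that the bottom path of $\pi_1$ is the top path of $\pi_2$, and $\pi_1,\pi_2$ are a $\pi_{u,v}$ and a $\pi_{v,u}$ cell for the same relation; it is removed by deleting the shared path and identifying the top path of $\pi_1$ with the bottom path of $\pi_2$. Two diagrams are equivalent if they differ by a sequence of removals and insertions of dipoles. The *diagram group* $\Delta(\mathcal P,w)$ is the set of equivalence classes of $(w,w)$-diagrams over $\mathcal P$ with the operation of concatenation; the identity is $\varepsilon_w$ and inverses are given by reflection in a horizontal axis. *)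

theory Defs
  imports
    "HOL-Analysis.Analysis"
    "HOL-Algebra.Bij"
    "HOL-Algebra.Generated_Groups"
    "Graph_Theory.Digraph"
begin

section \<open>Fast sets of bumps\<close>

text \<open>As in \<^const>\<open>BijGroup\<close>, a self-map of the unit interval is represented by a function on the
  reals that is \<^const>\<open>undefined\<close> outside the interval.\<close>

definition homeo_group :: "(real \<Rightarrow> real) monoid" where
  "homeo_group = (BijGroup {0..1})
     \<lparr>carrier := {f \<in> Bij {0..1}. \<exists>g. homeomorphism {0..1} {0..1} f g}\<rparr>"

definition fixfree_interval :: "(real \<Rightarrow> real) \<Rightarrow> real set \<Rightarrow> bool" where
  "fixfree_interval f I \<longleftrightarrow>
     (\<exists>a b. a < b \<and> I = {a<..<b}) \<and> I \<subseteq> {0..1} \<and> (\<forall>x\<in>I. f x \<noteq> x)"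

definition orbital :: "(real \<Rightarrow> real) \<Rightarrow> real set \<Rightarrow> bool" where
  "orbital f I \<longleftrightarrow> fixfree_interval f I \<and> (\<forall>J. fixfree_interval f J \<and> I \<subseteq> J \<longrightarrow> J = I)"

definition bump :: "(real \<Rightarrow> real) \<Rightarrow> bool" where
  "bump f \<longleftrightarrow> f \<in> carrier homeo_group \<and> strict_mono_on {0..1} f \<and> (\<exists>!I. orbital f I)"

definition positive_bump :: "(real \<Rightarrow> real) \<Rightarrow> bool" where
  "positive_bump f \<longleftrightarrow> bump f \<and> (\<forall>x\<in>{0..1}. x \<le> f x)"

definition pair_of_feet :: "(real \<Rightarrow> real) \<Rightarrow> real set \<Rightarrow> real set \<Rightarrow> bool" where
  "pair_of_feet f L R \<longleftrightarrow>
     (\<exists>a b c. orbital f {a<..<b} \<and> c \<in> {a<..<b} \<and> L = {a<..<c} \<and> R = {f c<..<b})"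

definition fast :: "(real \<Rightarrow> real) set \<Rightarrow> bool" where
  "fast F \<longleftrightarrow> finite F \<and> (\<forall>f\<in>F. positive_bump f) \<and>
     (\<exists>L R. (\<forall>f\<in>F. pair_of_feet f (L f) (R f) \<and> L f \<inter> R f = {}) \<and>
        (\<forall>f\<in>F. \<forall>g\<in>F. f \<noteq> g \<longrightarrow> (L f \<union> R f) \<inter> (L g \<union> R g) = {}))"

definition fast_group :: "(real \<Rightarrow> real) set \<Rightarrow> (real \<Rightarrow> real) monoid" where
  "fast_group F = subgroup_generated homeo_group F"


section \<open>Semigroup presentations\<close>

record 's presentation =
  gens :: "'s set"
  rels :: "('s list \<times> 's list) set"

definition word :: "'s presentation \<Rightarrow> 's list \<Rightarrow> bool" where
  "word P w \<longleftrightarrow> w \<noteq> [] \<and> set w \<subseteq> gens P"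

text \<open>Trivial relations \<open>u = u\<close> are excluded, as is usual for diagram groups: the cell \<open>\<pi>\<^sub>u\<^sub>u\<close> would
  cancel against itself.\<close>

definition finite_semigroup_presentation :: "'s presentation \<Rightarrow> bool" where
  "finite_semigroup_presentation P \<longleftrightarrow> finite (gens P) \<and> finite (rels P) \<and>
     (\<forall>(u, v)\<in>rels P. word P u \<and> word P v \<and> u \<noteq> v)"


section \<open>Diagrams\<close>

text \<open>
  A diagram is recorded as the directed graph together with the labelling, the bounded faces and
  the boundary. Each bounded face is given by its top path and its bottom path (lists of edges),
  and likewise for the boundary of the whole diagram. An isotopy of the plane carries one diagram
  to another exactly when these data are isomorphic. Vertices and edges are natural numbers, which
  suffices for finite graphs.
\<close>

record ('v, 'e, 's) diagram_data = "('v, 'e) pre_digraph" +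
  label :: "'e \<Rightarrow> 's"
  cells :: "('e list \<times> 'e list) set"
  top_path :: "'e list"
  bot_path :: "'e list"

type_synonym 's diag = "(nat, nat, 's) diagram_data"

definition path_label :: "'s diag \<Rightarrow> nat list \<Rightarrow> 's list" where
  "path_label D p = map (label D) p"

definition path_verts :: "'s diag \<Rightarrow> nat list \<Rightarrow> nat list" where
  "path_verts D p = map (tail D) p @ [head D (last p)]"

definition inner_verts :: "'s diag \<Rightarrow> nat list \<Rightarrow> nat set" where
  "inner_verts D p = set (map (tail D) (tl p))"

definition initial_vertex :: "'s diag \<Rightarrow> nat" where
  "initial_vertex D = tail D (hd (top_path D))"

definition terminal_vertex :: "'s diag \<Rightarrow> nat" where
  "terminal_vertex D = head D (last (top_path D))"

definition isotopic :: "'s diag \<Rightarrow> 's diag \<Rightarrow> bool" where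
  "isotopic D D' \<longleftrightarrow> (\<exists>fv fe.
     bij_betw fv (verts D) (verts D') \<and> bij_betw fe (arcs D) (arcs D') \<and>
     (\<forall>e\<in>arcs D. tail D' (fe e) = fv (tail D e) \<and> head D' (fe e) = fv (head D e) \<and>
        label D' (fe e) = label D e) \<and>
     cells D' = map_prod (map fe) (map fe) ` cells D \<and>
     top_path D' = map fe (top_path D) \<and> bot_path D' = map fe (bot_path D))"

definition trivial_diagram :: "'s list \<Rightarrow> 's diag" where
  "trivial_diagram w =
     \<lparr>verts = {..length w}, arcs = {..<length w}, tail = id, head = Suc,
      label = (!) w, cells = {}, top_path = [0..<length w], bot_path = [0..<length w]\<rparr>"

text \<open>The top path of the cell \<open>\<pi>\<^sub>u\<^sub>,\<^sub>v\<close> visits the vertices \<open>0, 1, \<dots>, |u|\<close>; its bottom path visits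
  \<open>0, |u| + 1, \<dots>, |u| + |v| - 1, |u|\<close>.\<close>

definition cell_diagram :: "'s list \<Rightarrow> 's list \<Rightarrow> 's diag" where
  "cell_diagram u v =
     (let k = length u; m = length u + length v; t = [0..<k]; b = [k..<m] in
      \<lparr>verts = {..<m}, arcs = {..<m},
       tail = (\<lambda>e. if e = k then 0 else e),
       head = (\<lambda>e. if Suc e = m then k else Suc e),
       label = (!) (u @ v), cells = {(t, b)}, top_path = t, bot_path = b\<rparr>)"

definition diag_union :: "'s diag \<Rightarrow> 's diag \<Rightarrow> nat list \<Rightarrow> nat list \<Rightarrow> 's diag" where
  "diag_union D1 D2 t b =
     \<lparr>verts = verts D1 \<union> verts D2, arcs = arcs D1 \<union> arcs D2,
      tail = (\<lambda>e. if e \<in> arcs D1 then tail D1 e else tail D2 e),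
      head = (\<lambda>e. if e \<in> arcs D1 then head D1 e else head D2 e),
      label = (\<lambda>e. if e \<in> arcs D1 then label D1 e else label D2 e),
      cells = cells D1 \<union> cells D2, top_path = t, bot_path = b\<rparr>"

text \<open>
  Identifying two vertices or two paths is expressed by choosing, up to isotopy, representatives
  that overlap in exactly the part to be identified, and taking their union.
\<close>

definition addable :: "'s diag \<Rightarrow> 's diag \<Rightarrow> bool" where
  "addable D1 D2 \<longleftrightarrow> terminal_vertex D1 = initial_vertex D2 \<and>
     verts D1 \<inter> verts D2 = {initial_vertex D2} \<and> arcs D1 \<inter> arcs D2 = {}"

definition diag_add :: "'s diag \<Rightarrow> 's diag \<Rightarrow> 's diag" where
  "diag_add D1 D2 =
     diag_union D1 D2 (top_path D1 @ top_path D2) (bot_path D1 @ bot_path D2)"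

definition composable :: "'s diag \<Rightarrow> 's diag \<Rightarrow> bool" where
  "composable D1 D2 \<longleftrightarrow> bot_path D1 = top_path D2 \<and>
     verts D1 \<inter> verts D2 = set (path_verts D2 (top_path D2)) \<and>
     arcs D1 \<inter> arcs D2 = set (top_path D2) \<and>
     (\<forall>e\<in>set (top_path D2).
        tail D1 e = tail D2 e \<and> head D1 e = head D2 e \<and> label D1 e = label D2 e)"

definition diag_comp :: "'s diag \<Rightarrow> 's diag \<Rightarrow> 's diag" where
  "diag_comp D1 D2 = diag_union D1 D2 (top_path D1) (bot_path D2)"

inductive diagram :: "'s presentation \<Rightarrow> 's diag \<Rightarrow> bool" for P where
  trivial: "word P w \<Longrightarrow> diagram P (trivial_diagram w)"
| cell: "(u, v) \<in> rels P \<or> (v, u) \<in> rels P \<Longrightarrow> diagram P (cell_diagram u v)"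
| add: "diagram P D1 \<Longrightarrow> diagram P D2 \<Longrightarrow> addable D1 D2 \<Longrightarrow> diagram P (diag_add D1 D2)"
| comp: "diagram P D1 \<Longrightarrow> diagram P D2 \<Longrightarrow> composable D1 D2 \<Longrightarrow> diagram P (diag_comp D1 D2)"
| isotopy: "diagram P D \<Longrightarrow> isotopic D D' \<Longrightarrow> diagram P D'"

definition word_diagram :: "'s presentation \<Rightarrow> 's list \<Rightarrow> 's list \<Rightarrow> 's diag \<Rightarrow> bool" where
  "word_diagram P u v D \<longleftrightarrow>
     diagram P D \<and> path_label D (top_path D) = u \<and> path_label D (bot_path D) = v"


section \<open>Dipoles and diagram groups\<close>

text \<open>
  The cells \<open>(p, r)\<close> and \<open>(r, q)\<close> form a dipole when \<open>p\<close> and \<open>q\<close> have the same label. Its removal is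
  the quotient of what is left after deleting \<open>r\<close> (its edges and inner vertices) and both cells,
  by the identification of \<open>p\<close> with \<open>q\<close>. The maps \<open>fv\<close> and \<open>fe\<close> below are the quotient maps.
\<close>

definition dipole :: "'s diag \<Rightarrow> nat list \<Rightarrow> nat list \<Rightarrow> nat list \<Rightarrow> bool" where
  "dipole D p r q \<longleftrightarrow>
     (p, r) \<in> cells D \<and> (r, q) \<in> cells D \<and> path_label D p = path_label D q"

definition identifies_exactly :: "('x \<Rightarrow> 'y) \<Rightarrow> 'x set \<Rightarrow> 'x list \<Rightarrow> 'x list \<Rightarrow> bool" where
  "identifies_exactly f A xs ys \<longleftrightarrow> (\<forall>x\<in>A. \<forall>y\<in>A. f x = f y \<longleftrightarrow>
     x = y \<or> (x, y) \<in> set (zip xs ys) \<or> (y, x) \<in> set (zip xs ys))"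

definition dipole_removal :: "'s diag \<Rightarrow> 's diag \<Rightarrow> bool" where
  "dipole_removal D D' \<longleftrightarrow> (\<exists>p r q fv fe. dipole D p r q \<and>
     identifies_exactly fv (verts D - inner_verts D r) (path_verts D p) (path_verts D q) \<and>
     identifies_exactly fe (arcs D - set r) p q \<and>
     verts D' = fv ` (verts D - inner_verts D r) \<and>
     arcs D' = fe ` (arcs D - set r) \<and>
     (\<forall>e\<in>arcs D - set r. tail D' (fe e) = fv (tail D e) \<and> head D' (fe e) = fv (head D e) \<and>
        label D' (fe e) = label D e) \<and>
     cells D' = map_prod (map fe) (map fe) ` (cells D - {(p, r), (r, q)}) \<and>
     top_path D' = map fe (top_path D) \<and> bot_path D' = map fe (bot_path D))"

definition diagram_equiv :: "'s presentation \<Rightarrow> 's diag \<Rightarrow> 's diag \<Rightarrow> bool" where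
  "diagram_equiv P = equivclp (\<lambda>D D'. diagram P D \<and> diagram P D' \<and>
     (isotopic D D' \<or> dipole_removal D D'))"

definition diagram_group :: "'s presentation \<Rightarrow> 's list \<Rightarrow> 's diag set monoid" where
  "diagram_group P w =
     \<lparr>carrier = {D. word_diagram P w w D} // {(D, D'). diagram_equiv P D D'},
      mult = (\<lambda>X Y. {D. \<exists>D1\<in>X. \<exists>D2\<in>Y. composable D1 D2 \<and>
                       diagram_equiv P (diag_comp D1 D2) D}),
      one = {D. diagram_equiv P (trivial_diagram w) D}\<rparr>"

end

theory Submission
  imports Defs
begin

text \<open>
  Let the \<open>n\<close> bumps have disjoint feet, the bump \<open>f\<close> with orbital \<open>(a, b)\<close> having the left foot
  \<open>(a, c)\<close> and the right foot \<open>[f c, b)\<close>. The \<open>2n\<close> feet and the gaps around them cut the unit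
  interval into \<open>4n + 1\<close> consecutive pieces, numbered from \<open>0\<close>; the feet get the odd numbers, and a
  gap may be empty. If the feet of \<open>f\<close> have the numbers \<open>p < q\<close>, then \<open>f\<close> maps the piece \<open>p\<close> onto the
  union of the pieces \<open>p, \<dots>, q - 1\<close>, it maps the union of the pieces \<open>p + 1, \<dots>, q\<close> onto the piece
  \<open>q\<close>, and it fixes all other points. The presentation copies this: its letters are the pieces, its
  relations are \<open>p = p (p + 1) \<dots> (q - 1)\<close> and \<open>q = (p + 1) \<dots> q\<close>, one pair for each bump, and \<open>w\<close> is the
  word \<open>0 1 \<dots> 4n\<close>.

  A diagram acts on the interval. Give each edge a chart, that is an injection of the piece named by its
  label into the interval, in such a way that the charts above a cell determine those below it through
  the bump of that cell. Identity charts on the top path of a \<open>(w, w)\<close>-diagram then produce charts on the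
  bottom path, which together form a self-map of the interval, the holonomy of the diagram. Isotopies
  and dipoles do not change it, and it is multiplicative. It remains to see that it is injective on
  equivalence classes and that its image is the group generated by the bumps.

  Both rest on the shape of the relations: each replaces one letter by a longer word (it
  expands the letter), and no letter has two expansions. So expansions are confluent, and up to
  equivalence every \<open>(w, w)\<close>-diagram expands \<open>w\<close> to some word \<open>u\<close> by a sequence \<open>E\<^sub>1\<close> and contracts it
  back by the inverse of a sequence \<open>E\<^sub>2\<close> (\<open>derivation_fraction\<close>).

  Injectivity is the ping-pong argument. If the holonomy is trivial, \<open>E\<^sub>1\<close> and \<open>E\<^sub>2\<close> give the same charts
  on \<open>u\<close>. Expanding a letter splits the range of its chart into several parts, each of them smaller
  than the range. So a letter that \<open>E\<^sub>1\<close> expands cannot survive in \<open>E\<^sub>2\<close>, where it would keep its chart. Hence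
  \<open>E\<^sub>1\<close> and \<open>E\<^sub>2\<close> expand the same letters (\<open>expansions_faithful\<close>), and the diagram is trivial.

  For the image, note that the words obtained from \<open>w\<close> by expansions are those that a reader spells who
  starts at \<open>0\<close>, reads the letters in increasing order, and may jump back from a right foot \<open>q\<close> to \<open>p + 1\<close>
  whenever it is about to read \<open>q\<close>. If each jump is charged with the bump \<open>f\<close>, every such word gets
  canonical charts (\<open>scan\<close>). An arbitrary expansion sequence leads to the canonical charts up to one common
  factor in the group (\<open>scan_expand\<close>), so the holonomy lies in the group (\<open>loop_generated\<close>). Conversely
  the diagram that expands \<open>p\<close> and contracts \<open>(p + 1) \<dots> q\<close> has the holonomy \<open>f\<^sup>-\<^sup>1\<close> (\<open>loop_f'\<close>).

  To make plane graphs accessible to this, a diagram is regarded as the trace of a derivation: a path to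
  whose lower side cells are attached one after the other (\<open>built\<close>). The exchange of two independent steps of a
  derivation does not change the graph, and a step followed by its inverse creates a dipole.
\<close>

section \<open>Derivations over a semigroup presentation\<close>

lemma append_prefix_split:
  assumes "a @ b = c @ d" "length a \<le> length c"
  shows "\<exists>g. c = a @ g \<and> b = g @ d"
  using assms by (auto simp: append_eq_append_conv2)

text \<open>The step \<open>(i, u, v)\<close> replaces the factor \<open>u\<close> that begins at position \<open>i\<close> by \<open>v\<close>.\<close>

type_synonym 's step = "nat \<times> 's list \<times> 's list"

definition sym_rels :: "'s presentation \<Rightarrow> ('s list \<times> 's list) set" where
  "sym_rels P = rels P \<union> (rels P)\<inverse>"

lemma sym_relsD: "(u, v) \<in> sym_rels P \<Longrightarrow> (v, u) \<in> sym_rels P"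
  by (auto simp: sym_rels_def)

inductive derivation :: "'s presentation \<Rightarrow> 's list \<Rightarrow> 's step list \<Rightarrow> 's list \<Rightarrow> bool" for P where
  deriv_Nil: "derivation P y [] y"
| deriv_Cons: "(u, v) \<in> sym_rels P \<Longrightarrow> derivation P (\<alpha> @ v @ \<beta>) d z \<Longrightarrow>
    derivation P (\<alpha> @ u @ \<beta>) ((length \<alpha>, u, v) # d) z"

lemma deriv_Nil_iff [simp]: "derivation P y [] z \<longleftrightarrow> y = z"
  by (auto intro: deriv_Nil elim: derivation.cases)

lemma deriv_Cons_iff: "derivation P y ((i, u, v) # d) z \<longleftrightarrow>
   (\<exists>\<alpha> \<beta>. y = \<alpha> @ u @ \<beta> \<and> i = length \<alpha> \<and> (u, v) \<in> sym_rels P \<and> derivation P (\<alpha> @ v @ \<beta>) d z)"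
  by (subst derivation.simps) auto

lemma deriv_append: "derivation P x (d @ d') z \<longleftrightarrow> (\<exists>y. derivation P x d y \<and> derivation P y d' z)"
proof (induction d arbitrary: x)
  case (Cons s d)
  obtain i u v where s: "s = (i, u, v)" by (cases s)
  show ?case unfolding s append_Cons deriv_Cons_iff Cons.IH by blast
qed auto

lemma deriv_functional: "derivation P x d y \<Longrightarrow> derivation P x d z \<Longrightarrow> y = z"
proof (induction arbitrary: z rule: derivation.induct)
  case (deriv_Cons u v \<alpha> \<beta> d y)
  show ?case using deriv_Cons.prems by (auto simp: deriv_Cons_iff intro: deriv_Cons.IH)
qed auto

definition step_inv :: "'s step \<Rightarrow> 's step" where
  "step_inv s = (fst s, snd (snd s), fst (snd s))"

definition deriv_inv :: "'s step list \<Rightarrow> 's step list" where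
  "deriv_inv d = rev (map step_inv d)"

lemma deriv_inv_simps [simp]: "deriv_inv [] = []"
  "deriv_inv ((i, u, v) # d) = deriv_inv d @ [(i, v, u)]"
  "deriv_inv (d @ d') = deriv_inv d' @ deriv_inv d"
  by (auto simp: deriv_inv_def step_inv_def)

lemma deriv_inv_inv [simp]: "deriv_inv (deriv_inv d) = d"
  by (auto simp: deriv_inv_def step_inv_def rev_map comp_def)

lemma deriv_deriv_inv: "derivation P x d y \<Longrightarrow> derivation P y (deriv_inv d) x"
  by (induction rule: derivation.induct) (auto simp: deriv_append deriv_Cons_iff sym_relsD)

text \<open>Positions are absolute. When two steps at disjoint places are exchanged, the one further to the right
  therefore moves by the change of length that the other one causes; \<open>k\<close> is the number of letters between
  the two places.\<close>

inductive deriv_eq :: "'s presentation \<Rightarrow> 's list \<Rightarrow> 's list \<Rightarrow> 's step list \<Rightarrow> 's step list \<Rightarrow> bool"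
  for P y z where
  deq_refl: "derivation P y d z \<Longrightarrow> deriv_eq P y z d d"
| deq_sym: "deriv_eq P y z d d' \<Longrightarrow> deriv_eq P y z d' d"
| deq_trans: "deriv_eq P y z d d' \<Longrightarrow> deriv_eq P y z d' d'' \<Longrightarrow> deriv_eq P y z d d''"
| deq_exchange: "derivation P y (d @ [(i, u, v), (i + length v + k, u', v')] @ d') z \<Longrightarrow>
    deriv_eq P y z (d @ [(i, u, v), (i + length v + k, u', v')] @ d')
      (d @ [(i + length u + k, u', v'), (i, u, v)] @ d')"
| deq_cancel: "derivation P y (d @ [(i, u, v), (i, v, u)] @ d') z \<Longrightarrow>
    deriv_eq P y z (d @ [(i, u, v), (i, v, u)] @ d') (d @ d')"

lemma deriv_exchange:
  assumes "derivation P y [(i, u, v), (i + length v + k, u', v')] z"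
  obtains \<alpha> \<gamma> \<beta> where "y = \<alpha> @ u @ \<gamma> @ u' @ \<beta>" "z = \<alpha> @ v @ \<gamma> @ v' @ \<beta>" "i = length \<alpha>"
    "k = length \<gamma>" "(u, v) \<in> sym_rels P" "(u', v') \<in> sym_rels P"
proof -
  from assms obtain \<alpha> \<beta> \<alpha>' \<beta>' where 1: "y = \<alpha> @ u @ \<beta>" "i = length \<alpha>" "(u, v) \<in> sym_rels P"
    "\<alpha> @ v @ \<beta> = \<alpha>' @ u' @ \<beta>'" "i + length v + k = length \<alpha>'" "(u', v') \<in> sym_rels P"
    "z = \<alpha>' @ v' @ \<beta>'"
    by (auto simp: deriv_Cons_iff)
  from 1(2,5) have "length (\<alpha> @ v) \<le> length \<alpha>'" by simp
  with 1(4) have "\<exists>\<gamma>. \<alpha>' = (\<alpha> @ v) @ \<gamma> \<and> \<beta> = \<gamma> @ u' @ \<beta>'"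
    using append_prefix_split[of "\<alpha> @ v" \<beta> \<alpha>' "u' @ \<beta>'"] by simp
  then obtain \<gamma> where \<gamma>: "\<alpha>' = (\<alpha> @ v) @ \<gamma>" "\<beta> = \<gamma> @ u' @ \<beta>'" by blast
  show thesis by (rule that[of \<alpha> \<gamma> \<beta>']) (use 1 \<gamma> in auto)
qed

lemma deriv_eq_deriv: "deriv_eq P y z d d' \<Longrightarrow> derivation P y d z \<and> derivation P y d' z"
proof (induction rule: deriv_eq.induct)
  case (deq_exchange d i u v k u' v' d')
  then obtain a b where ab: "derivation P y d a" "derivation P a [(i, u, v), (i + length v + k, u', v')] b"
    "derivation P b d' z" by (auto simp only: deriv_append)
  from ab(2) have "derivation P a [(i + length u + k, u', v'), (i, u, v)] b"
  proof (rule deriv_exchange)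
    fix \<alpha> \<gamma> \<beta> assume *: "a = \<alpha> @ u @ \<gamma> @ u' @ \<beta>" "b = \<alpha> @ v @ \<gamma> @ v' @ \<beta>" "i = length \<alpha>"
    "k = length \<gamma>" "(u, v) \<in> sym_rels P" "(u', v') \<in> sym_rels P"
    then show ?thesis unfolding deriv_Cons_iff
      by (intro exI[of _ "\<alpha> @ u @ \<gamma>"] exI[of _ \<beta>] conjI exI[of _ \<alpha>] exI[of _ "\<gamma> @ v' @ \<beta>"]) auto
  qed
  with ab deq_exchange show ?case by (auto simp only: deriv_append)
next
  case (deq_cancel d i u v d')
  then show ?case by (auto simp: deriv_append deriv_Cons_iff)
qed auto

lemma deriv_eq_append_left:
  "deriv_eq P y z d d' \<Longrightarrow> derivation P x e y \<Longrightarrow> deriv_eq P x z (e @ d) (e @ d')"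
proof (induction rule: deriv_eq.induct)
  case (deq_refl d) then show ?case by (auto intro!: deriv_eq.deq_refl simp: deriv_append)
next
  case (deq_sym d d') then show ?case by (blast intro: deriv_eq.deq_sym)
next
  case (deq_trans d d' d'') then show ?case by (blast intro: deriv_eq.deq_trans)
next
  case (deq_exchange d i u v k u' v' d')
  then have "derivation P x (e @ (d @ [(i, u, v), (i + length v + k, u', v')] @ d')) z"
    unfolding deriv_append[of _ _ e] by blast
  then show ?case
    using deriv_eq.deq_exchange[of P x "e @ d" i u v k u' v' d' z] by simp
next
  case (deq_cancel d i u v d')
  then have "derivation P x (e @ (d @ [(i, u, v), (i, v, u)] @ d')) z"
    unfolding deriv_append[of _ _ e] by blast
  then show ?case
    using deriv_eq.deq_cancel[of P x "e @ d" i u v d' z] by simp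
qed

lemma deriv_eq_append_right:
  "deriv_eq P x y d d' \<Longrightarrow> derivation P y e z \<Longrightarrow> deriv_eq P x z (d @ e) (d' @ e)"
proof (induction rule: deriv_eq.induct)
  case (deq_refl d) then show ?case by (auto intro!: deriv_eq.deq_refl simp: deriv_append)
next
  case (deq_sym d d') then show ?case by (blast intro: deriv_eq.deq_sym)
next
  case (deq_trans d d' d'') then show ?case by (blast intro: deriv_eq.deq_trans)
next
  case (deq_exchange d i u v k u' v' d')
  then have "derivation P x ((d @ [(i, u, v), (i + length v + k, u', v')] @ d') @ e) z"
    unfolding deriv_append[of _ _ _ e] by blast
  then show ?case
    using deriv_eq.deq_exchange[of P x d i u v k u' v' "d' @ e" z] by simp
next
  case (deq_cancel d i u v d')
  then have "derivation P x ((d @ [(i, u, v), (i, v, u)] @ d') @ e) z"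
    unfolding deriv_append[of _ _ _ e] by blast
  then show ?case
    using deriv_eq.deq_cancel[of P x d i u v "d' @ e" z] by simp
qed

lemma deriv_eq_inv: "derivation P x d y \<Longrightarrow> deriv_eq P x x (d @ deriv_inv d) []"
proof (induction rule: derivation.induct)
  case (deriv_Nil y) then show ?case by (simp add: deq_refl)
next
  case (deriv_Cons u v \<alpha> \<beta> d z)
  let ?x = "\<alpha> @ u @ \<beta>" and ?s = "(length \<alpha>, u, v)" and ?s' = "(length \<alpha>, v, u)"
  have s: "derivation P ?x [?s] (\<alpha> @ v @ \<beta>)" "derivation P (\<alpha> @ v @ \<beta>) [?s'] ?x"
    using deriv_Cons.hyps(1) by (auto simp: deriv_Cons_iff sym_relsD)
  have "deriv_eq P ?x ?x ([?s] @ ((d @ deriv_inv d) @ [?s'])) ([?s] @ ([] @ [?s']))"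
    by (rule deriv_eq_append_left[OF deriv_eq_append_right[OF deriv_Cons.IH s(2)] s(1)])
  moreover have "deriv_eq P ?x ?x ([] @ [?s, ?s'] @ []) ([] @ [])"
    by (rule deq_cancel) (use s in \<open>auto simp: deriv_Cons_iff\<close>)
  ultimately show ?case using deq_trans by fastforce
qed

lemma deriv_eq_inv': "derivation P x d y \<Longrightarrow> deriv_eq P y y (deriv_inv d @ d) []"
  using deriv_eq_inv[OF deriv_deriv_inv] by fastforce

lemma deriv_eq_cancel_right:
  assumes "deriv_eq P x z (d @ e) (d' @ e)" "derivation P x d y" "derivation P x d' y" "derivation P y e z"
  shows "deriv_eq P x y d d'"
proof -
  have *: "deriv_eq P x y (c @ e @ deriv_inv e) c" if "derivation P x c y" for c
    using deriv_eq_append_left[OF deriv_eq_inv[OF assms(4)] that] by simp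
  have "deriv_eq P x y ((d @ e) @ deriv_inv e) ((d' @ e) @ deriv_inv e)"
    by (rule deriv_eq_append_right[OF assms(1) deriv_deriv_inv[OF assms(4)]])
  then have "deriv_eq P x y (d @ e @ deriv_inv e) (d' @ e @ deriv_inv e)" by simp
  from deq_trans[OF deq_trans[OF deq_sym[OF *[OF assms(2)]] this] *[OF assms(3)]]
  show ?thesis .
qed

section \<open>Diagrams as traces of derivations\<close>

lemma path_label_simps [simp]: "path_label D [] = []"
  "path_label D (p @ q) = path_label D p @ path_label D q"
  "length (path_label D p) = length p"
  by (simp_all add: path_label_def)

lemma path_label_cong: "(\<And>e. e \<in> set p \<Longrightarrow> label D e = label D' e) \<Longrightarrow> path_label D p = path_label D' p"
  by (simp add: path_label_def)

definition simple_walk :: "'s diag \<Rightarrow> nat list \<Rightarrow> bool" where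
  "simple_walk D p \<longleftrightarrow> p \<noteq> [] \<and> successively (\<lambda>e e'. head D e = tail D e') p \<and>
     distinct (path_verts D p)"

lemma simple_walk_distinct: "simple_walk D p \<Longrightarrow> distinct p"
  by (auto simp: simple_walk_def path_verts_def distinct_map)

lemma path_verts_cong:
  assumes "p \<noteq> []" "\<And>e. e \<in> set p \<Longrightarrow> tail D e = tail D' e \<and> head D e = head D' e"
  shows "path_verts D p = path_verts D' p"
  using assms by (simp add: path_verts_def)

lemma simple_walk_cong:
  assumes "\<And>e. e \<in> set p \<Longrightarrow> tail D e = tail D' e \<and> head D e = head D' e"
  shows "simple_walk D p \<longleftrightarrow> simple_walk D' p"
proof (cases "p = []")
  case False
  moreover have "successively (\<lambda>e e'. head D e = tail D e') p = successively (\<lambda>e e'. head D' e = tail D' e') p"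
    using assms by (intro successively_cong) auto
  ultimately show ?thesis using path_verts_cong[OF False assms] by (simp add: simple_walk_def)
qed (simp add: simple_walk_def)

definition iso_via :: "(nat \<Rightarrow> nat) \<Rightarrow> (nat \<Rightarrow> nat) \<Rightarrow> 's diag \<Rightarrow> 's diag \<Rightarrow> bool" where
  "iso_via fv fe D D' \<longleftrightarrow>
     bij_betw fv (verts D) (verts D') \<and> bij_betw fe (arcs D) (arcs D') \<and>
     (\<forall>e\<in>arcs D. tail D' (fe e) = fv (tail D e) \<and> head D' (fe e) = fv (head D e) \<and>
        label D' (fe e) = label D e) \<and>
     cells D' = map_prod (map fe) (map fe) ` cells D \<and>
     top_path D' = map fe (top_path D) \<and> bot_path D' = map fe (bot_path D)"

lemma isotopic_iff: "isotopic D D' \<longleftrightarrow> (\<exists>fv fe. iso_via fv fe D D')"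
  by (simp add: isotopic_def iso_via_def)

text \<open>Only the values on the arcs of a diagram matter.\<close>

lemma isotopic_agree:
  assumes "verts D = verts D'" "arcs D = arcs D'" "cells D = cells D'"
    "top_path D = top_path D'" "bot_path D = bot_path D'"
    "\<And>e. e \<in> arcs D \<Longrightarrow> tail D e = tail D' e \<and> head D e = head D' e \<and> label D e = label D' e"
  shows "isotopic D D'"
  unfolding isotopic_iff iso_via_def using assms
  by (intro exI[of _ id]) (auto simp: map_prod.id)

definition rename_diag :: "(nat \<Rightarrow> nat) \<Rightarrow> (nat \<Rightarrow> nat) \<Rightarrow> 's diag \<Rightarrow> 's diag" where
  "rename_diag fv fe D =
     \<lparr>verts = fv ` verts D, arcs = fe ` arcs D,
      tail = (\<lambda>e. fv (tail D (inv_into (arcs D) fe e))),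
      head = (\<lambda>e. fv (head D (inv_into (arcs D) fe e))),
      label = (\<lambda>e. label D (inv_into (arcs D) fe e)),
      cells = map_prod (map fe) (map fe) ` cells D,
      top_path = map fe (top_path D), bot_path = map fe (bot_path D)\<rparr>"

lemma iso_via_rename:
  assumes "inj_on fv (verts D)" "inj_on fe (arcs D)"
  shows "iso_via fv fe D (rename_diag fv fe D)"
  using assms by (auto simp: iso_via_def rename_diag_def bij_betw_def)

text \<open>Copies of trivial diagrams, with arbitrary names for vertices and edges.\<close>

definition is_line :: "'s list \<Rightarrow> 's diag \<Rightarrow> bool" where
  "is_line y D \<longleftrightarrow> simple_walk D (top_path D) \<and> bot_path D = top_path D \<and>
     arcs D = set (top_path D) \<and> verts D = set (path_verts D (top_path D)) \<and> cells D = {} \<and>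
     path_label D (top_path D) = y"

lemma path_verts_iso:
  assumes "iso_via fv fe D D'" "p \<noteq> []" "set p \<subseteq> arcs D"
  shows "path_verts D' (map fe p) = map fv (path_verts D p)"
proof -
  have "last p \<in> arcs D" using assms by (metis last_in_set subsetD)
  then show ?thesis
    using assms by (auto simp: path_verts_def iso_via_def last_map)
qed

lemma path_label_iso:
  assumes "iso_via fv fe D D'" "set p \<subseteq> arcs D"
  shows "path_label D' (map fe p) = path_label D p"
  using assms by (auto simp: path_label_def iso_via_def)

lemma simple_walk_iso:
  assumes "iso_via fv fe D D'" "set p \<subseteq> arcs D" "set (path_verts D p) \<subseteq> verts D" "simple_walk D p"
  shows "simple_walk D' (map fe p)"
proof -
  have p: "p \<noteq> []" using assms(4) by (simp add: simple_walk_def)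
  have "inj_on fv (verts D)" using assms(1) by (simp add: iso_via_def bij_betw_def)
  then have "distinct (path_verts D' (map fe p))"
    using assms p by (auto simp: path_verts_iso simple_walk_def distinct_map intro: inj_on_subset)
  moreover have "successively (\<lambda>e e'. head D' e = tail D' e') (map fe p)"
    unfolding successively_map
    by (rule successively_mono[of "\<lambda>e e'. head D e = tail D e'"])
      (use assms in \<open>auto simp: simple_walk_def iso_via_def subset_iff\<close>)
  ultimately show ?thesis using p by (simp add: simple_walk_def)
qed

lemma is_line_iso:
  assumes "iso_via fv fe D D'" "is_line y D"
  shows "is_line y D'"
proof -
  let ?p = "top_path D"
  have l: "simple_walk D ?p" "bot_path D = ?p" "arcs D = set ?p" "verts D = set (path_verts D ?p)"
    "cells D = {}" "path_label D ?p = y" using assms(2) by (auto simp: is_line_def)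
  have p: "?p \<noteq> []" using l(1) by (simp add: simple_walk_def)
  have "simple_walk D' (map fe ?p)" using simple_walk_iso[OF assms(1)] l by simp
  moreover have "path_verts D' (map fe ?p) = map fv (path_verts D ?p)"
    using path_verts_iso[OF assms(1) p] l by simp
  moreover have "path_label D' (map fe ?p) = y" using path_label_iso[OF assms(1)] l by simp
  ultimately show ?thesis using assms(1) l
    by (auto simp: is_line_def iso_via_def bij_betw_def)
qed

lemma path_verts_nth:
  assumes "simple_walk D p" "i < length p"
  shows "path_verts D p ! i = tail D (p ! i)" "path_verts D p ! Suc i = head D (p ! i)"
proof -
  show "path_verts D p ! i = tail D (p ! i)" using assms by (simp add: path_verts_def nth_append)
  show "path_verts D p ! Suc i = head D (p ! i)"
  proof (cases "Suc i < length p")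
    case True
    then show ?thesis using assms
      by (auto simp: path_verts_def nth_append simple_walk_def successively_conv_nth)
  next
    case False
    with assms(2) have "length p = Suc i" by simp
    moreover from this have "last p = p ! i" by (metis diff_Suc_1 last_conv_nth length_0_conv nat.simps(3))
    ultimately show ?thesis by (simp add: path_verts_def nth_append)
  qed
qed

lemma length_path_verts [simp]: "length (path_verts D p) = Suc (length p)"
  by (simp add: path_verts_def)

lemma is_line_trivial: "y \<noteq> [] \<Longrightarrow> is_line y (trivial_diagram y)"
proof -
  assume y: "y \<noteq> []"
  have pv: "path_verts (trivial_diagram y) [0..<length y] = [0..<Suc (length y)]"
    using y by (simp add: path_verts_def trivial_diagram_def last_upt)
  have "successively (\<lambda>e e'. Suc e = e') [0..<length y]"
    by (auto simp: successively_conv_nth)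
  then have "simple_walk (trivial_diagram y) [0..<length y]"
    using y by (simp add: simple_walk_def pv del: upt_Suc) (simp add: trivial_diagram_def)
  then show ?thesis using pv
    by (auto simp: is_line_def path_label_def trivial_diagram_def map_nth simp del: upt_Suc)
qed

lemma obtain_list_bij:
  assumes "distinct xs" "distinct ys" "length xs = length ys"
  obtains g where "map g xs = ys" "bij_betw g (set xs) (set ys)"
proof
  let ?g = "\<lambda>x. the (map_of (zip xs ys) x)"
  show *: "map ?g xs = ys"
    using assms by (auto simp: list_eq_iff_nth_eq map_of_zip_nth)
  then have "inj_on ?g (set xs)" using assms(2) by (metis distinct_map)
  moreover have "?g ` set xs = set ys" using arg_cong[OF *, of set] by simp
  ultimately show "bij_betw ?g (set xs) (set ys)" by (simp add: bij_betw_def)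
qed

lemma is_line_unique:
  assumes "is_line y D" "is_line y D'" shows "isotopic D D'"
proof -
  let ?p = "top_path D" and ?p' = "top_path D'"
  have l: "simple_walk D ?p" "bot_path D = ?p" "arcs D = set ?p" "verts D = set (path_verts D ?p)"
    "cells D = {}" "path_label D ?p = y" using assms(1) by (auto simp: is_line_def)
  have l': "simple_walk D' ?p'" "bot_path D' = ?p'" "arcs D' = set ?p'" "verts D' = set (path_verts D' ?p')"
    "cells D' = {}" "path_label D' ?p' = y" using assms(2) by (auto simp: is_line_def)
  have len: "length ?p = length ?p'" using l(6) l'(6) by (metis path_label_simps(3))
  obtain fe where fe: "map fe ?p = ?p'" "bij_betw fe (set ?p) (set ?p')"
    using obtain_list_bij simple_walk_distinct l(1) l'(1) len by metis
  obtain fv where fv: "map fv (path_verts D ?p) = path_verts D' ?p'"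
      "bij_betw fv (set (path_verts D ?p)) (set (path_verts D' ?p'))"
    using obtain_list_bij[of "path_verts D ?p" "path_verts D' ?p'"] l(1) l'(1) len
    by (auto simp: simple_walk_def)
  have "tail D' (fe e) = fv (tail D e) \<and> head D' (fe e) = fv (head D e) \<and> label D' (fe e) = label D e"
    if "e \<in> arcs D" for e
  proof -
    obtain i where i: "i < length ?p" "e = ?p ! i" using \<open>e \<in> arcs D\<close> l(3) by (auto simp: in_set_conv_nth)
    have fei: "fe e = ?p' ! i" using i arg_cong[OF fe(1), of "\<lambda>xs. xs ! i"] by simp
    have fvi: "fv (path_verts D ?p ! j) = path_verts D' ?p' ! j" if "j \<le> length ?p" for j
      using that arg_cong[OF fv(1), of "\<lambda>xs. xs ! j"] by simp
    have "path_label D ?p ! i = path_label D' ?p' ! i" using l(6) l'(6) by simp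
    then show ?thesis using path_verts_nth[OF l(1) i(1)] path_verts_nth[OF l'(1)] i len fei
        fvi[of i] fvi[of "Suc i"] by (simp add: path_label_def)
  qed
  then have "iso_via fv fe D D'" using fe fv l l' by (simp add: iso_via_def)
  then show ?thesis unfolding isotopic_iff by blast
qed

subsection \<open>Attaching a cell at the bottom\<close>

text \<open>The segment \<open>t\<close> of the bottom path \<open>\<alpha> @ t @ \<beta>\<close> becomes the top path of a new cell, whose bottom path \<open>b\<close>
  and inner vertices \<open>ns\<close> are new.\<close>

definition attach_at :: "'s diag \<Rightarrow> nat list \<Rightarrow> nat list \<Rightarrow> nat list \<Rightarrow> 's list \<Rightarrow> nat list \<Rightarrow> nat list
    \<Rightarrow> 's diag \<Rightarrow> bool" where
  "attach_at D \<alpha> t \<beta> v b ns D' \<longleftrightarrow> bot_path D = \<alpha> @ t @ \<beta> \<and> t \<noteq> [] \<and>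
     distinct b \<and> distinct ns \<and> length b = length v \<and> length b = Suc (length ns) \<and>
     set b \<inter> arcs D = {} \<and> set ns \<inter> verts D = {} \<and>
     verts D' = verts D \<union> set ns \<and> arcs D' = arcs D \<union> set b \<and>
     (\<forall>e\<in>arcs D. tail D' e = tail D e \<and> head D' e = head D e \<and> label D' e = label D e) \<and>
     map (tail D') b = tail D (hd t) # ns \<and> map (head D') b = ns @ [head D (last t)] \<and>
     path_label D' b = v \<and> cells D' = insert (t, b) (cells D) \<and>
     top_path D' = top_path D \<and> bot_path D' = \<alpha> @ b @ \<beta>"

definition attach :: "'s diag \<Rightarrow> 's step \<Rightarrow> 's diag \<Rightarrow> bool" where
  "attach D s D' \<longleftrightarrow> (\<exists>\<alpha> t \<beta> b ns. attach_at D \<alpha> t \<beta> (snd (snd s)) b ns D' \<and>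
     fst s = length \<alpha> \<and> path_label D t = fst (snd s))"

text \<open>A plane diagram can be swept from top to bottom, one cell at a time. This linear description of
  a diagram takes the place of sums and compositions in all later proofs.\<close>

inductive built :: "'s presentation \<Rightarrow> 's list \<Rightarrow> 's step list \<Rightarrow> 's diag \<Rightarrow> bool" for P y where
  built_line: "word P y \<Longrightarrow> is_line y D \<Longrightarrow> built P y [] D"
| built_attach: "built P y d D \<Longrightarrow> (u, v) \<in> sym_rels P \<Longrightarrow> attach D (i, u, v) D' \<Longrightarrow>
    built P y (d @ [(i, u, v)]) D'"

text \<open>The trace of planarity that the arguments use: the boundary paths are simple, and an edge lies on the
  top path of at most one cell and on the bottom path of at most one cell.\<close>

definition wf_diag :: "'s presentation \<Rightarrow> 's diag \<Rightarrow> bool" where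
  "wf_diag P D \<longleftrightarrow> finite (verts D) \<and> finite (arcs D) \<and>
     set (top_path D) \<subseteq> arcs D \<and> set (bot_path D) \<subseteq> arcs D \<and>
     (\<forall>e\<in>arcs D. tail D e \<in> verts D \<and> head D e \<in> verts D) \<and>
     simple_walk D (top_path D) \<and> simple_walk D (bot_path D) \<and>
     tail D (hd (bot_path D)) = initial_vertex D \<and> head D (last (bot_path D)) = terminal_vertex D \<and>
     (\<forall>(t, b)\<in>cells D. t \<noteq> [] \<and> b \<noteq> [] \<and> set t \<subseteq> arcs D \<and> set b \<subseteq> arcs D \<and> set t \<inter> set (bot_path D) = {} \<and> set b \<inter> set (top_path D) = {} \<and>
        (path_label D t, path_label D b) \<in> sym_rels P) \<and>
     (\<forall>(t, b)\<in>cells D. \<forall>(t', b')\<in>cells D. (t, b) \<noteq> (t', b') \<longrightarrow> set t \<inter> set t' = {} \<and> set b \<inter> set b' = {})"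

lemma wf_diagD:
  assumes "wf_diag P D"
  shows "finite (verts D)" "finite (arcs D)" "set (top_path D) \<subseteq> arcs D" "set (bot_path D) \<subseteq> arcs D"
    "\<And>e. e \<in> arcs D \<Longrightarrow> tail D e \<in> verts D" "\<And>e. e \<in> arcs D \<Longrightarrow> head D e \<in> verts D"
    "simple_walk D (top_path D)" "simple_walk D (bot_path D)"
    "tail D (hd (bot_path D)) = initial_vertex D" "head D (last (bot_path D)) = terminal_vertex D"
    "\<And>t b. (t, b) \<in> cells D \<Longrightarrow> set t \<subseteq> arcs D" "\<And>t b. (t, b) \<in> cells D \<Longrightarrow> set b \<subseteq> arcs D"
    "\<And>t b. (t, b) \<in> cells D \<Longrightarrow> set t \<inter> set (bot_path D) = {}"
    "\<And>t b. (t, b) \<in> cells D \<Longrightarrow> (path_label D t, path_label D b) \<in> sym_rels P"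
    "\<And>t b t' b'. (t, b) \<in> cells D \<Longrightarrow> (t', b') \<in> cells D \<Longrightarrow> (t, b) \<noteq> (t', b') \<Longrightarrow> set t \<inter> set t' = {}"
    "\<And>t b t' b'. (t, b) \<in> cells D \<Longrightarrow> (t', b') \<in> cells D \<Longrightarrow> (t, b) \<noteq> (t', b') \<Longrightarrow> set b \<inter> set b' = {}"
    "top_path D \<noteq> []" "bot_path D \<noteq> []"
    "\<And>t b. (t, b) \<in> cells D \<Longrightarrow> t \<noteq> []" "\<And>t b. (t, b) \<in> cells D \<Longrightarrow> b \<noteq> []"
    "\<And>t b. (t, b) \<in> cells D \<Longrightarrow> set b \<inter> set (top_path D) = {}"
proof -
  have c1: "\<forall>(t, b)\<in>cells D. t \<noteq> [] \<and> b \<noteq> [] \<and> set t \<subseteq> arcs D \<and> set b \<subseteq> arcs D \<and> set t \<inter> set (bot_path D) = {} \<and> set b \<inter> set (top_path D) = {} \<and>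
        (path_label D t, path_label D b) \<in> sym_rels P"
    and c2: "\<forall>(t, b)\<in>cells D. \<forall>(t', b')\<in>cells D. (t, b) \<noteq> (t', b') \<longrightarrow>
        set t \<inter> set t' = {} \<and> set b \<inter> set b' = {}"
    using assms unfolding wf_diag_def by - (elim conjE, assumption)+
  show "t \<noteq> []" "b \<noteq> []" "set b \<inter> set (top_path D) = {}" "set t \<subseteq> arcs D" "set b \<subseteq> arcs D" "set t \<inter> set (bot_path D) = {}"
    "(path_label D t, path_label D b) \<in> sym_rels P" if "(t, b) \<in> cells D" for t b
    using bspec[OF c1 that] by simp_all
  show "set t \<inter> set t' = {}" "set b \<inter> set b' = {}"
    if "(t, b) \<in> cells D" "(t', b') \<in> cells D" "(t, b) \<noteq> (t', b')" for t b t' b'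
    using bspec[OF c2 that(1)] that(2,3) by auto
  show "finite (verts D)" "finite (arcs D)" "set (top_path D) \<subseteq> arcs D" "set (bot_path D) \<subseteq> arcs D"
    "\<And>e. e \<in> arcs D \<Longrightarrow> tail D e \<in> verts D" "\<And>e. e \<in> arcs D \<Longrightarrow> head D e \<in> verts D"
    "simple_walk D (top_path D)" "simple_walk D (bot_path D)"
    "tail D (hd (bot_path D)) = initial_vertex D" "head D (last (bot_path D)) = terminal_vertex D"
    using assms by (simp_all add: wf_diag_def)
  then show "top_path D \<noteq> []" "bot_path D \<noteq> []" by (simp_all add: simple_walk_def)
qed

lemma set_path_verts:
  assumes "wf_diag P D" "p \<noteq> []" "set p \<subseteq> arcs D"
  shows "set (path_verts D p) \<subseteq> verts D"
proof -
  have "last p \<in> arcs D" using assms by (metis last_in_set subsetD)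
  then show ?thesis using assms wf_diagD(5,6)[OF assms(1)] by (auto simp: path_verts_def)
qed

lemma is_line_wf: "is_line y D \<Longrightarrow> wf_diag P D"
proof -
  assume l: "is_line y D"
  let ?p = "top_path D"
  have l: "simple_walk D ?p" "bot_path D = ?p" "arcs D = set ?p" "verts D = set (path_verts D ?p)"
    "cells D = {}" using l by (auto simp: is_line_def)
  have "tail D e \<in> verts D \<and> head D e \<in> verts D" if e: "e \<in> arcs D" for e
  proof -
    obtain i where "i < length ?p" "e = ?p ! i" using e l(3) by (auto simp: in_set_conv_nth)
    then show ?thesis using path_verts_nth[OF l(1)] l(4) nth_mem
      by (metis Suc_less_eq length_path_verts less_Suc_eq)
  qed
  then show ?thesis using l by (auto simp: wf_diag_def initial_vertex_def terminal_vertex_def)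
qed

lemma attach_atD:
  assumes "attach_at D \<alpha> t \<beta> v b ns D'"
  shows "bot_path D = \<alpha> @ t @ \<beta>" "t \<noteq> []" "distinct b" "distinct ns" "length b = length v"
     "length b = Suc (length ns)" "set b \<inter> arcs D = {}" "set ns \<inter> verts D = {}"
     "verts D' = verts D \<union> set ns" "arcs D' = arcs D \<union> set b"
     "\<And>e. e \<in> arcs D \<Longrightarrow> tail D' e = tail D e" "\<And>e. e \<in> arcs D \<Longrightarrow> head D' e = head D e"
     "\<And>e. e \<in> arcs D \<Longrightarrow> label D' e = label D e"
     "map (tail D') b = tail D (hd t) # ns" "map (head D') b = ns @ [head D (last t)]"
     "path_label D' b = v" "cells D' = insert (t, b) (cells D)"
     "top_path D' = top_path D" "bot_path D' = \<alpha> @ b @ \<beta>" "b \<noteq> []"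
  using assms unfolding attach_at_def by auto

text \<open>The new path \<open>b\<close> runs through new vertices from the first to the last vertex of \<open>t\<close>, so the new bottom
  path is again simple. The edges of \<open>t\<close> leave the bottom path, so they are never used as a top path again.\<close>

lemma attach_wf:
  assumes wf: "wf_diag P D" and a: "attach_at D \<alpha> t \<beta> v b ns D'"
    and rel: "(path_label D t, v) \<in> sym_rels P"
  shows "wf_diag P D'"
proof -
  note w = wf_diagD[OF wf] and a = attach_atD[OF a]
  have sub: "set \<alpha> \<subseteq> arcs D" "set t \<subseteq> arcs D" "set \<beta> \<subseteq> arcs D" using w(4) a(1) by auto
  have ht: "hd t \<in> arcs D" "last t \<in> arcs D" using sub a(2) by auto
  have hb: "tail D' (hd b) = tail D (hd t)" using a(14,20) by (cases b) auto
  have lb: "head D' (last b) = head D (last t)"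
    using a(15,20) by (metis last_map last_snoc)
  have tb: "tail D' e \<in> insert (tail D (hd t)) (set ns)" if "e \<in> set b" for e
    using that arg_cong[OF a(14), of set] by auto
  have hb': "head D' e \<in> insert (head D (last t)) (set ns)" if "e \<in> set b" for e
    using that arg_cong[OF a(15), of set] by auto
  have ends: "tail D' e \<in> verts D' \<and> head D' e \<in> verts D'" if "e \<in> arcs D'" for e
  proof (cases "e \<in> arcs D")
    case True then show ?thesis using w(5,6) by (simp add: a(9,11,12))
  next
    case False
    then have "e \<in> set b" using that a(10) by simp
    from tb[OF this] hb'[OF this] show ?thesis using w(5)[OF ht(1)] w(6)[OF ht(2)] by (auto simp: a(9))
  qed
  have same: "tail D' e = tail D e \<and> head D' e = head D e" if "e \<in> arcs D" for e
    using that a(11,12) by simp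
  have sp: "simple_walk D (\<alpha> @ t @ \<beta>)" using w(8) a(1) by simp
  have sb: "successively (\<lambda>e e'. head D' e = tail D' e') b"
    unfolding successively_conv_nth
  proof (intro allI impI)
    fix i assume i: "Suc i < length b"
    have "head D' (b ! i) = map (head D') b ! i" using i by simp
    also have "\<dots> = ns ! i" using i a(6) unfolding a(15) by (simp add: nth_append)
    also have "\<dots> = map (tail D') b ! Suc i" unfolding a(14) by simp
    finally show "head D' (b ! i) = tail D' (b ! Suc i)" using i by simp
  qed
  have s2: "successively (\<lambda>e e'. head D' e = tail D' e') p" if "successively (\<lambda>e e'. head D e = tail D e') p"
    "set p \<subseteq> arcs D" for p
    by (rule successively_mono[OF that(1)]) (use that(2) in \<open>auto simp: same subset_iff\<close>)
  have e2: "\<alpha> = [] \<or> head D' (last \<alpha>) = head D (last \<alpha>)" "\<beta> = [] \<or> tail D' (hd \<beta>) = tail D (hd \<beta>)"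
    using sub same last_in_set[of \<alpha>] hd_in_set[of \<beta>] by blast+
  have succ: "successively (\<lambda>e e'. head D' e = tail D' e') (\<alpha> @ b @ \<beta>)"
    using sp sb s2[of \<alpha>] s2[of \<beta>] sub ht a(2,20) hb lb e2
    by (auto simp: simple_walk_def successively_append_iff)
  define X where "X = (if \<beta> = [] then [head D (last t)] else map (tail D) \<beta> @ [head D (last \<beta>)])"
  have m: "map (tail D') p = map (tail D) p" if "set p \<subseteq> arcs D" for p
    using that same by auto
  have "path_verts D (\<alpha> @ t @ \<beta>) = map (tail D) \<alpha> @ map (tail D) t @ X"
    using a(2) by (simp add: path_verts_def X_def)
  then have dX: "distinct (map (tail D) \<alpha> @ map (tail D) t @ X)"
    using sp by (simp add: simple_walk_def)
  have Xv: "set X \<subseteq> verts D" using w(5,6) sub ht last_in_set[of \<beta>] by (auto simp: X_def subset_iff)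
  have "path_verts D' (\<alpha> @ b @ \<beta>) = map (tail D) \<alpha> @ (tail D (hd t) # ns) @ X"
  proof (cases "\<beta> = []")
    case True
    then show ?thesis using a(20) lb m[OF sub(1)] a(14) by (simp add: path_verts_def X_def)
  next
    case False
    then have "last \<beta> \<in> arcs D" using sub(3) by auto
    then show ?thesis using False m[OF sub(1)] m[OF sub(3)] a(14) same
      by (simp add: path_verts_def X_def)
  qed
  moreover have "tail D (hd t) \<in> set (map (tail D) t)" using a(2) by simp
  moreover have "set (map (tail D) \<alpha>) \<subseteq> verts D" using sub(1) w(5) by auto
  moreover have "tail D (hd t) \<in> verts D" using ht w(5) by simp
  ultimately have "distinct (path_verts D' (\<alpha> @ b @ \<beta>))"
    using dX Xv a(4,8) by auto
  then have spb: "simple_walk D' (bot_path D')" using succ a(19,20) by (simp add: simple_walk_def)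
  have spt: "simple_walk D' (top_path D')"
    using simple_walk_cong[of "top_path D" D' D] same w(3,7) a(18) by auto
  have pl: "path_label D' p = path_label D p" if "set p \<subseteq> arcs D" for p
    using that a(13) by (intro path_label_cong) auto
  have dt: "set t \<inter> set (\<alpha> @ b @ \<beta>) = {}"
    using simple_walk_distinct[OF sp] sub a(7) by auto
  have cell: "set t' \<subseteq> arcs D \<and> set b' \<subseteq> arcs D \<and> set t' \<inter> set t = {} \<and> set t' \<inter> set b = {} \<and> set b' \<inter> set b = {}
      \<and> set t' \<inter> set (\<alpha> @ b @ \<beta>) = {}" if "(t', b') \<in> cells D" for t' b'
    using w(11,12,13)[OF that] a(1,7) by auto
  have i1: "initial_vertex D' = initial_vertex D" "terminal_vertex D' = terminal_vertex D"
    unfolding initial_vertex_def terminal_vertex_def a(18)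
    using same[of "hd (top_path D)"] same[of "last (top_path D)"] w(3) hd_in_set[OF w(17)]
      last_in_set[OF w(17)] by auto
  have i2: "tail D' (hd (bot_path D')) = tail D (hd (bot_path D))"
    unfolding a(19) a(1) using hb a(2,20) same sub by (cases \<alpha>) auto
  have i3: "head D' (last (bot_path D')) = head D (last (bot_path D))"
    unfolding a(19) a(1) using lb a(2,20) same[of "last \<beta>"] subsetD[OF sub(3) last_in_set]
    by (cases "\<beta> = []") auto
  have disj: "set t1 \<inter> set t2 = {} \<and> set b1 \<inter> set b2 = {}"
    if c: "(t1, b1) \<in> cells D'" "(t2, b2) \<in> cells D'" "(t1, b1) \<noteq> (t2, b2)" for t1 b1 t2 b2
  proof -
    have c': "(t1, b1) = (t, b) \<or> (t1, b1) \<in> cells D" "(t2, b2) = (t, b) \<or> (t2, b2) \<in> cells D"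
      using c(1,2) a(17) by auto
    from c' c(3) consider "(t1, b1) = (t, b)" "(t2, b2) \<in> cells D" | "(t1, b1) \<in> cells D" "(t2, b2) = (t, b)"
      | "(t1, b1) \<in> cells D" "(t2, b2) \<in> cells D" by argo
    then show ?thesis
    proof cases
      case 1 then show ?thesis using cell[OF 1(2)] by auto
    next
      case 2 then show ?thesis using cell[OF 2(1)] by auto
    next
      case 3 then show ?thesis using w(15,16) c(3) by blast
    qed
  qed
  show ?thesis unfolding wf_diag_def
  proof (intro conjI)
    show "\<forall>(t, b)\<in>cells D'. t \<noteq> [] \<and> b \<noteq> [] \<and> set t \<subseteq> arcs D' \<and> set b \<subseteq> arcs D' \<and> set t \<inter> set (bot_path D') = {} \<and> set b \<inter> set (top_path D') = {} \<and>
        (path_label D' t, path_label D' b) \<in> sym_rels P"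
    proof (clarify)
      fix t' b' assume "(t', b') \<in> cells D'"
      then consider "t' = t" "b' = b" | "(t', b') \<in> cells D" using a(17) by auto
      then show "t' \<noteq> [] \<and> b' \<noteq> [] \<and> set t' \<subseteq> arcs D' \<and> set b' \<subseteq> arcs D' \<and> set t' \<inter> set (bot_path D') = {} \<and> set b' \<inter> set (top_path D') = {} \<and>
        (path_label D' t', path_label D' b') \<in> sym_rels P"
      proof cases
        case 1 then show ?thesis using dt sub rel a(2,7,10,16,18-20) w(3) pl[OF sub(2)] by auto
      next
        case 2 then show ?thesis using cell[OF 2] w(14)[OF 2] w(19-21)[OF 2] pl a(10,18,19) by auto
      qed
    qed
    show "\<forall>(t, b)\<in>cells D'. \<forall>(t', b')\<in>cells D'. (t, b) \<noteq> (t', b') \<longrightarrow>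
       set t \<inter> set t' = {} \<and> set b \<inter> set b' = {}"
    proof (intro ballI case_prodI2 impI)
      fix c t1 b1 c' t2 b2 assume "c \<in> cells D'" "c = (t1, b1)" "c' \<in> cells D'" "c' = (t2, b2)"
        "(t1, b1) \<noteq> (t2, b2)"
      then show "set t1 \<inter> set t2 = {} \<and> set b1 \<inter> set b2 = {}"
        using disj[of t1 b1 t2 b2] by simp
    qed
  qed (use w a ends spb spt i1 i2 i3 sub in \<open>auto\<close>)
qed

lemma built_wf: "built P y d D \<Longrightarrow> wf_diag P D"
proof (induction rule: built.induct)
  case (built_line D) then show ?case by (blast intro: is_line_wf)
next
  case (built_attach d D u v i D')
  then show ?case unfolding attach_def by (auto intro: attach_wf)
qed

lemma built_top_label: "built P y d D \<Longrightarrow> path_label D (top_path D) = y"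
proof (induction rule: built.induct)
  case (built_line D) then show ?case by (simp add: is_line_def)
next
  case (built_attach d D u v i D')
  from built_attach(3) obtain \<alpha> t \<beta> b ns where a: "attach_at D \<alpha> t \<beta> v b ns D'"
    by (auto simp: attach_def)
  have "set (top_path D) \<subseteq> arcs D" using built_wf[OF built_attach(1)] wf_diagD(3) by blast
  then have "path_label D' (top_path D) = path_label D (top_path D)"
    using attach_atD(13)[OF a] by (intro path_label_cong) auto
  then show ?case using built_attach(4) attach_atD(18)[OF a] by simp
qed

lemma attach_bot_label:
  assumes "wf_diag P D" "attach_at D \<alpha> t \<beta> v b ns D'"
  shows "path_label D (bot_path D) = path_label D \<alpha> @ path_label D t @ path_label D \<beta>"
    "path_label D' (bot_path D') = path_label D \<alpha> @ v @ path_label D \<beta>"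
proof -
  note w = wf_diagD[OF assms(1)] and a = attach_atD[OF assms(2)]
  have "set \<alpha> \<subseteq> arcs D" "set \<beta> \<subseteq> arcs D" using w(4) a(1) by auto
  then have "path_label D' \<alpha> = path_label D \<alpha>" "path_label D' \<beta> = path_label D \<beta>"
    using a(13) by (auto intro!: path_label_cong)
  then show "path_label D' (bot_path D') = path_label D \<alpha> @ v @ path_label D \<beta>"
    using a(16,19) by simp
qed (simp add: attach_atD(1)[OF assms(2)])

lemma built_bot_label: "built P y d D \<Longrightarrow> derivation P y d (path_label D (bot_path D))"
proof (induction rule: built.induct)
  case (built_line D) then show ?case by (simp add: is_line_def)
next
  case (built_attach d D u v i D')
  from built_attach(3) obtain \<alpha> t \<beta> b ns where a: "attach_at D \<alpha> t \<beta> v b ns D'"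
    "i = length \<alpha>" "u = path_label D t" by (auto simp: attach_def)
  note l = attach_bot_label[OF built_wf[OF built_attach(1)] a(1)]
  show ?case using built_attach(4) a(2,3) built_attach(2)
    unfolding l deriv_append deriv_Cons_iff
    by (intro exI[of _ "path_label D \<alpha> @ path_label D t @ path_label D \<beta>"] conjI
        exI[of _ "path_label D \<alpha>"] exI[of _ "path_label D \<beta>"]) auto
qed

lemma iso_viaD:
  assumes "iso_via fv fe D D'"
  shows "bij_betw fv (verts D) (verts D')" "bij_betw fe (arcs D) (arcs D')"
    "\<And>e. e \<in> arcs D \<Longrightarrow> tail D' (fe e) = fv (tail D e)"
    "\<And>e. e \<in> arcs D \<Longrightarrow> head D' (fe e) = fv (head D e)"
    "\<And>e. e \<in> arcs D \<Longrightarrow> label D' (fe e) = label D e"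
    "cells D' = map_prod (map fe) (map fe) ` cells D"
    "top_path D' = map fe (top_path D)" "bot_path D' = map fe (bot_path D)"
  using assms by (auto simp: iso_via_def)

text \<open>An isotopy of a diagram restricts to the diagram that existed before the last cell was attached.\<close>

lemma attach_iso_back:
  assumes wf: "wf_diag P D0" and att: "attach_at D0 \<alpha> t \<beta> v b ns D" and iso: "iso_via fv fe D D'"
  obtains D0' where "iso_via fv fe D0 D0'"
    "attach_at D0' (map fe \<alpha>) (map fe t) (map fe \<beta>) v (map fe b) (map fv ns) D'"
    "path_label D0' (map fe t) = path_label D0 t"
proof
  note w = wf_diagD[OF wf] and a = attach_atD[OF att] and i = iso_viaD[OF iso]
  define D0' where "D0' = D'\<lparr>verts := fv ` verts D0, arcs := fe ` arcs D0,
    cells := map_prod (map fe) (map fe) ` cells D0, top_path := map fe (top_path D0),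
    bot_path := map fe (bot_path D0)\<rparr>"
  have inj: "inj_on fv (verts D)" "inj_on fe (arcs D)" using i(1,2) by (auto simp: bij_betw_def)
  have t: "set t \<subseteq> arcs D0" using w(4) a(1) by auto
  have ht: "hd t \<in> arcs D0" "last t \<in> arcs D0" using t a(2) by auto
  show iso0: "iso_via fv fe D0 D0'"
    unfolding iso_via_def D0'_def using inj i(3,4,5) a(9-13)
    by (auto simp: bij_betw_def intro: inj_on_subset)
  show "path_label D0' (map fe t) = path_label D0 t" by (rule path_label_iso[OF iso0 t])
  have bimg: "fe ` set b \<inter> fe ` arcs D0 = {}"
    using inj_on_image_Int[OF inj(2), of "set b" "arcs D0"] a(7,10) by auto
  have nimg: "fv ` set ns \<inter> fv ` verts D0 = {}"
    using inj_on_image_Int[OF inj(1), of "set ns" "verts D0"] a(8,9) by auto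
  have d: "distinct (map fe b)" "distinct (map fv ns)"
    using a(3,4,9,10) inj by (auto simp: distinct_map intro: inj_on_subset)
  have im: "verts D' = fv ` verts D" "arcs D' = fe ` arcs D" using i(1,2) by (auto simp: bij_betw_def)
  have tl: "map (tail D') (map fe b) = map fv (map (tail D) b)"
    "map (head D') (map fe b) = map fv (map (head D) b)"
    using i(3,4) a(10) by auto
  have hts: "tail D' (fe (hd t)) = fv (tail D0 (hd t))" "head D' (fe (last t)) = fv (head D0 (last t))"
    using ht i(3,4) a(10,11,12) by auto
  have lb: "path_label D' (map fe b) = v" using path_label_iso[OF iso, of b] a(10,16) by simp
  show "attach_at D0' (map fe \<alpha>) (map fe t) (map fe \<beta>) v (map fe b) (map fv ns) D'"
    unfolding attach_at_def
    using a(1,2,5,6,17,18,19) bimg nimg d im tl[unfolded a(14,15)] hts lb i(6-8) unfolding a(9,10)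
    by (simp add: D0'_def image_Un hd_map last_map)
qed

lemma built_iso:
  "built P y d D \<Longrightarrow> iso_via fv fe D D' \<Longrightarrow> built P y d D'"
proof (induction arbitrary: D' rule: built.induct)
  case (built_line D)
  then show ?case by (blast intro: built.built_line is_line_iso)
next
  case (built_attach d D0 u v i D)
  from built_attach(3) obtain \<alpha> t \<beta> b ns where a: "attach_at D0 \<alpha> t \<beta> v b ns D"
    "i = length \<alpha>" "u = path_label D0 t" by (auto simp: attach_def)
  from attach_iso_back[OF built_wf[OF built_attach(1)] a(1) built_attach(5)]
  obtain D0' where D0': "iso_via fv fe D0 D0'"
    "attach_at D0' (map fe \<alpha>) (map fe t) (map fe \<beta>) v (map fe b) (map fv ns) D'"
    "path_label D0' (map fe t) = path_label D0 t" .
  have "attach D0' (i, u, v) D'" unfolding attach_def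
    by (rule exI[of _ "map fe \<alpha>"], rule exI[of _ "map fe t"], rule exI[of _ "map fe \<beta>"],
        rule exI[of _ "map fe b"], rule exI[of _ "map fv ns"]) (use D0'(2,3) a(2,3) in simp)
  from built.built_attach[OF built_attach(4)[OF D0'(1)] built_attach(2) this] show ?case .
qed

lemma built_isotopic: "built P y d D \<Longrightarrow> isotopic D D' \<Longrightarrow> built P y d D'"
  unfolding isotopic_iff by (blast intro: built_iso)

text \<open>The names of the new edges and vertices are the only choice made by an attachment.\<close>

lemma attach_unique:
  assumes wf: "wf_diag P D0" and att: "attach_at D0 \<alpha> t \<beta> v b ns D"
    and att': "attach_at D0' \<alpha>' t' \<beta>' v b' ns' D'" and iso: "iso_via fv fe D0 D0'"
    and len: "length \<alpha> = length \<alpha>'" "length t = length t'"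
  shows "isotopic D D'"
proof -
  note w = wf_diagD[OF wf] and a = attach_atD[OF att] and a' = attach_atD[OF att'] and i = iso_viaD[OF iso]
  obtain ge where ge: "map ge b = b'" "bij_betw ge (set b) (set b')"
    using obtain_list_bij a(3,5) a'(3,5) by metis
  obtain gv where gv: "map gv ns = ns'" "bij_betw gv (set ns) (set ns')"
    using obtain_list_bij[OF a(4) a'(4)] a(5,6) a'(5,6) by auto
  define fe' where "fe' = (\<lambda>e. if e \<in> arcs D0 then fe e else ge e)"
  define fv' where "fv' = (\<lambda>e. if e \<in> verts D0 then fv e else gv e)"
  have old: "map fe' p = map fe p" if "set p \<subseteq> arcs D0" for p
    using that by (auto simp: fe'_def)
  have oldv: "fv' x = fv x" if "x \<in> verts D0" for x using that by (simp add: fv'_def)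
  have new: "map fe' b = b'" "map fv' ns = ns'"
    using a(7,8) ge(1) gv(1) by (auto simp: fe'_def fv'_def intro!: map_cong)
  have sub: "set \<alpha> \<subseteq> arcs D0" "set t \<subseteq> arcs D0" "set \<beta> \<subseteq> arcs D0" using w(4) a(1) by auto
  have split: "\<alpha>' = map fe \<alpha>" "t' = map fe t" "\<beta>' = map fe \<beta>"
    using i(8) len unfolding a(1) a'(1) by auto
  have "bij_betw fe' (arcs D0) (arcs D0') = bij_betw fe (arcs D0) (arcs D0')"
    "bij_betw fv' (verts D0) (verts D0') = bij_betw fv (verts D0) (verts D0')"
    "bij_betw fe' (set b) (set b') = bij_betw ge (set b) (set b')"
    "bij_betw fv' (set ns) (set ns') = bij_betw gv (set ns) (set ns')"
    using a(7,8) by (intro bij_betw_cong; auto simp: fe'_def fv'_def)+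
  then have "bij_betw fe' (arcs D0) (arcs D0')" "bij_betw fv' (verts D0) (verts D0')"
    "bij_betw fe' (set b) (set b')" "bij_betw fv' (set ns) (set ns')" using i(1,2) ge gv by simp_all
  then have bij: "bij_betw fe' (arcs D) (arcs D')" "bij_betw fv' (verts D) (verts D')"
    unfolding a(9,10) a'(9,10) using a'(7,8) by (simp_all add: bij_betw_combine Int_commute)
  have ht: "hd t \<in> arcs D0" "last t \<in> arcs D0" using sub(2) a(2) by auto
  have ht': "tail D0' (hd t') = fv' (tail D0 (hd t))" "head D0' (last t') = fv' (head D0 (last t))"
    using ht i(3,4) a(2) w(5,6) oldv by (auto simp: split hd_map last_map)
  have "map (tail D') b' = map fv' (map (tail D) b)" "map (head D') b' = map fv' (map (head D) b)"
    unfolding a(14,15) a'(14,15) using ht' new(2) by simp_all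
  then have endb: "tail D' (fe' e) = fv' (tail D e)" "head D' (fe' e) = fv' (head D e)" if "e \<in> set b" for e
    using that unfolding new(1)[symmetric] by auto
  have "map (label D') b' = map (label D) b" using a(16) a'(16) by (simp add: path_label_def)
  then have labb: "label D' (fe' e) = label D e" if "e \<in> set b" for e
    using that unfolding new(1)[symmetric] by auto
  have olde: "tail D' (fe' e) = fv' (tail D e) \<and> head D' (fe' e) = fv' (head D e) \<and> label D' (fe' e) = label D e"
    if e: "e \<in> arcs D0" for e
  proof -
    have "fe e \<in> arcs D0'" using e i(2) by (auto simp: bij_betw_def)
    then show ?thesis using e a(11-13) a'(11-13) i(3-5) w(5,6) oldv by (simp add: fe'_def)
  qed
  have cells: "cells D' = map_prod (map fe') (map fe') ` cells D"
  proof -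
    have "map_prod (map fe) (map fe) ` cells D0 = map_prod (map fe') (map fe') ` cells D0"
    proof (intro image_cong refl)
      fix c assume c: "c \<in> cells D0"
      obtain t1 b1 where "c = (t1, b1)" by (cases c)
      with c old[OF w(11), of t1 b1] old[OF w(12), of t1 b1]
      show "map_prod (map fe) (map fe) c = map_prod (map fe') (map fe') c" by simp
    qed
    then show ?thesis unfolding a(17) a'(17) i(6)
      by (simp only: image_insert map_prod_simp old[OF sub(2)] new(1) split(2))
  qed
  have "iso_via fv' fe' D D'" unfolding iso_via_def
    using bij endb labb olde cells a(10,18,19) a'(18,19) i(7) old[OF w(3)] old[OF sub(1)] old[OF sub(3)] new(1)
    by (auto simp: split)
  then show ?thesis unfolding isotopic_iff by blast
qed

lemma built_NilD: "built P y [] D \<Longrightarrow> is_line y D \<and> word P y"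
  by (erule built.cases) auto

lemma built_snocE:
  assumes "built P y (d @ [(i, u, v)]) D"
  obtains D0 \<alpha> t \<beta> b ns where "built P y d D0" "(u, v) \<in> sym_rels P" "attach_at D0 \<alpha> t \<beta> v b ns D"
    "i = length \<alpha>" "u = path_label D0 t" "attach D0 (i, u, v) D"
proof -
  from assms obtain D0 where D0: "built P y d D0" "(u, v) \<in> sym_rels P" "attach D0 (i, u, v) D"
    by (cases rule: built.cases) auto
  from D0(3) obtain \<alpha> t \<beta> b ns where "attach_at D0 \<alpha> t \<beta> v b ns D" "i = length \<alpha>" "u = path_label D0 t"
    by (auto simp: attach_def)
  from that[OF D0(1,2) this D0(3)] show thesis .
qed

lemma built_unique: "built P y d D \<Longrightarrow> built P y d D' \<Longrightarrow> isotopic D D'"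
proof (induction arbitrary: D' rule: built.induct)
  case (built_line D)
  then show ?case by (blast intro: is_line_unique dest: built_NilD)
next
  case (built_attach d D0 u v i D)
  from built_attach(3) obtain \<alpha> t \<beta> b ns where a: "attach_at D0 \<alpha> t \<beta> v b ns D"
    "i = length \<alpha>" "u = path_label D0 t" by (auto simp: attach_def)
  from built_attach(5) obtain D0' \<alpha>' t' \<beta>' b' ns' where a': "built P y d D0'"
    "attach_at D0' \<alpha>' t' \<beta>' v b' ns' D'" "i = length \<alpha>'" "u = path_label D0' t'"
    by (rule built_snocE)
  from built_attach(4)[OF a'(1)] obtain fv fe where "iso_via fv fe D0 D0'" by (auto simp: isotopic_iff)
  from attach_unique[OF built_wf[OF built_attach(1)] a(1) a'(2) this] a(2,3) a'(3,4)
  show ?case by (metis path_label_simps(3))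
qed

text \<open>Two cells attached at disjoint segments may be attached in either order, with the same graph as result.
  Only the intermediate graph differs: it is the final one without the first cell.\<close>

lemma attach_exchange:
  assumes wf: "wf_diag P D" and "attach D (i, u, v) D1" "attach D1 (i + length v + k, u', v') D2"
  obtains D1' where "attach D (i + length u + k, u', v') D1'" "attach D1' (i, u, v) D2"
proof -
  from assms obtain \<alpha> t \<beta> b ns where att: "attach_at D \<alpha> t \<beta> v b ns D1"
    "i = length \<alpha>" "u = path_label D t" by (auto simp: attach_def)
  from assms obtain \<alpha>2 t2 \<beta>2 b2 ns2 where att2: "attach_at D1 \<alpha>2 t2 \<beta>2 v' b2 ns2 D2"
    "i + length v + k = length \<alpha>2" "u' = path_label D1 t2" by (auto simp: attach_def)
  note w = wf_diagD[OF wf] and a = attach_atD[OF att(1)] and a2 = attach_atD[OF att2(1)]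
  have "\<exists>\<gamma>. \<alpha>2 = (\<alpha> @ b) @ \<gamma> \<and> \<beta> = \<gamma> @ (t2 @ \<beta>2)"
    using a(5,19) a2(1) att(2) att2(2) by (intro append_prefix_split) auto
  then obtain \<gamma> where \<gamma>: "\<alpha>2 = \<alpha> @ b @ \<gamma>" "\<beta> = \<gamma> @ t2 @ \<beta>2" by auto
  have k: "k = length \<gamma>" using \<gamma>(1) att(2) att2(2) a(5) by simp
  have sub: "set t \<subseteq> arcs D" "set t2 \<subseteq> arcs D" using w(4) unfolding a(1) \<gamma>(2) by auto
  have ht: "hd t \<in> arcs D" "last t \<in> arcs D" "hd t2 \<in> arcs D" "last t2 \<in> arcs D"
    using sub a(2) a2(2) by auto
  have lt2: "path_label D1 t2 = path_label D t2" using sub(2) a(13) by (intro path_label_cong) auto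
  define D1' where "D1' = D2\<lparr>verts := verts D \<union> set ns2, arcs := arcs D \<union> set b2,
    cells := insert (t2, b2) (cells D), bot_path := \<alpha> @ t @ \<gamma> @ b2 @ \<beta>2\<rparr>"
  have same: "tail D2 e = tail D e" "head D2 e = head D e" "label D2 e = label D e" if "e \<in> arcs D" for e
    using that a(10-13) a2(11-13) by auto
  have same1: "map (tail D2) b = map (tail D1) b" "map (head D2) b = map (head D1) b"
      "path_label D2 b = path_label D1 b"
    using a2(11-13) a(10) by (auto intro: path_label_cong)
  have "attach_at D (\<alpha> @ t @ \<gamma>) t2 \<beta>2 v' b2 ns2 D1'"
    unfolding attach_at_def using a a2 \<gamma> ht same
    by (auto simp: D1'_def path_label_def)
  then have "attach D (i + length u + k, u', v') D1'"
    unfolding attach_def using att(2,3) k lt2 att2(3)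
    by (intro exI[of _ "\<alpha> @ t @ \<gamma>"] exI[of _ t2] exI[of _ \<beta>2] exI[of _ b2] exI[of _ ns2]) simp
  have "attach_at D1' \<alpha> t (\<gamma> @ b2 @ \<beta>2) v b ns D2"
    unfolding attach_at_def using a(2-6) a2(18,19) \<gamma> ht same same1 a(7-10,14-18) a2(7-10,17)
    by (auto simp: D1'_def)
  moreover have "path_label D1' t = path_label D t"
    using same sub(1) by (intro path_label_cong) (auto simp: D1'_def)
  ultimately have "attach D1' (i, u, v) D2"
    unfolding attach_def using att(2,3)
    by (intro exI[of _ \<alpha>] exI[of _ t] exI[of _ "\<gamma> @ b2 @ \<beta>2"] exI[of _ b] exI[of _ ns]) simp
  with \<open>attach D (i + length u + k, u', v') D1'\<close> show thesis by (rule that)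
qed

lemma built_exchange:
  "built P y (d @ [(i, u, v), (i + length v + k, u', v')] @ d') D \<Longrightarrow>
   built P y (d @ [(i + length u + k, u', v'), (i, u, v)] @ d') D"
proof (induction d' arbitrary: D rule: rev_induct)
  case Nil
  then have "built P y ((d @ [(i, u, v)]) @ [(i + length v + k, u', v')]) D" by simp
  then obtain D1 where D1: "built P y (d @ [(i, u, v)]) D1" "attach D1 (i + length v + k, u', v') D"
    "(u', v') \<in> sym_rels P"
    by (rule built_snocE)
  from D1(1) obtain D0 where D0: "built P y d D0" "attach D0 (i, u, v) D1" "(u, v) \<in> sym_rels P"
    by (rule built_snocE)
  from attach_exchange[OF built_wf[OF D0(1)] D0(2) D1(2)] obtain D1' where
    "attach D0 (i + length u + k, u', v') D1'" "attach D1' (i, u, v) D" .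
  then show ?case using D0 D1 built_attach[of P y "d @ [(i + length u + k, u', v')]"]
    by (auto dest: built_attach)
next
  case (snoc s d')
  obtain j x z where s: "s = (j, x, z)" by (cases s)
  from snoc.prems have "built P y ((d @ [(i, u, v), (i + length v + k, u', v')] @ d') @ [(j, x, z)]) D"
    by (simp add: s)
  then obtain D0 where "built P y (d @ [(i, u, v), (i + length v + k, u', v')] @ d') D0"
    "attach D0 (j, x, z) D" "(x, z) \<in> sym_rels P" by (rule built_snocE)
  from built_attach[OF snoc.IH[OF this(1)] this(3,2)] show ?case by (simp add: s)
qed

subsection \<open>Cancelling pairs are dipoles\<close>

text \<open>A map that folds \<open>ys\<close> onto \<open>xs\<close> and fixes everything else identifies corresponding entries, and nothing else,
  because the entries of \<open>xs\<close> are fixed and distinct.\<close>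

lemma identifies_exactly_retract:
  assumes f: "map f ys = xs" "\<And>x. x \<notin> set ys \<Longrightarrow> f x = x" and d: "set xs \<inter> set ys = {}" "distinct xs"
  shows "f x = f y \<longleftrightarrow> x = y \<or> (x, y) \<in> set (zip xs ys) \<or> (y, x) \<in> set (zip xs ys)"
proof -
  have len: "length xs = length ys" using f(1) by auto
  have nth: "f (ys ! i) = xs ! i" if "i < length ys" for i
    using that arg_cong[OF f(1), of "\<lambda>l. l ! i"] by simp
  have z: "(x, y) \<in> set (zip xs ys) \<longleftrightarrow> (\<exists>i<length ys. x = xs ! i \<and> y = ys ! i)" for x y
    using len by (auto simp: set_zip)
  have fy: "f y \<in> set xs" if "y \<in> set ys" for y using that f(1) by auto
  have z': "(x, y) \<in> set (zip xs ys) \<longleftrightarrow> y \<in> set ys \<and> x = f y" for x y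
    unfolding z using nth by (auto simp: in_set_conv_nth)
  have inj: "x = y" if "x \<in> set ys" "y \<in> set ys" "f x = f y" for x y
    using that d(2) f(1) by (metis distinct_map inj_onD)
  have nx: "f x \<notin> set ys" if "x \<in> set ys" for x using fy[OF that] d(1) by blast
  show ?thesis
  proof (cases "x \<in> set ys"; cases "y \<in> set ys")
    assume "x \<in> set ys" "y \<in> set ys"
    then show ?thesis using inj[of x y] nx[of x] nx[of y] unfolding z' by metis
  next
    assume "x \<in> set ys" "y \<notin> set ys"
    then show ?thesis using f(2)[of y] nx[of x] unfolding z' by metis
  next
    assume "x \<notin> set ys" "y \<in> set ys"
    then show ?thesis using f(2)[of x] nx[of y] unfolding z' by metis
  next
    assume "x \<notin> set ys" "y \<notin> set ys"
    then show ?thesis using f(2)[of x] f(2)[of y] unfolding z' by metis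
  qed
qed

text \<open>A form of \<^const>\<open>dipole_removal\<close> whose quotient maps send the diagram into itself and are the
  identity outside. The same maps then still work after further cells have been attached, since new
  edges and vertices are not touched by them.\<close>

definition removal_via :: "nat list \<Rightarrow> nat list \<Rightarrow> nat list \<Rightarrow> (nat \<Rightarrow> nat) \<Rightarrow> (nat \<Rightarrow> nat) \<Rightarrow> 's diag \<Rightarrow> 's diag \<Rightarrow> bool" where
  "removal_via p r q fv fe D D' \<longleftrightarrow> dipole D p r q \<and> set r \<inter> set (bot_path D) = {} \<and> set r \<inter> set (top_path D) = {} \<and> r \<noteq> [] \<and>
     (\<forall>n. n \<notin> verts D \<longrightarrow> fv n = n) \<and> (\<forall>e. e \<notin> arcs D \<longrightarrow> fe e = e) \<and>
     fv ` verts D \<subseteq> verts D \<and> fe ` arcs D \<subseteq> arcs D \<and>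
     identifies_exactly fv UNIV (path_verts D p) (path_verts D q) \<and>
     identifies_exactly fe UNIV p q \<and>
     verts D' = fv ` (verts D - inner_verts D r) \<and>
     arcs D' = fe ` (arcs D - set r) \<and>
     (\<forall>e\<in>arcs D - set r. tail D' (fe e) = fv (tail D e) \<and> head D' (fe e) = fv (head D e) \<and>
        label D' (fe e) = label D e) \<and>
     cells D' = map_prod (map fe) (map fe) ` (cells D - {(p, r), (r, q)}) \<and>
     top_path D' = map fe (top_path D) \<and> bot_path D' = map fe (bot_path D)"

lemma removal_viaD:
  assumes "removal_via p r q fv fe D D'"
  shows "dipole D p r q" "set r \<inter> set (bot_path D) = {}" "set r \<inter> set (top_path D) = {}" "r \<noteq> []"
     "\<And>n. n \<notin> verts D \<Longrightarrow> fv n = n" "\<And>e. e \<notin> arcs D \<Longrightarrow> fe e = e"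
     "fv ` verts D \<subseteq> verts D" "fe ` arcs D \<subseteq> arcs D"
     "identifies_exactly fv UNIV (path_verts D p) (path_verts D q)"
     "identifies_exactly fe UNIV p q"
     "verts D' = fv ` (verts D - inner_verts D r)" "arcs D' = fe ` (arcs D - set r)"
     "\<And>e. e \<in> arcs D \<Longrightarrow> e \<notin> set r \<Longrightarrow> tail D' (fe e) = fv (tail D e)"
     "\<And>e. e \<in> arcs D \<Longrightarrow> e \<notin> set r \<Longrightarrow> head D' (fe e) = fv (head D e)"
     "\<And>e. e \<in> arcs D \<Longrightarrow> e \<notin> set r \<Longrightarrow> label D' (fe e) = label D e"
     "cells D' = map_prod (map fe) (map fe) ` (cells D - {(p, r), (r, q)})"
     "top_path D' = map fe (top_path D)" "bot_path D' = map fe (bot_path D)"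
  using assms unfolding removal_via_def by auto

lemma removal_via_dipole_removal: "removal_via p r q fv fe D D' \<Longrightarrow> dipole_removal D D'"
  unfolding dipole_removal_def
  by (rule exI[of _ p], rule exI[of _ r], rule exI[of _ q], rule exI[of _ fv], rule exI[of _ fe])
    (auto simp: removal_via_def identifies_exactly_def)

lemma heads_of_walk:
  assumes "successively (\<lambda>e e'. head D e = tail D e') t" "t \<noteq> []"
  shows "map (head D) t = map (tail D) (tl t) @ [head D (last t)]"
  using assms by (induction t rule: induct_list012) auto

text \<open>After a cell and its mirror image have been attached below \<open>t\<close>, the lowest path \<open>b2\<close> is a copy of \<open>t\<close>.
  Folding \<open>b2\<close> onto \<open>t\<close> and deleting the path between them restores the original diagram, with its own names.\<close>

lemma attach_cancel:
  assumes wf: "wf_diag P D0" and s1: "attach D0 (i, u, v) D1" and s2: "attach D1 (i, v, u) D2"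
  shows "\<exists>p r q fv fe. removal_via p r q fv fe D2 D0"
proof -
  from s1 obtain \<alpha> t \<beta> b ns where att: "attach_at D0 \<alpha> t \<beta> v b ns D1"
    "i = length \<alpha>" "u = path_label D0 t" by (auto simp: attach_def)
  from s2 obtain \<alpha>2 t2 \<beta>2 b2 ns2 where att2: "attach_at D1 \<alpha>2 t2 \<beta>2 u b2 ns2 D2"
    "i = length \<alpha>2" "v = path_label D1 t2" by (auto simp: attach_def)
  note w = wf_diagD[OF wf] and a = attach_atD[OF att(1)] and a2 = attach_atD[OF att2(1)]
  have "length b = length t2" using a(5) att2(3) by simp
  then have split: "\<alpha>2 = \<alpha>" "t2 = b" "\<beta>2 = \<beta>" using a(19) a2(1) att(2) att2(2) by auto
  have len: "length b2 = length t" using a2(5) att(3) by simp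
  have sub: "set t \<subseteq> arcs D0" "set \<alpha> \<subseteq> arcs D0" "set \<beta> \<subseteq> arcs D0" using w(4) unfolding a(1) by auto
  have ht: "hd t \<in> arcs D0" "last t \<in> arcs D0" using sub a(2) by auto
  have walk: "successively (\<lambda>e e'. head D0 e = tail D0 e') t" "distinct (map (tail D0) t)" "distinct t"
     "head D0 (last t) \<notin> set (map (tail D0) t)"
  proof -
    have sp: "simple_walk D0 (\<alpha> @ t @ \<beta>)" using w(8) a(1) by simp
    then show "successively (\<lambda>e e'. head D0 e = tail D0 e') t" "distinct (map (tail D0) t)"
      by (auto simp: simple_walk_def path_verts_def successively_append_iff)
    then show "distinct t" by (simp add: distinct_map)
    show "head D0 (last t) \<notin> set (map (tail D0) t)"
      using sp a(2) by (cases \<beta>) (auto simp: simple_walk_def path_verts_def successively_append_iff)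
  qed
  \<comment> \<open>The inner vertices of \<open>t\<close>; the inner vertices \<open>ns2\<close> of the copy are folded onto them.\<close>
  define nt where "nt = map (tail D0) (tl t)"
  have heads: "map (head D0) t = nt @ [head D0 (last t)]"
    unfolding nt_def by (rule heads_of_walk[OF walk(1) a(2)])
  have tails: "map (tail D0) t = tail D0 (hd t) # nt" using a(2) by (cases t) (auto simp: nt_def)
  have ntv: "set nt \<subseteq> verts D0" using sub w(5) by (auto simp: nt_def dest: list.set_sel(2)[OF a(2)])
  have b2: "set b2 \<inter> arcs D0 = {}" "set b2 \<inter> set b = {}" using a2(7) a(10) by auto
  have ns2: "set ns2 \<inter> verts D0 = {}" "set ns2 \<inter> set ns = {}" using a2(8) a(9) by auto
  obtain ge where ge: "map ge b2 = t" using obtain_list_bij[OF a2(3) walk(3) len] by metis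
  have lenn: "length ns2 = length nt" using a2(6) len by (simp add: nt_def)
  have dnt: "distinct nt" using walk(2) tails by simp
  obtain gv where gv: "map gv ns2 = nt" using obtain_list_bij[OF a2(4) dnt lenn] by metis
  define fe where "fe = (\<lambda>e. if e \<in> set b2 then ge e else e)"
  define fv where "fv = (\<lambda>e. if e \<in> set ns2 then gv e else e)"
  have fe: "map fe b2 = t" using ge by (auto simp: fe_def)
  have fv: "map fv ns2 = nt" using gv by (auto simp: fv_def)
  have feid: "map fe p = p" if "set p \<subseteq> arcs D0" for p
    using that b2(1) by (intro map_idI) (auto simp: fe_def)
  have fvid: "fv x = x" if "x \<in> verts D0" for x using that ns2(1) by (auto simp: fv_def)
  have arcs2: "arcs D2 = arcs D0 \<union> set b \<union> set b2" using a(10) a2(10) by simp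
  have verts2: "verts D2 = verts D0 \<union> set ns \<union> set ns2" using a(9) a2(9) by simp
  have same: "tail D2 e = tail D0 e" "head D2 e = head D0 e" "label D2 e = label D0 e" if "e \<in> arcs D0" for e
    using that a(10-13) a2(11-13) by auto
  have tb: "map (tail D2) b = tail D0 (hd t) # ns" "map (head D2) b = ns @ [head D0 (last t)]"
    unfolding a(14,15)[symmetric] using a(10) a2(11,12) by auto
  have hb: "tail D1 (hd b) = tail D0 (hd t)" "head D1 (last b) = head D0 (last t)"
    using hd_map[OF a(20), of "tail D1"] last_map[OF a(20), of "head D1"] unfolding a(14,15) by simp_all
  have tb2: "map (tail D2) b2 = tail D0 (hd t) # ns2" "map (head D2) b2 = ns2 @ [head D0 (last t)]"
    using a2(14,15) hb split by auto
  have inner: "inner_verts D2 b = set ns"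
    using tb(1) a(20) by (cases b) (auto simp: inner_verts_def)
  have lab: "path_label D2 t = u" using att(3) same(3) sub(1) by (auto simp: path_label_def subset_iff)
  have lab2: "map (label D0) t = map (label D2) b2" using a2(16) att(3) by (simp add: path_label_def)
  have pvt: "path_verts D2 t = tail D0 (hd t) # nt @ [head D0 (last t)]"
    using a(2) ht same sub tails by (auto simp: path_verts_def subset_iff)
  have "last b2 = last b2 \<and> head D2 (last b2) = head D0 (last t)"
    using tb2(2) a2(20) by (metis last_map last_snoc)
  then have pvb: "path_verts D2 b2 = tail D0 (hd t) # ns2 @ [head D0 (last t)]"
    using tb2(1) by (simp add: path_verts_def)
  have cells: "cells D2 = insert (b, b2) (insert (t, b) (cells D0))" using a(17) a2(17) split by simp
  have notin: "(b, x) \<notin> cells D0" "(x, b) \<notin> cells D0" for x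
    using w(11)[of b x] w(12)[of x b] a(7,20) by (auto simp: neq_Nil_conv)
  have idv: "identifies_exactly fv UNIV (path_verts D2 t) (path_verts D2 b2)"
  proof -
    have "fv x = fv y \<longleftrightarrow> x = y \<or> (x, y) \<in> set (zip nt ns2) \<or> (y, x) \<in> set (zip nt ns2)" for x y
      by (rule identifies_exactly_retract[OF fv]) (use ntv ns2 dnt in \<open>auto simp: fv_def\<close>)
    then show ?thesis unfolding identifies_exactly_def pvt pvb using lenn by auto
  qed
  have ide: "identifies_exactly fe UNIV t b2"
  proof -
    have "fe x = fe y \<longleftrightarrow> x = y \<or> (x, y) \<in> set (zip t b2) \<or> (y, x) \<in> set (zip t b2)" for x y
      by (rule identifies_exactly_retract[OF fe]) (use sub(1) b2(1) walk(3) in \<open>auto simp: fe_def\<close>)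
    then show ?thesis unfolding identifies_exactly_def by blast
  qed
  have ends: "tail D0 (fe e) = fv (tail D2 e) \<and> head D0 (fe e) = fv (head D2 e) \<and> label D0 (fe e) = label D2 e"
    if e: "e \<in> arcs D2 - set b" for e
  proof (cases "e \<in> set b2")
    case False
    then have "e \<in> arcs D0" using e arcs2 by auto
    then show ?thesis using False same w(5,6) fvid by (simp add: fe_def)
  next
    case True
    have "map (tail D0) (map fe b2) = map fv (map (tail D2) b2)"
      "map (head D0) (map fe b2) = map fv (map (head D2) b2)"
      "map (label D0) (map fe b2) = map (label D2) b2"
      unfolding fe tb2 tails heads using lab2 fv fvid w(5,6) ht by auto
    then show ?thesis using True by auto
  qed
  have img: "fv ` set ns2 = set nt" "fe ` set b2 = set t"
    using arg_cong[OF fv, of set] arg_cong[OF fe, of set] by auto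
  have img': "fv ` verts D0 = verts D0" "fe ` arcs D0 = arcs D0"
    using fvid b2(1) by (auto simp: fe_def image_def)
  have va: "verts D2 - inner_verts D2 b = verts D0 \<union> set ns2" "arcs D2 - set b = arcs D0 \<union> set b2"
    unfolding inner verts2 arcs2 using a(7,8) b2 ns2 by auto
  have "map_prod (map fe) (map fe) ` cells D0 = cells D0"
  proof -
    have "map_prod (map fe) (map fe) c = c" if "c \<in> cells D0" for c
      using that feid[OF w(11), of "fst c" "snd c"] feid[OF w(12), of "fst c" "snd c"] by (cases c) auto
    then show ?thesis by (auto simp: image_def)
  qed
  moreover have "cells D2 - {(t, b), (b, b2)} = cells D0" using cells notin by auto
  moreover have "bot_path D0 = map fe (bot_path D2)"
    using a(1) a2(19) split fe feid sub by simp
  moreover have "top_path D0 = map fe (top_path D2)" using a(18) a2(18) feid w(3) by simp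
  moreover have "set b \<inter> set (bot_path D2) = {}" using a2(19) split sub a(7) b2 by auto
  moreover have "set b \<inter> set (top_path D2) = {}" using a(7,18) a2(18) w(3) by auto
  moreover have "dipole D2 t b b2" using cells lab a2(16) by (simp add: dipole_def)
  moreover have "fv ` verts D2 \<subseteq> verts D2" "fe ` arcs D2 \<subseteq> arcs D2"
    unfolding verts2 arcs2 image_Un img img' using ntv sub ns2 b2 by (auto simp: fv_def fe_def)
  moreover have "fv n = n" if "n \<notin> verts D2" for n using that verts2 by (auto simp: fv_def)
  moreover have "fe e = e" if "e \<notin> arcs D2" for e using that arcs2 by (auto simp: fe_def)
  moreover have "verts D0 = fv ` (verts D2 - inner_verts D2 b)" "arcs D0 = fe ` (arcs D2 - set b)"
    unfolding va image_Un img img' using ntv sub by auto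
  ultimately have "removal_via t b b2 fv fe D2 D0"
    unfolding removal_via_def using idv ide ends a(20) by simp
  then show ?thesis by blast
qed

text \<open>Folding a dipole and attaching a cell commute: the cell lies below the dipole, and the middle path \<open>r\<close> of
  the dipole does not meet the bottom path.\<close>

lemma removal_attach:
  assumes wf: "wf_diag P D" and rem: "removal_via p r q fv fe D D'" and att: "attach_at D \<alpha> t \<beta> v b ns E"
  obtains E' where "removal_via p r q fv fe E E'"
    "attach_at D' (map fe \<alpha>) (map fe t) (map fe \<beta>) v b ns E'" "path_label D' (map fe t) = path_label D t"
proof -
  note w = wf_diagD[OF wf] and a = attach_atD[OF att] and m = removal_viaD[OF rem]
  have pq: "(p, r) \<in> cells D" "(r, q) \<in> cells D" "path_label D p = path_label D q"
    using m(1) by (auto simp: dipole_def)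
  note pr = w(11)[OF pq(1)] w(12)[OF pq(1)] w(12)[OF pq(2)]
  have sub: "set t \<subseteq> arcs D - set r" "set \<alpha> \<subseteq> arcs D - set r" "set \<beta> \<subseteq> arcs D - set r"
    using w(4) m(2) unfolding a(1) by auto
  have ht: "hd t \<in> arcs D" "last t \<in> arcs D" "hd t \<notin> set r" "last t \<notin> set r"
    using subsetD[OF sub(1) hd_in_set[OF a(2)]] subsetD[OF sub(1) last_in_set[OF a(2)]] by auto
  have feb: "map fe b = b" using a(7) m(6) by (intro map_idI) auto
  have fvn: "map fv ns = ns" using a(8) m(5) by (intro map_idI) auto
  define E' where "E' = D'\<lparr>verts := verts D' \<union> set ns, arcs := arcs D' \<union> set b,
    tail := (\<lambda>e. if e \<in> set b then fv (tail E e) else tail D' e),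
    head := (\<lambda>e. if e \<in> set b then fv (head E e) else head D' e),
    label := (\<lambda>e. if e \<in> set b then label E e else label D' e),
    cells := insert (map fe t, b) (cells D'), bot_path := map fe \<alpha> @ b @ map fe \<beta>\<rparr>"
  have arcs': "arcs D' \<subseteq> arcs D" using m(8,12) by auto
  have verts': "verts D' \<subseteq> verts D" using m(7,11) by auto
  have tb: "map (tail E') b = tail D' (hd (map fe t)) # ns" "map (head E') b = ns @ [head D' (last (map fe t))]"
  proof -
    have "map (tail E') b = map fv (map (tail E) b)" "map (head E') b = map fv (map (head E) b)"
      by (auto simp: E'_def)
    then show "map (tail E') b = tail D' (hd (map fe t)) # ns" "map (head E') b = ns @ [head D' (last (map fe t))]"
      unfolding a(14,15) using fvn m(13,14) ht a(2) by (auto simp: hd_map last_map)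
  qed
  have lb: "path_label E' b = v" unfolding a(16)[symmetric] path_label_def by (simp add: E'_def)
  have att': "attach_at D' (map fe \<alpha>) (map fe t) (map fe \<beta>) v b ns E'"
    unfolding attach_at_def using tb lb a(1-8) m(18) arcs' verts' by (auto simp: E'_def)
  have same: "map (tail E) c = map (tail D) c" "map (head E) c = map (head D) c" "map (label E) c = map (label D) c"
      if "set c \<subseteq> arcs D" for c
    using that a(11-13) by auto
  have pv: "path_verts E c = path_verts D c" "inner_verts E c = inner_verts D c"
    "path_label E c = path_label D c" if "set c \<subseteq> arcs D" "c \<noteq> []" for c
  proof -
    have "last c \<in> arcs D" "set (tl c) \<subseteq> arcs D" using that by (auto dest: list.set_sel(2))
    then show "path_verts E c = path_verts D c" "inner_verts E c = inner_verts D c"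
      "path_label E c = path_label D c"
      using same[OF that(1)] same(1)[of "tl c"] a(12)
      by (simp_all add: path_verts_def inner_verts_def path_label_def del: map_eq_conv)
  qed
  note ne = w(19)[OF pq(1)] w(20)[OF pq(1)] w(20)[OF pq(2)]
  note pvp = pv[OF pr(1) ne(1)] and pvr = pv[OF pr(2) ne(2)] and pvq = pv[OF pr(3) ne(3)]
  have innerr: "inner_verts D r \<subseteq> verts D"
    using pr(2) w(5) by (auto simp: inner_verts_def dest: list.set_sel(2)[OF ne(2)])
  have cellne: "(t, b) \<noteq> (p, r)" "(t, b) \<noteq> (r, q)"
    using a(7,20) pr by (auto simp: neq_Nil_conv)
  have cells: "cells E - {(p, r), (r, q)} = insert (t, b) (cells D - {(p, r), (r, q)})"
    using cellne unfolding a(17) by auto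
  have verts: "verts E - inner_verts E r = (verts D - inner_verts D r) \<union> set ns"
    unfolding a(9) pvr using innerr a(8) by auto
  have arcs: "arcs E - set r = (arcs D - set r) \<union> set b" unfolding a(10) using a(7) pr(2) by auto
  have fvn': "fv ` set ns = set ns" "fe ` set b = set b"
    using arg_cong[OF fvn, of set] arg_cong[OF feb, of set] by auto
  have old: "tail E' (fe e) = fv (tail E e) \<and> head E' (fe e) = fv (head E e) \<and> label E' (fe e) = label E e"
    if e: "e \<in> arcs D" "e \<notin> set r" for e
  proof -
    have "fe e \<in> arcs D" using e m(8) by auto
    then have "fe e \<notin> set b" using a(7) by auto
    then show ?thesis using e m(13-15) a(11-13) by (simp add: E'_def)
  qed
  have new: "tail E' (fe e) = fv (tail E e) \<and> head E' (fe e) = fv (head E e) \<and> label E' (fe e) = label E e"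
    if e: "e \<in> set b" for e
    using e feb by (simp add: E'_def map_idI) (metis map_eq_conv map_ident)
  have "dipole E p r q" unfolding dipole_def pvp pvq using pq a(17) by simp
  moreover have "set r \<inter> set (bot_path E) = {}" unfolding a(19) using sub a(7) pr(2) by auto
  moreover have "set r \<inter> set (top_path E) = {}" unfolding a(18) by (rule m(3))
  moreover have "fv ` verts E \<subseteq> verts E" "fe ` arcs E \<subseteq> arcs E"
    unfolding a(9,10) image_Un fvn' using m(7,8) by auto
  moreover have "verts E' = fv ` (verts E - inner_verts E r)" "arcs E' = fe ` (arcs E - set r)"
    unfolding verts arcs image_Un fvn' by (simp_all add: E'_def m(11,12))
  moreover have "cells E' = map_prod (map fe) (map fe) ` (cells E - {(p, r), (r, q)})"
    unfolding cells image_insert map_prod_simp feb m(16)[symmetric] by (simp add: E'_def)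
  moreover have "top_path E' = map fe (top_path E)" "bot_path E' = map fe (bot_path E)"
    unfolding a(18,19) using feb m(17) by (simp_all add: E'_def)
  moreover have "fv n = n" if "n \<notin> verts E" for n using that m(5) a(9) by simp
  moreover have "fe n = n" if "n \<notin> arcs E" for n using that m(6) a(10) by simp
  ultimately have "removal_via p r q fv fe E E'"
    unfolding removal_via_def using m(9,10) ne(2) pvp(1) pvq(1) old new unfolding arcs by auto
  moreover have "path_label D' (map fe t) = path_label D t"
    using m(15) sub(1) by (auto simp: path_label_def)
  ultimately show thesis using att' that by blast
qed

lemma built_cancel:
  "built P y (d @ [(i, u, v), (i, v, u)] @ d') D \<Longrightarrow>
   \<exists>D' p r q fv fe. built P y (d @ d') D' \<and> removal_via p r q fv fe D D'"
proof (induction d' arbitrary: D rule: rev_induct)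
  case Nil
  then have "built P y ((d @ [(i, u, v)]) @ [(i, v, u)]) D" by simp
  then obtain D1 where D1: "built P y (d @ [(i, u, v)]) D1" "attach D1 (i, v, u) D"
    by (rule built_snocE)
  from D1(1) obtain D0 where D0: "built P y d D0" "attach D0 (i, u, v) D1"
    by (rule built_snocE)
  from attach_cancel[OF built_wf[OF D0(1)] D0(2) D1(2)] D0(1) show ?case by (simp, blast)
next
  case (snoc s d')
  obtain j x z where s: "s = (j, x, z)" by (cases s)
  from snoc.prems have "built P y ((d @ [(i, u, v), (i, v, u)] @ d') @ [(j, x, z)]) D"
    by (simp add: s)
  then obtain D0 \<alpha> t \<beta> b ns where D0: "built P y (d @ [(i, u, v), (i, v, u)] @ d') D0"
    "(x, z) \<in> sym_rels P" "attach_at D0 \<alpha> t \<beta> z b ns D" "j = length \<alpha>" "x = path_label D0 t"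
    by (rule built_snocE)
  from snoc.IH[OF D0(1)] obtain D' p r q fv fe where D': "built P y (d @ d') D'"
    "removal_via p r q fv fe D0 D'" by blast
  from removal_attach[OF built_wf[OF D0(1)] D'(2) D0(3)] obtain E' where E':
    "removal_via p r q fv fe D E'" "attach_at D' (map fe \<alpha>) (map fe t) (map fe \<beta>) z b ns E'"
    "path_label D' (map fe t) = path_label D0 t" .
  have "attach D' (j, x, z) E'"
    unfolding attach_def using E'(2,3) D0(4,5)
    by (intro exI[of _ "map fe \<alpha>"] exI[of _ "map fe t"] exI[of _ "map fe \<beta>"] exI[of _ b] exI[of _ ns]) simp
  from built_attach[OF D'(1) D0(2) this] E'(1) show ?case unfolding s by (simp, blast)
qed

subsection \<open>Every diagram traces a derivation\<close>

lemma built_word: "built P y d D \<Longrightarrow> word P y"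
  by (induction rule: built.induct) auto

lemma diag_comp_simps [simp]:
  "verts (diag_comp D1 D2) = verts D1 \<union> verts D2" "arcs (diag_comp D1 D2) = arcs D1 \<union> arcs D2"
  "tail (diag_comp D1 D2) e = (if e \<in> arcs D1 then tail D1 e else tail D2 e)"
  "head (diag_comp D1 D2) e = (if e \<in> arcs D1 then head D1 e else head D2 e)"
  "label (diag_comp D1 D2) e = (if e \<in> arcs D1 then label D1 e else label D2 e)"
  "cells (diag_comp D1 D2) = cells D1 \<union> cells D2"
  "top_path (diag_comp D1 D2) = top_path D1" "bot_path (diag_comp D1 D2) = bot_path D2"
  by (simp_all add: diag_comp_def diag_union_def)

lemma diag_add_simps [simp]:
  "verts (diag_add D1 D2) = verts D1 \<union> verts D2" "arcs (diag_add D1 D2) = arcs D1 \<union> arcs D2"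
  "tail (diag_add D1 D2) e = (if e \<in> arcs D1 then tail D1 e else tail D2 e)"
  "head (diag_add D1 D2) e = (if e \<in> arcs D1 then head D1 e else head D2 e)"
  "label (diag_add D1 D2) e = (if e \<in> arcs D1 then label D1 e else label D2 e)"
  "cells (diag_add D1 D2) = cells D1 \<union> cells D2"
  "top_path (diag_add D1 D2) = top_path D1 @ top_path D2"
  "bot_path (diag_add D1 D2) = bot_path D1 @ bot_path D2"
  by (simp_all add: diag_add_def diag_union_def)

lemma attach_top:
  assumes "wf_diag P D" "attach_at D \<alpha> t \<beta> v b ns E"
  shows "path_verts E (top_path D) = path_verts D (top_path D)" "initial_vertex E = initial_vertex D"
    "terminal_vertex E = terminal_vertex D" "initial_vertex D \<in> verts D" "terminal_vertex D \<in> verts D"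
proof -
  note w = wf_diagD[OF assms(1)] and a = attach_atD[OF assms(2)]
  have ht: "hd (top_path D) \<in> arcs D" "last (top_path D) \<in> arcs D"
    using subsetD[OF w(3) hd_in_set[OF w(17)]] subsetD[OF w(3) last_in_set[OF w(17)]] by auto
  show "path_verts E (top_path D) = path_verts D (top_path D)"
    using a(11,12) w(3,17) by (intro path_verts_cong) auto
  show "initial_vertex E = initial_vertex D" "terminal_vertex E = terminal_vertex D"
    using ht a(11,12,18) by (auto simp: initial_vertex_def terminal_vertex_def)
  show "initial_vertex D \<in> verts D" "terminal_vertex D \<in> verts D"
    using ht w(5,6) by (auto simp: initial_vertex_def terminal_vertex_def)
qed

text \<open>The cells of the lower diagram are attached to the upper one in their own order; a cell that is new with
  respect to the part of \<open>D2\<close> built so far is also new with respect to \<open>D1\<close>, because \<open>D1\<close> and \<open>D2\<close> share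
  the top path of \<open>D2\<close> only.\<close>

lemma built_comp:
  assumes "built P y d1 D1" "built P z d2 D2" "composable D1 D2"
  shows "built P y (d1 @ d2) (diag_comp D1 D2)"
  using assms(2,3)
proof (induction rule: built.induct)
  case (built_line D2)
  have l: "arcs D2 = set (top_path D2)" "verts D2 = set (path_verts D2 (top_path D2))" "cells D2 = {}"
    "bot_path D2 = top_path D2"
    using built_line(2) by (auto simp: is_line_def)
  have "isotopic D1 (diag_comp D1 D2)"
    by (rule isotopic_agree) (use built_line(3) l in \<open>auto simp: composable_def\<close>)
  then show ?case using assms(1) by (simp add: built_isotopic)
next
  case (built_attach d2 D u v i E)
  from built_attach(3) obtain \<alpha> t \<beta> b ns where att: "attach_at D \<alpha> t \<beta> v b ns E"
    "i = length \<alpha>" "u = path_label D t" by (auto simp: attach_def)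
  note wf = built_wf[OF built_attach(1)]
  note w = wf_diagD[OF wf] and a = attach_atD[OF att(1)]
  note tp = attach_top[OF wf att(1)]
  have cE: "bot_path D1 = top_path D" "verts D1 \<inter> verts E = set (path_verts D (top_path D))"
    "arcs D1 \<inter> arcs E = set (top_path D)"
    and cE': "\<And>e. e \<in> set (top_path D) \<Longrightarrow> tail D1 e = tail E e \<and> head D1 e = head E e \<and> label D1 e = label E e"
    using built_attach(5) tp(1) a(18) by (auto simp: composable_def)
  have pvD: "set (path_verts D (top_path D)) \<subseteq> verts D" by (rule set_path_verts[OF wf w(17,3)])
  have agree: "tail D1 e = tail D e \<and> head D1 e = head D e \<and> label D1 e = label D e"
    if "e \<in> set (top_path D)" for e
    using cE'[OF that] a(11-13) w(3) that by auto
  have "composable D1 D"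
    unfolding composable_def using cE agree pvD w(3) a(9,10) by auto
  note IH = built_attach(4)[OF this]
  have b1: "set b \<inter> arcs D1 = {}" using cE(3) a(7,10) w(3) by auto
  have n1: "set ns \<inter> verts D1 = {}" using cE(2) a(8,9) pvD by auto
  have both: "e \<in> set (top_path D)" if "e \<in> arcs D1" "e \<in> arcs D" for e
    using that cE(3) a(10) by auto
  have same: "tail (diag_comp D1 D) e = tail D e" "head (diag_comp D1 D) e = head D e"
    "label (diag_comp D1 D) e = label D e" if "e \<in> arcs D" for e
    using agree both that by auto
  have t: "set t \<subseteq> arcs D" using w(4) a(1) by auto
  have ht: "hd t \<in> arcs D" "last t \<in> arcs D" using t a(2) by auto
  have be: "map (tail (diag_comp D1 E)) b = map (tail E) b" "map (head (diag_comp D1 E)) b = map (head E) b"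
    "path_label (diag_comp D1 E) b = path_label E b"
    using b1 by (auto simp: path_label_def)
  have "attach_at (diag_comp D1 D) \<alpha> t \<beta> v b ns (diag_comp D1 E)"
    unfolding attach_at_def be same(1)[OF ht(1)] same(2)[OF ht(2)]
    using a b1 n1 by auto
  moreover have "path_label (diag_comp D1 D) t = path_label D t"
    by (rule path_label_cong) (use t same(3) in blast)
  ultimately have "attach (diag_comp D1 D) (i, u, v) (diag_comp D1 E)"
    unfolding attach_def using att(2,3)
    by (intro exI[of _ \<alpha>] exI[of _ t] exI[of _ \<beta>] exI[of _ b] exI[of _ ns]) simp
  from built.built_attach[OF IH built_attach(2) this] show ?case by simp
qed

definition shift_deriv :: "nat \<Rightarrow> 's step list \<Rightarrow> 's step list" where
  "shift_deriv n d = map (\<lambda>(i, u, v). (i + n, u, v)) d"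

lemma shift_deriv_simps [simp]: "shift_deriv n [] = []" "shift_deriv 0 d = d"
  "shift_deriv n (d @ d') = shift_deriv n d @ shift_deriv n d'"
  "shift_deriv n ((i, u, v) # d) = (i + n, u, v) # shift_deriv n d"
  by (simp_all add: shift_deriv_def case_prod_beta)

lemma is_line_add:
  assumes "is_line y1 D1" "is_line y2 D2" "addable D1 D2"
  shows "is_line (y1 @ y2) (diag_add D1 D2)"
proof -
  let ?D = "diag_add D1 D2" and ?p = "top_path D1" and ?q = "top_path D2"
  have l: "simple_walk D1 ?p" "arcs D1 = set ?p" "verts D1 = set (path_verts D1 ?p)" "path_label D1 ?p = y1"
    "simple_walk D2 ?q" "arcs D2 = set ?q" "verts D2 = set (path_verts D2 ?q)" "path_label D2 ?q = y2"
    "cells D1 = {}" "cells D2 = {}" "bot_path D1 = ?p" "bot_path D2 = ?q"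
    using assms(1,2) by (auto simp: is_line_def)
  have ad: "head D1 (last ?p) = tail D2 (hd ?q)" "verts D1 \<inter> verts D2 = {tail D2 (hd ?q)}"
    "set ?p \<inter> set ?q = {}"
    using assms(3) l by (auto simp: addable_def initial_vertex_def terminal_vertex_def)
  have ne: "?p \<noteq> []" "?q \<noteq> []" using l by (auto simp: simple_walk_def)
  have agr: "tail ?D e = tail D1 e" "head ?D e = head D1 e" "label ?D e = label D1 e" if "e \<in> set ?p" for e
    using that l(2) by auto
  have agr2: "tail ?D e = tail D2 e" "head ?D e = head D2 e" "label ?D e = label D2 e" if "e \<in> set ?q" for e
    using that l(2) ad(3) by auto
  have w1: "simple_walk ?D ?p" "simple_walk ?D ?q"
    using l(1,5) simple_walk_cong[of ?p ?D D1] simple_walk_cong[of ?q ?D D2] agr agr2 by auto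
  have pv1: "path_verts D1 ?p = map (tail D1) ?p @ [tail D2 (hd ?q)]" using ad(1) by (simp add: path_verts_def)
  have pv: "path_verts ?D (?p @ ?q) = map (tail D1) ?p @ path_verts D2 ?q"
    using ne agr agr2 by (simp add: path_verts_def)
  have hq: "tail D2 (hd ?q) \<in> set (path_verts D2 ?q)" using ne by (auto simp: path_verts_def)
  have "distinct (path_verts D1 ?p)" using l(1) by (simp add: simple_walk_def)
  then have d1: "distinct (map (tail D1) ?p)" "tail D2 (hd ?q) \<notin> set (map (tail D1) ?p)"
    unfolding pv1 by simp_all
  have sub_disj: "A \<inter> S = {}" if "A \<subseteq> V" "x \<notin> A" "V \<inter> S = {x}" for A S V :: "nat set" and x
    using that by auto
  have "set (map (tail D1) ?p) \<subseteq> verts D1" unfolding l(3) pv1 by auto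
  then have "set (map (tail D1) ?p) \<inter> set (path_verts D2 ?q) = {}"
    using d1(2) ad(2) l(7) sub_disj by metis
  then have "distinct (path_verts ?D (?p @ ?q))"
    unfolding pv using d1(1) l(5) by (simp add: simple_walk_def)
  moreover have "successively (\<lambda>e e'. head ?D e = tail ?D e') (?p @ ?q)"
    using w1 ne ad(1) agr(2)[of "last ?p"] agr2(1)[of "hd ?q"]
    by (simp add: successively_append_iff simple_walk_def)
  ultimately have "simple_walk ?D (?p @ ?q)" using ne by (simp add: simple_walk_def)
  moreover have "verts D1 \<union> verts D2 = set (path_verts ?D (?p @ ?q))"
    unfolding pv l(3,7) pv1 using hq by auto
  moreover have "path_label ?D (?p @ ?q) = y1 @ y2"
    using path_label_cong[of ?p ?D D1] path_label_cong[of ?q ?D D2] agr agr2 l(4,8) by simp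
  ultimately show ?thesis unfolding is_line_def using l by simp
qed

lemma built_add_line:
  assumes "built P y1 d1 D1" "is_line y2 D2" "word P y2" "addable D1 D2"
  shows "built P (y1 @ y2) d1 (diag_add D1 D2)"
  using assms(1,4)
proof (induction rule: built.induct)
  case (built_line D)
  then show ?case using assms(2,3) by (intro built.built_line is_line_add) (auto simp: word_def)
next
  case (built_attach d D u v i E)
  from built_attach(3) obtain \<alpha> t \<beta> b ns where att: "attach_at D \<alpha> t \<beta> v b ns E"
    "i = length \<alpha>" "u = path_label D t" by (auto simp: attach_def)
  note wf = built_wf[OF built_attach(1)]
  note w = wf_diagD[OF wf] and a = attach_atD[OF att(1)]
  note tp = attach_top[OF wf att(1)]
  have E: "terminal_vertex D = initial_vertex D2" "verts E \<inter> verts D2 = {initial_vertex D2}"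
    "arcs E \<inter> arcs D2 = {}" using built_attach(5) tp by (auto simp: addable_def)
  have "addable D D2" unfolding addable_def using E tp(5) a(9,10) by auto
  note IH = built_attach(4)[OF this]
  have b1: "set b \<inter> arcs D2 = {}" using E(3) a(10) by auto
  have n1: "set ns \<inter> verts D2 = {}" using E(1,2) a(8,9) tp(5) by auto
  have t: "set t \<subseteq> arcs D" using w(4) a(1) by auto
  have ht: "hd t \<in> arcs D" "last t \<in> arcs D" using t a(2) by auto
  have be: "map (tail (diag_add E D2)) b = map (tail E) b" "map (head (diag_add E D2)) b = map (head E) b"
    "path_label (diag_add E D2) b = path_label E b"
    using a(10) by (auto simp: path_label_def)
  have "attach_at (diag_add D D2) \<alpha> t (\<beta> @ bot_path D2) v b ns (diag_add E D2)"
    unfolding attach_at_def be using a b1 n1 ht E(3) by auto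
  moreover have "path_label (diag_add D D2) t = path_label D t"
    using t by (intro path_label_cong) auto
  ultimately have "attach (diag_add D D2) (i, u, v) (diag_add E D2)"
    unfolding attach_def using att(2,3)
    by (intro exI[of _ \<alpha>] exI[of _ t] exI[of _ "\<beta> @ bot_path D2"] exI[of _ b] exI[of _ ns]) simp
  from built.built_attach[OF IH built_attach(2) this] show ?case .
qed

text \<open>The cells of \<open>D1\<close> are attached first. Those of \<open>D2\<close> then find the bottom path of \<open>D1\<close> on their left,
  which shifts their positions.\<close>

lemma built_add:
  assumes "built P y1 d1 D1" "built P y2 d2 D2" "addable D1 D2"
  shows "built P (y1 @ y2) (d1 @ shift_deriv (length (bot_path D1)) d2) (diag_add D1 D2)"
  using assms(2,3)
proof (induction rule: built.induct)
  case (built_line D)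
  then show ?case using built_add_line[OF assms(1)] by simp
next
  case (built_attach d D u v i E)
  from built_attach(3) obtain \<alpha> t \<beta> b ns where att: "attach_at D \<alpha> t \<beta> v b ns E"
    "i = length \<alpha>" "u = path_label D t" by (auto simp: attach_def)
  note wf = built_wf[OF built_attach(1)]
  note w = wf_diagD[OF wf] and a = attach_atD[OF att(1)]
  note tp = attach_top[OF wf att(1)]
  have E: "terminal_vertex D1 = initial_vertex D" "verts D1 \<inter> verts E = {initial_vertex D}"
    "arcs D1 \<inter> arcs E = {}" using built_attach(5) tp by (auto simp: addable_def)
  have "addable D1 D" unfolding addable_def using E tp(4) a(9,10) by auto
  note IH = built_attach(4)[OF this]
  have b1: "set b \<inter> arcs D1 = {}" using E(3) a(10) by auto
  have n1: "set ns \<inter> verts D1 = {}" using E(1,2) a(8,9) tp(4) by auto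
  have t: "set t \<subseteq> arcs D" using w(4) a(1) by auto
  have d1: "e \<notin> arcs D1" if "e \<in> arcs D" for e using that E(3) a(10) by auto
  have ht: "hd t \<in> arcs D" "last t \<in> arcs D" using t a(2) by auto
  have be: "map (tail (diag_add D1 E)) b = map (tail E) b" "map (head (diag_add D1 E)) b = map (head E) b"
    "path_label (diag_add D1 E) b = path_label E b"
    using b1 by (auto simp: path_label_def)
  have "attach_at (diag_add D1 D) (bot_path D1 @ \<alpha>) t \<beta> v b ns (diag_add D1 E)"
    unfolding attach_at_def be using a b1 n1 ht d1 by auto
  moreover have "path_label (diag_add D1 D) t = path_label D t"
    using t d1 by (intro path_label_cong) auto
  ultimately have "attach (diag_add D1 D) (i + length (bot_path D1), u, v) (diag_add D1 E)"
    unfolding attach_def using att(2,3)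
    by (intro exI[of _ "bot_path D1 @ \<alpha>"] exI[of _ t] exI[of _ \<beta>] exI[of _ b] exI[of _ ns]) simp
  from built.built_attach[OF IH built_attach(2) this] show ?case by simp
qed

text \<open>In the numbering of the cell diagram its top path is literally the trivial diagram.\<close>

lemma attach_cell:
  assumes "u \<noteq> []" "v \<noteq> []"
  shows "attach (trivial_diagram u) (0, u, v) (cell_diagram u v)"
proof -
  define k where "k = length u"
  define m where "m = length u + length v"
  define m' where "m' = m - 1"
  have km: "0 < k" "k < m" "m = Suc m'" "k \<le> m'" using assms[folded length_greater_0_conv] unfolding k_def m_def m'_def by linarith+
  have k0: "length u = k" "length u + length v = m" by (auto simp: k_def m_def)
  have C: "cell_diagram u v = \<lparr>verts = {..<m}, arcs = {..<m},
       tail = (\<lambda>e. if e = k then 0 else e), head = (\<lambda>e. if Suc e = m then k else Suc e),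
       label = (!) (u @ v), cells = {([0..<k], [k..<m])}, top_path = [0..<k], bot_path = [k..<m]\<rparr>"
    unfolding cell_diagram_def k_def m_def Let_def by simp
  have T: "trivial_diagram u = \<lparr>verts = {..k}, arcs = {..<k}, tail = id, head = Suc,
      label = (!) u, cells = {}, top_path = [0..<k], bot_path = [0..<k]\<rparr>"
    by (simp add: trivial_diagram_def k_def)
  have tails: "map (\<lambda>e. if e = k then 0 else e) [k..<m] = 0 # [Suc k..<m]"
    using km(2) by (auto simp: upt_conv_Cons intro!: map_idI)
  have heads: "map (\<lambda>e. if Suc e = m then k else Suc e) [k..<m] = [Suc k..<m] @ [k]"
  proof -
    have "map (\<lambda>e. if Suc e = m then k else Suc e) [k..<m'] = map Suc [k..<m']"
      using km by (intro map_cong) auto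
    also have "\<dots> = [Suc k..<m]" using km(3) by (simp add: map_Suc_upt)
    finally show ?thesis using km(3,4) by simp
  qed
  have labs: "map ((!) (u @ v)) [k..<m] = v"
    by (rule nth_equalityI) (auto simp: k_def m_def nth_append)
  have labs': "map ((!) u) [0..<k] = u" unfolding k_def by (rule map_nth)
  have ends: "hd [0..<k] = 0" "last [0..<k] = k - 1" "Suc (k - 1) = k" "[0..<k] \<noteq> []"
    "length [k..<m] = length v" "length [k..<m] = Suc (length [Suc k..<m])"
    using km(1,2) k0 by auto
  have "attach_at (trivial_diagram u) [] [0..<k] [] v [k..<m] [Suc k..<m] (cell_diagram u v)"
    unfolding attach_at_def C T path_label_def diagram_data.simps pre_digraph.simps
  proof (intro conjI ballI)
    show "map (\<lambda>e. if e = k then 0 else e) [k..<m] = id (hd [0..<k]) # [Suc k..<m]"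
      using tails ends(1) by simp
    show "map (\<lambda>e. if Suc e = m then k else Suc e) [k..<m] = [Suc k..<m] @ [Suc (last [0..<k])]"
      using heads ends(2,3) by simp
    show "map ((!) (u @ v)) [k..<m] = v" by (rule labs)
    fix e assume "e \<in> {..<k}"
    then show "(if e = k then 0 else e) = id e" "(if Suc e = m then k else Suc e) = Suc e" "(u @ v) ! e = u ! e"
      using km(2) k0(1) by (auto simp: nth_append)
  qed (use km(1,2) ends in auto)
  then show ?thesis unfolding attach_def using labs'
    by (intro exI[of _ "[]"] exI[of _ "[0..<k]"] exI[of _ "[k..<m]"] exI[of _ "[Suc k..<m]"])
      (simp add: T path_label_def)
qed

locale semigroup_presentation =
  fixes P :: "'s presentation"
  assumes fin: "finite_semigroup_presentation P"
begin

lemma sym_rels_words: "(u, v) \<in> sym_rels P \<Longrightarrow> word P u \<and> word P v \<and> u \<noteq> v"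
  using fin by (auto simp: finite_semigroup_presentation_def sym_rels_def)

lemma derivation_word: "derivation P y d z \<Longrightarrow> word P y \<Longrightarrow> word P z"
proof (induction rule: derivation.induct)
  case (deriv_Cons u v \<alpha> \<beta> d z)
  then show ?case using sym_rels_words[OF deriv_Cons(1)] by (auto simp: word_def)
qed auto

lemma built_trivial: "word P y \<Longrightarrow> built P y [] (trivial_diagram y)"
  by (intro built_line is_line_trivial) (auto simp: word_def)

lemma built_cell: "(u, v) \<in> sym_rels P \<Longrightarrow> built P u [(0, u, v)] (cell_diagram u v)"
  using built_attach[of P u "[]" _ u v 0, OF built_trivial _ attach_cell] sym_rels_words[of u v]
  by (auto simp: word_def)

theorem diagram_built: "diagram P D \<Longrightarrow> \<exists>y d. built P y d D"
proof (induction rule: diagram.induct)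
  case (cell u v)
  then show ?case using built_cell[of u v] by (auto simp: sym_rels_def)
next
  case (isotopy D D')
  then show ?case by (blast intro: built_isotopic)
next
  case (comp D1 D2)
  then show ?case by (blast intro: built_comp)
next
  case (add D1 D2)
  then show ?case by (blast intro: built_add)
qed (blast intro: built_trivial)

end

text \<open>For making the edges or vertices of two diagrams overlap exactly as an identification requires.\<close>

lemma obtain_fresh_extension:
  fixes A B :: "nat set"
  assumes "finite B" "distinct p" "distinct q" "length p = length q"
  obtains f where "inj_on f A" "map f p = q" "f ` (A - set p) \<inter> (B \<union> set q) = {}"
proof -
  obtain g where g: "map g p = q" "bij_betw g (set p) (set q)" using obtain_list_bij assms(2-4) by metis
  obtain N where N: "\<And>x. x \<in> B \<union> set q \<Longrightarrow> x < N"
    using assms(1) finite_nat_set_iff_bounded[of "B \<union> set q"] by auto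
  \<comment> \<open>\<open>N\<close> bounds all names in use, so what is not in \<open>p\<close> is moved out of the way.\<close>
  define f where "f = (\<lambda>x. if x \<in> set p then g x else x + N)"
  have gq: "g x \<in> set q" if "x \<in> set p" for x using g(2) that by (auto simp: bij_betw_def)
  have "inj_on f A"
  proof (rule inj_onI)
    fix x y assume *: "x \<in> A" "y \<in> A" "f x = f y"
    have "g x = g y \<Longrightarrow> x \<in> set p \<Longrightarrow> y \<in> set p \<Longrightarrow> x = y"
      using g(2) by (auto simp: bij_betw_def inj_on_def)
    then show "x = y" using *(3) N[of "g x"] N[of "g y"] gq[of x] gq[of y]
      by (auto simp: f_def split: if_splits)
  qed
  moreover have "map f p = q" using g(1) by (auto simp: f_def)
  moreover have "f ` (A - set p) \<inter> (B \<union> set q) = {}" using N by (fastforce simp: f_def)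
  ultimately show thesis by (rule that)
qed

lemma composable_copy:
  assumes wf1: "wf_diag P D1" and wf2: "wf_diag P D2"
    and lab: "path_label D1 (bot_path D1) = path_label D2 (top_path D2)"
  obtains D2' where "isotopic D2 D2'" "composable D1 D2'"
proof -
  note w1 = wf_diagD[OF wf1] and w2 = wf_diagD[OF wf2]
  let ?t = "top_path D2" and ?b = "bot_path D1"
  have len: "length ?t = length ?b" using lab by (metis path_label_simps(3))
  obtain fe where fe: "inj_on fe (arcs D2)" "map fe ?t = ?b" "fe ` (arcs D2 - set ?t) \<inter> (arcs D1 \<union> set ?b) = {}"
    using obtain_fresh_extension[OF w1(2) simple_walk_distinct[OF w2(7)] simple_walk_distinct[OF w1(8)] len] .
  have d: "distinct (path_verts D2 ?t)" "distinct (path_verts D1 ?b)"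
    "length (path_verts D2 ?t) = length (path_verts D1 ?b)"
    using w2(7) w1(8) len by (auto simp: simple_walk_def)
  obtain fv where fv: "inj_on fv (verts D2)" "map fv (path_verts D2 ?t) = path_verts D1 ?b"
    "fv ` (verts D2 - set (path_verts D2 ?t)) \<inter> (verts D1 \<union> set (path_verts D1 ?b)) = {}"
    using obtain_fresh_extension[OF w1(1) d] .
  define D2' where "D2' = rename_diag fv fe D2"
  have iso: "iso_via fv fe D2 D2'" unfolding D2'_def by (rule iso_via_rename[OF fv(1) fe(1)])
  note i = iso_viaD[OF iso]
  have t': "top_path D2' = ?b" using i(7) fe(2) by simp
  have pv': "path_verts D2' ?b = path_verts D1 ?b"
    using path_verts_iso[OF iso w2(17,3)] fe(2) fv(2) by simp
  have sub: "set (path_verts D2 ?t) \<subseteq> verts D2" "set (path_verts D1 ?b) \<subseteq> verts D1"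
    by (rule set_path_verts[OF wf2 w2(17,3)], rule set_path_verts[OF wf1 w1(18,4)])
  have av: "arcs D2' = fe ` arcs D2" "verts D2' = fv ` verts D2" using i(1,2) by (auto simp: bij_betw_def)
  have "arcs D1 \<inter> arcs D2' = set ?b"
  proof -
    have "arcs D2 = set ?t \<union> (arcs D2 - set ?t)" using w2(3) by auto
    then have "fe ` arcs D2 = set ?b \<union> fe ` (arcs D2 - set ?t)"
      using arg_cong[OF fe(2), of set] by (metis image_Un list.set_map)
    then show ?thesis using fe(3) w1(4) av by auto
  qed
  moreover have "verts D1 \<inter> verts D2' = set (path_verts D1 ?b)"
  proof -
    let ?p = "path_verts D2 ?t"
    have "verts D2 = set ?p \<union> (verts D2 - set ?p)" using sub by auto
    then have "fv ` verts D2 = set (path_verts D1 ?b) \<union> fv ` (verts D2 - set ?p)"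
      using arg_cong[OF fv(2), of set] by (metis image_Un list.set_map)
    then show ?thesis using fv(3) sub av by auto
  qed
  moreover have "tail D1 e = tail D2' e \<and> head D1 e = head D2' e \<and> label D1 e = label D2' e"
    if "e \<in> set ?b" for e
  proof -
    obtain j where j: "j < length ?b" "e = ?b ! j" using \<open>e \<in> set ?b\<close> by (auto simp: in_set_conv_nth)
    have w': "simple_walk D2' ?b"
      using simple_walk_iso[OF iso w2(3) sub(1) w2(7)] fe(2) by simp
    have "path_label D2' ?b = path_label D1 ?b" using path_label_iso[OF iso w2(3)] fe(2) lab by simp
    then have "label D2' e = label D1 e" using j arg_cong[of _ _ "\<lambda>l. l ! j"] by (auto simp: path_label_def)
    then show ?thesis using path_verts_nth[OF w' j(1)] path_verts_nth[OF w1(8) j(1)] pv' j(2) by simp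
  qed
  ultimately have "composable D1 D2'" unfolding composable_def t' pv' by simp
  moreover have "isotopic D2 D2'" using iso by (auto simp: isotopic_iff)
  ultimately show thesis using that by blast
qed

lemma addable_copy:
  assumes wf1: "wf_diag P D1" and wf2: "wf_diag P D2"
  obtains D2' where "isotopic D2 D2'" "addable D1 D2'"
proof -
  note w1 = wf_diagD[OF wf1] and w2 = wf_diagD[OF wf2]
  obtain fe where fe: "inj_on fe (arcs D2)" "fe ` arcs D2 \<inter> arcs D1 = {}"
    using obtain_fresh_extension[OF w1(2), of "[]" "[]" "arcs D2"] by auto
  let ?v = "initial_vertex D2" and ?w = "terminal_vertex D1"
  obtain fv where fv: "inj_on fv (verts D2)" "fv ?v = ?w" "fv ` (verts D2 - {?v}) \<inter> (verts D1 \<union> {?w}) = {}"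
    using obtain_fresh_extension[OF w1(1), of "[?v]" "[?w]" "verts D2"] by auto
  define D2' where "D2' = rename_diag fv fe D2"
  have iso: "iso_via fv fe D2 D2'" unfolding D2'_def by (rule iso_via_rename[OF fv(1) fe(1)])
  note i = iso_viaD[OF iso]
  have ht: "hd (top_path D2) \<in> arcs D2" "last (top_path D1) \<in> arcs D1"
    using subsetD[OF w2(3) hd_in_set[OF w2(17)]] subsetD[OF w1(3) last_in_set[OF w1(17)]] by auto
  have vv: "?v \<in> verts D2" "?w \<in> verts D1"
    using ht w2(5) w1(6) by (auto simp: initial_vertex_def terminal_vertex_def)
  have "initial_vertex D2' = ?w"
    using i(3)[OF ht(1)] i(7) w2(17) fv(2) by (simp add: initial_vertex_def hd_map)
  moreover have "arcs D2' = fe ` arcs D2" "verts D2' = fv ` verts D2" using i(1,2) by (auto simp: bij_betw_def)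
  moreover have "fv ` verts D2 = insert ?w (fv ` (verts D2 - {?v}))" using vv(1) fv(2)
    by (metis image_insert insert_Diff)
  ultimately have "addable D1 D2'" unfolding addable_def using fe(2) fv(3) vv by auto
  moreover have "isotopic D2 D2'" using iso by (auto simp: isotopic_iff)
  ultimately show thesis using that by blast
qed

context semigroup_presentation
begin

lemma whisker_left:
  assumes "diagram P A" "built P y d A" "set \<alpha> \<subseteq> gens P"
  shows "\<exists>A. diagram P A \<and> built P (\<alpha> @ y) (shift_deriv (length \<alpha>) d) A"
proof (cases "\<alpha> = []")
  case False
  then have w: "word P \<alpha>" using assms(3) by (simp add: word_def)
  note T = built_trivial[OF w]
  obtain A' where A': "isotopic A A'" "addable (trivial_diagram \<alpha>) A'"
    using addable_copy[OF built_wf[OF T] built_wf[OF assms(2)]] .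
  have "diagram P (diag_add (trivial_diagram \<alpha>) A')"
    using diagram.add[OF diagram.trivial[OF w] diagram.isotopy[OF assms(1) A'(1)] A'(2)] .
  moreover have "built P (\<alpha> @ y) (shift_deriv (length \<alpha>) d) (diag_add (trivial_diagram \<alpha>) A')"
    using built_add[OF T built_isotopic[OF assms(2) A'(1)] A'(2)] by (simp add: trivial_diagram_def)
  ultimately show ?thesis by blast
qed (use assms in auto)

lemma whisker_right:
  assumes "diagram P A" "built P y d A" "set \<beta> \<subseteq> gens P"
  shows "\<exists>A. diagram P A \<and> built P (y @ \<beta>) d A"
proof (cases "\<beta> = []")
  case False
  then have w: "word P \<beta>" using assms(3) by (simp add: word_def)
  note T = built_trivial[OF w]
  obtain T' where T': "isotopic (trivial_diagram \<beta>) T'" "addable A T'"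
    using addable_copy[OF built_wf[OF assms(2)] built_wf[OF T]] .
  have "diagram P (diag_add A T')"
    using diagram.add[OF assms(1) diagram.isotopy[OF diagram.trivial[OF w] T'(1)] T'(2)] .
  moreover have "built P (y @ \<beta>) d (diag_add A T')"
    using built_add[OF assms(2) built_isotopic[OF T T'(1)] T'(2)] by simp
  ultimately show ?thesis by blast
qed (use assms in auto)

text \<open>A single step is a cell with trivial diagrams added on both sides, which are left out if they would be
  empty; a derivation is a composition of such diagrams.\<close>

lemma derivation_diagram:
  "derivation P y d z \<Longrightarrow> word P y \<Longrightarrow> \<exists>D. diagram P D \<and> built P y d D"
proof (induction rule: derivation.induct)
  case (deriv_Nil y)
  then show ?case using built_trivial diagram.trivial by blast
next
  case (deriv_Cons u v \<alpha> \<beta> d z)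
  have w: "word P (\<alpha> @ v @ \<beta>)" "set \<alpha> \<subseteq> gens P" "set \<beta> \<subseteq> gens P"
    using deriv_Cons.prems sym_rels_words[OF deriv_Cons(1)] by (auto simp: word_def)
  obtain D where D: "diagram P D" "built P (\<alpha> @ v @ \<beta>) d D" using deriv_Cons.IH[OF w(1)] by blast
  have c: "diagram P (cell_diagram u v)" using deriv_Cons(1) by (intro diagram.cell) (auto simp: sym_rels_def)
  from whisker_right[OF c built_cell[OF deriv_Cons(1)] w(3)] obtain A0 where
    "diagram P A0" "built P (u @ \<beta>) [(0, u, v)] A0" by blast
  from whisker_left[OF this w(2)] obtain A where A: "diagram P A"
    "built P (\<alpha> @ u @ \<beta>) [(length \<alpha>, u, v)] A" by auto
  have "derivation P (\<alpha> @ u @ \<beta>) [(length \<alpha>, u, v)] (\<alpha> @ v @ \<beta>)"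
    using deriv_Cons(1) by (auto simp: deriv_Cons_iff)
  then have "path_label A (bot_path A) = \<alpha> @ v @ \<beta>"
    using built_bot_label[OF A(2)] deriv_functional by blast
  then have "path_label A (bot_path A) = path_label D (top_path D)" using built_top_label[OF D(2)] by simp
  from composable_copy[OF built_wf[OF A(2)] built_wf[OF D(2)] this]
  obtain D' where D': "isotopic D D'" "composable A D'" .
  have "diagram P (diag_comp A D')" by (rule diagram.comp[OF A(1) diagram.isotopy[OF D(1) D'(1)] D'(2)])
  moreover have "built P (\<alpha> @ u @ \<beta>) ([(length \<alpha>, u, v)] @ d) (diag_comp A D')"
    by (rule built_comp[OF A(2) built_isotopic[OF D(2) D'(1)] D'(2)])
  ultimately show ?case by auto
qed

text \<open>One diagram traced by the derivation is known to be a diagram, and all others are isotopic to it.\<close>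

lemma built_diagram: "built P y d D \<Longrightarrow> diagram P D"
  by (metis built_bot_label built_word built_unique derivation_diagram diagram.isotopy)

lemma derivation_built: "derivation P y d z \<Longrightarrow> word P y \<Longrightarrow> \<exists>D. built P y d D"
  using derivation_diagram by blast

lemma diagram_equiv_refl: "diagram_equiv P D D"
  by (simp add: diagram_equiv_def)

lemma diagram_equiv_sym: "diagram_equiv P D D' \<Longrightarrow> diagram_equiv P D' D"
  unfolding diagram_equiv_def by (rule equivclp_sym)

lemma diagram_equiv_trans: "diagram_equiv P D D' \<Longrightarrow> diagram_equiv P D' D'' \<Longrightarrow> diagram_equiv P D D''"
  unfolding diagram_equiv_def by (rule equivclp_trans)

lemma built_equiv: "built P y d D \<Longrightarrow> built P y d D' \<Longrightarrow> diagram_equiv P D D'"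
  unfolding diagram_equiv_def by (intro r_into_equivclp) (auto intro: built_unique built_diagram)

text \<open>An exchange leaves the traced graph as it is, and the cancellation of a step with its inverse removes a
  dipole.\<close>

theorem deriv_eq_diagram_equiv:
  assumes "deriv_eq P y z d d'" "word P y" "built P y d D" "built P y d' D'"
  shows "diagram_equiv P D D'"
  using assms
proof (induction arbitrary: D D' rule: deriv_eq.induct)
  case (deq_refl d) then show ?case by (blast intro: built_equiv)
next
  case (deq_sym d d') then show ?case by (blast intro: diagram_equiv_sym)
next
  case (deq_trans d d' d'')
  from derivation_built[of y d' z] deriv_eq_deriv[OF deq_trans(1)] deq_trans(5)
  obtain C where "built P y d' C" by blast
  then show ?case using deq_trans by (blast intro: diagram_equiv_trans)
next
  case (deq_exchange d i u v k u' v' d')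
  then show ?case by (blast intro: built_equiv built_exchange)
next
  case (deq_cancel d i u v d')
  from built_cancel[OF deq_cancel(3)] obtain C p r q fv fe where
    C: "built P y (d @ d') C" "removal_via p r q fv fe D C" by blast
  have "diagram_equiv P D C"
    unfolding diagram_equiv_def using C deq_cancel(3)
    by (intro r_into_equivclp) (blast intro: built_diagram removal_via_dipole_removal)
  then show ?case using built_equiv[OF C(1) deq_cancel(4)] diagram_equiv_trans by blast
qed

end

section \<open>Representations of a presentation\<close>

definition colourings :: "('s \<Rightarrow> 'c set) \<Rightarrow> 's list \<Rightarrow> 'c list set" where
  "colourings C y = {cs. list_all2 (\<lambda>c l. c \<in> C l) cs y}"

lemma colourings_append:
  "cs \<in> colourings C (y @ z) \<longleftrightarrow> (\<exists>as bs. cs = as @ bs \<and> as \<in> colourings C y \<and> bs \<in> colourings C z)"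
  by (auto simp: colourings_def intro: list_all2_appendI) (auto simp: list_all2_append2)

lemma colourings_length: "cs \<in> colourings C y \<Longrightarrow> length cs = length y"
  by (auto simp: colourings_def dest: list_all2_lengthD)

lemma colourings_map: "map \<rho> p \<in> colourings C (path_label D p) \<longleftrightarrow> (\<forall>e\<in>set p. \<rho> e \<in> C (label D e))"
  by (simp add: colourings_def path_label_def list_all2_map1 list_all2_map2 list_all2_same)

lemma colourings_nth: "cs \<in> colourings C y \<Longrightarrow> i < length y \<Longrightarrow> cs ! i \<in> C (y ! i)"
  by (auto simp: colourings_def list_all2_conv_all_nth)

text \<open>A presentation is represented by assigning a set of colours to each letter, and to each relation \<open>u = v\<close> a
  bijection between the colourings of \<open>u\<close> and those of \<open>v\<close>. Derivations then act on colourings.\<close>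

locale representation = semigroup_presentation P for P :: "'s presentation" +
  fixes C :: "'s \<Rightarrow> 'c set" and T :: "'s list \<Rightarrow> 's list \<Rightarrow> 'c list \<Rightarrow> 'c list"
  assumes transport: "(u, v) \<in> sym_rels P \<Longrightarrow> cs \<in> colourings C u \<Longrightarrow> T u v cs \<in> colourings C v"
    and transport_inv: "(u, v) \<in> sym_rels P \<Longrightarrow> cs \<in> colourings C u \<Longrightarrow> T v u (T u v cs) = cs"
begin

fun act :: "'s step list \<Rightarrow> 'c list \<Rightarrow> 'c list" where
  "act [] cs = cs"
| "act ((i, u, v) # d) cs =
     act d (take i cs @ T u v (take (length u) (drop i cs)) @ drop (i + length u) cs)"

lemma act_append [simp]: "act (d @ d') cs = act d' (act d cs)"
  by (induction d cs rule: act.induct) auto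

lemma act_Cons_split:
  assumes "length as = i" "length bs = length u"
  shows "act ((i, u, v) # d) (as @ bs @ cs) = act d (as @ T u v bs @ cs)"
  using assms by auto

lemma colourings_split:
  assumes "cs \<in> colourings C (\<alpha> @ u @ \<beta>)"
  obtains as bs ds where "cs = as @ bs @ ds" "as \<in> colourings C \<alpha>" "bs \<in> colourings C u"
    "ds \<in> colourings C \<beta>" "length as = length \<alpha>" "length bs = length u"
proof -
  from assms obtain as bs ds where *: "cs = as @ bs @ ds" "as \<in> colourings C \<alpha>" "bs \<in> colourings C u"
    "ds \<in> colourings C \<beta>" by (auto simp: colourings_append)
  with that colourings_length[OF *(2)] colourings_length[OF *(3)] show thesis by blast
qed

lemma act_colourings: "derivation P y d z \<Longrightarrow> cs \<in> colourings C y \<Longrightarrow> act d cs \<in> colourings C z"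
proof (induction arbitrary: cs rule: derivation.induct)
  case (deriv_Cons u v \<alpha> \<beta> d z)
  from deriv_Cons.prems obtain as bs ds where s: "cs = as @ bs @ ds" "as \<in> colourings C \<alpha>"
    "bs \<in> colourings C u" "ds \<in> colourings C \<beta>" "length as = length \<alpha>" "length bs = length u"
    by (rule colourings_split)
  have "as @ T u v bs @ ds \<in> colourings C (\<alpha> @ v @ \<beta>)"
    unfolding colourings_append using s transport[OF deriv_Cons(1) s(3)] by blast
  from deriv_Cons.IH[OF this] show ?case unfolding s(1) act_Cons_split[OF s(5,6)] .
qed simp

text \<open>The edges are coloured so that each cell carries the colours of its top path to those of its bottom
  path. Sweeping the diagram downwards shows that the colours of the top path can be prescribed and
  determine all others.\<close>

definition compat :: "'s diag \<Rightarrow> (nat \<Rightarrow> 'c) \<Rightarrow> bool" where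
  "compat D \<rho> \<longleftrightarrow> (\<forall>e\<in>arcs D. \<rho> e \<in> C (label D e)) \<and>
     (\<forall>t b. (t, b) \<in> cells D \<longrightarrow> map \<rho> b = T (path_label D t) (path_label D b) (map \<rho> t))"

definition holonomy :: "'s diag \<Rightarrow> 'c list \<Rightarrow> 'c list \<Rightarrow> bool" where
  "holonomy D cs cs' \<longleftrightarrow> (\<exists>\<rho>. compat D \<rho> \<and> map \<rho> (top_path D) = cs \<and> map \<rho> (bot_path D) = cs')"

lemma attach_labels:
  assumes "wf_diag P D" "attach_at D \<alpha> t \<beta> v b ns E"
  shows "path_label E t = path_label D t"
    "(t', b') \<in> cells D \<Longrightarrow> path_label E t' = path_label D t' \<and> path_label E b' = path_label D b'"
proof -
  note w = wf_diagD[OF assms(1)] and a = attach_atD[OF assms(2)]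
  show "path_label E t = path_label D t"
    using w(4) a(1,13) by (intro path_label_cong) auto
  show "path_label E t' = path_label D t' \<and> path_label E b' = path_label D b'" if "(t', b') \<in> cells D"
    using w(11,12)[OF that] a(13) by (intro conjI path_label_cong) auto
qed

lemma built_compat: "built P y d D \<Longrightarrow> compat D \<rho> \<Longrightarrow> map \<rho> (bot_path D) = act d (map \<rho> (top_path D))"
proof (induction rule: built.induct)
  case (built_line D) then show ?case by (simp add: is_line_def)
next
  case (built_attach d D u v i E)
  from built_attach(3) obtain \<alpha> t \<beta> b ns where att: "attach_at D \<alpha> t \<beta> v b ns E"
    "i = length \<alpha>" "u = path_label D t" by (auto simp: attach_def)
  note wf = built_wf[OF built_attach(1)]
  note w = wf_diagD[OF wf] and a = attach_atD[OF att(1)] and l = attach_labels[OF wf att(1)]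
  have "\<rho> e \<in> C (label D e)" if "e \<in> arcs D" for e
    using built_attach(5) a(10) a(13)[OF that] that unfolding compat_def by (metis UnI1)
  moreover have "map \<rho> b' = T (path_label D t') (path_label D b') (map \<rho> t')" if "(t', b') \<in> cells D" for t' b'
    using built_attach(5) a(17) l(2)[OF that] that unfolding compat_def by (metis insertI2)
  ultimately have "compat D \<rho>" unfolding compat_def by blast
  note IH = built_attach(4)[OF this]
  have "map \<rho> b = T (path_label E t) (path_label E b) (map \<rho> t)"
    using built_attach(5) a(17) by (auto simp: compat_def)
  then have b: "map \<rho> b = T u v (map \<rho> t)" using l(1) a(16) att(3) by simp
  have "act (d @ [(i, u, v)]) (map \<rho> (top_path D)) = act [(i, u, v)] (map \<rho> \<alpha> @ map \<rho> t @ map \<rho> \<beta>)"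
    using IH a(1) by simp
  also have "\<dots> = map \<rho> \<alpha> @ T u v (map \<rho> t) @ map \<rho> \<beta>"
    using act_Cons_split[of "map \<rho> \<alpha>" i "map \<rho> t" u v "[]"] att(2,3) by simp
  finally show ?case using b a(18,19) by simp
qed

lemma obtain_list_fun:
  assumes "distinct xs" "length xs = length ys"
  obtains g where "map g xs = ys"
proof
  show "map (\<lambda>x. the (map_of (zip xs ys) x)) xs = ys"
    using assms by (auto simp: list_eq_iff_nth_eq map_of_zip_nth)
qed

lemma built_compat_exists:
  "built P y d D \<Longrightarrow> cs \<in> colourings C y \<Longrightarrow> \<exists>\<rho>. compat D \<rho> \<and> map \<rho> (top_path D) = cs"
proof (induction rule: built.induct)
  case (built_line D)
  have l: "distinct (top_path D)" "path_label D (top_path D) = y" "arcs D = set (top_path D)" "cells D = {}"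
    using built_line(2) by (auto simp: is_line_def intro: simple_walk_distinct)
  have "length (top_path D) = length cs"
    using colourings_length[OF built_line(3)] l(2) by (metis path_label_simps(3))
  then obtain \<rho> where "map \<rho> (top_path D) = cs" using obtain_list_fun l(1) by blast
  then show ?case using built_line(3) l colourings_map[of \<rho> "top_path D" C D]
    by (auto simp: compat_def)
next
  case (built_attach d D u v i E)
  from built_attach(3) obtain \<alpha> t \<beta> b ns where att: "attach_at D \<alpha> t \<beta> v b ns E"
    "i = length \<alpha>" "u = path_label D t" by (auto simp: attach_def)
  note wf = built_wf[OF built_attach(1)]
  note w = wf_diagD[OF wf] and a = attach_atD[OF att(1)] and l = attach_labels[OF wf att(1)]
  from built_attach(4)[OF built_attach(5)] obtain \<rho> where \<rho>: "compat D \<rho>" "map \<rho> (top_path D) = cs" by blast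
  have t: "set t \<subseteq> arcs D" using w(4) a(1) by auto
  have "map \<rho> t \<in> colourings C u" unfolding att(3) colourings_map using \<rho>(1) t by (auto simp: compat_def)
  from transport[OF built_attach(2) this] have Tv: "T u v (map \<rho> t) \<in> colourings C v" .
  then have "length b = length (T u v (map \<rho> t))" using colourings_length a(5) by metis
  then obtain g where g: "map g b = T u v (map \<rho> t)" using obtain_list_fun[OF a(3)] by blast
  define \<rho>' where "\<rho>' = (\<lambda>e. if e \<in> set b then g e else \<rho> e)"
  have old: "map \<rho>' p = map \<rho> p" if "set p \<subseteq> arcs D" for p using that a(7) by (auto simp: \<rho>'_def)
  have new: "map \<rho>' b = T u v (map \<rho> t)" unfolding g[symmetric] by (auto simp: \<rho>'_def)
  have "\<forall>e\<in>set b. \<rho>' e \<in> C (label E e)"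
    using Tv colourings_map[of \<rho>' b C E] new a(16) by simp
  moreover have "\<rho>' e \<in> C (label E e)" if "e \<in> arcs D" for e
    using that a(7,13) \<rho>(1) by (auto simp: \<rho>'_def compat_def)
  moreover have "map \<rho>' b' = T (path_label E t') (path_label E b') (map \<rho>' t')" if c: "(t', b') \<in> cells E" for t' b'
  proof (cases "(t', b') = (t, b)")
    case True
    then have "t' = t" "b' = b" by simp_all
    then show ?thesis by (simp only: new old[OF t] l(1) a(16) att(3))
  next
    case False
    then have c: "(t', b') \<in> cells D" using c a(17) by auto
    then have "map \<rho> b' = T (path_label D t') (path_label D b') (map \<rho> t')"
      using \<rho>(1) by (simp add: compat_def)
    then show ?thesis
      by (simp only: old[OF w(11)[OF c]] old[OF w(12)[OF c]] l(2)[OF c])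
  qed
  ultimately have "compat E \<rho>'" unfolding compat_def a(10) by blast
  moreover have "map \<rho>' (top_path E) = cs" using old[OF w(3)] \<rho>(2) a(18) by simp
  ultimately show ?case by blast
qed

lemma holonomy_iff:
  assumes "built P y d D"
  shows "holonomy D cs cs' \<longleftrightarrow> cs \<in> colourings C y \<and> cs' = act d cs"
proof
  assume "holonomy D cs cs'"
  then obtain \<rho> where \<rho>: "compat D \<rho>" "map \<rho> (top_path D) = cs" "map \<rho> (bot_path D) = cs'"
    by (auto simp: holonomy_def)
  have "set (top_path D) \<subseteq> arcs D" using wf_diagD(3)[OF built_wf[OF assms]] .
  then have "map \<rho> (top_path D) \<in> colourings C y"
    unfolding built_top_label[OF assms, symmetric] colourings_map using \<rho>(1) by (auto simp: compat_def)
  then show "cs \<in> colourings C y \<and> cs' = act d cs" using \<rho> built_compat[OF assms \<rho>(1)] by simp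
next
  assume *: "cs \<in> colourings C y \<and> cs' = act d cs"
  then obtain \<rho> where "compat D \<rho>" "map \<rho> (top_path D) = cs" using built_compat_exists[OF assms] by blast
  then show "holonomy D cs cs'" using built_compat[OF assms] * unfolding holonomy_def by blast
qed

text \<open>Across a dipole the colours are transported and transported back, so its outer paths are coloured alike
  and the colouring descends to the quotient.\<close>

lemma dipole_removal_holonomy:
  assumes wf: "wf_diag P D" and rem: "dipole_removal D D'"
  shows "holonomy D cs cs' \<Longrightarrow> holonomy D' cs cs'"
    "path_label D' (top_path D') = path_label D (top_path D)"
    "path_label D' (bot_path D') = path_label D (bot_path D)"
proof -
  note w = wf_diagD[OF wf]
  from rem obtain p r q fv fe where dip: "dipole D p r q"
    and fe: "identifies_exactly fe (arcs D - set r) p q"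
    and arcs: "arcs D' = fe ` (arcs D - set r)"
    and ends: "\<forall>e\<in>arcs D - set r. tail D' (fe e) = fv (tail D e) \<and> head D' (fe e) = fv (head D e) \<and>
        label D' (fe e) = label D e"
    and cells: "cells D' = map_prod (map fe) (map fe) ` (cells D - {(p, r), (r, q)})"
    and tb: "top_path D' = map fe (top_path D)" "bot_path D' = map fe (bot_path D)"
    unfolding dipole_removal_def by (elim exE conjE) (rule that, assumption+)
  have pq: "(p, r) \<in> cells D" "(r, q) \<in> cells D" "path_label D p = path_label D q"
    using dip by (auto simp: dipole_def)
  have top: "set (top_path D) \<subseteq> arcs D - set r" "set (bot_path D) \<subseteq> arcs D - set r"
    using w(3,4) w(21)[OF pq(1)] w(13)[OF pq(2)] by auto
  have lab: "path_label D' (map fe c) = path_label D c" if "set c \<subseteq> arcs D - set r" for c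
    using that ends by (auto simp: path_label_def)
  show "path_label D' (top_path D') = path_label D (top_path D)"
    "path_label D' (bot_path D') = path_label D (bot_path D)"
    using lab top tb by auto
  assume "holonomy D cs cs'"
  then obtain \<rho> where \<rho>: "compat D \<rho>" "map \<rho> (top_path D) = cs" "map \<rho> (bot_path D) = cs'"
    by (auto simp: holonomy_def)
  \<comment> \<open>The two outer paths of the dipole carry the same colours.\<close>
  have "map \<rho> p \<in> colourings C (path_label D p)"
    unfolding colourings_map using \<rho>(1) w(11)[OF pq(1)] by (auto simp: compat_def)
  then have "map \<rho> q = map \<rho> p"
    using \<rho>(1) pq transport_inv[OF w(14)[OF pq(1)]] by (simp add: compat_def)
  then have zip: "\<rho> x = \<rho> y" if "(x, y) \<in> set (zip p q)" for x y
    using that by (auto simp: set_zip list_eq_iff_nth_eq)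
  \<comment> \<open>Any preimage will do, by the equality of colours on the two paths.\<close>
  define \<rho>' where "\<rho>' = (\<lambda>e'. \<rho> (SOME e. e \<in> arcs D - set r \<and> fe e = e'))"
  have \<rho>': "\<rho>' (fe e) = \<rho> e" if e: "e \<in> arcs D - set r" for e
  proof -
    define s where "s = (SOME x. x \<in> arcs D - set r \<and> fe x = fe e)"
    have s: "s \<in> arcs D - set r \<and> fe s = fe e"
      unfolding s_def by (rule someI[of _ e]) (use e in auto)
    then have "s = e \<or> (s, e) \<in> set (zip p q) \<or> (e, s) \<in> set (zip p q)"
      using fe e unfolding identifies_exactly_def by blast
    then have "\<rho> s = \<rho> e" using zip by auto
    then show ?thesis by (simp add: \<rho>'_def s_def)
  qed
  have map': "map \<rho>' (map fe c) = map \<rho> c" if "set c \<subseteq> arcs D - set r" for c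
    using that \<rho>' by auto
  have "compat D' \<rho>'"
    unfolding compat_def
  proof (intro conjI ballI allI impI)
    fix e' assume "e' \<in> arcs D'"
    then obtain e where "e' = fe e" "e \<in> arcs D - set r" using arcs by auto
    then show "\<rho>' e' \<in> C (label D' e')" using \<rho>' ends \<rho>(1) by (auto simp: compat_def)
  next
    fix t' b' assume "(t', b') \<in> cells D'"
    then obtain t b where tb: "(t, b) \<in> cells D" "(t, b) \<noteq> (p, r)" "(t, b) \<noteq> (r, q)" "t' = map fe t" "b' = map fe b"
      unfolding cells by auto
    have "set t \<subseteq> arcs D - set r" "set b \<subseteq> arcs D - set r"
      using w(11,12)[OF tb(1)] w(15)[OF tb(1) pq(2) tb(3)] w(16)[OF tb(1) pq(1) tb(2)] by auto
    then show "map \<rho>' b' = T (path_label D' t') (path_label D' b') (map \<rho>' t')"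
      using map' lab tb \<rho>(1) unfolding compat_def by metis
  qed
  then show "holonomy D' cs cs'" unfolding holonomy_def using \<rho> tb map' top by metis
qed

lemma built_same_bot:
  assumes "built P y d D" "built P y d D'"
  shows "path_label D (bot_path D) = path_label D' (bot_path D')"
  using built_bot_label[OF assms(1)] built_bot_label[OF assms(2)] by (rule deriv_functional)

lemma equiv_step:
  assumes "diagram P D" "diagram P D'" "isotopic D D' \<or> dipole_removal D D'"
  shows "holonomy D = holonomy D' \<and> (word_diagram P u v D \<longleftrightarrow> word_diagram P u v D')"
proof -
  obtain y d where D: "built P y d D" using diagram_built[OF assms(1)] by blast
  obtain y' d' where D': "built P y' d' D'" using diagram_built[OF assms(2)] by blast
  from assms(3) show ?thesis
  proof
    assume "isotopic D D'"
    from built_isotopic[OF D this] have E: "built P y d D'" .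
    show ?thesis unfolding fun_eq_iff word_diagram_def
      using holonomy_iff[OF D] holonomy_iff[OF E] built_same_bot[OF D E]
        built_top_label[OF D] built_top_label[OF E] assms by simp
  next
    assume rem: "dipole_removal D D'"
    note r = dipole_removal_holonomy[OF built_wf[OF D] rem]
    have y: "y = y'" using built_top_label[OF D] built_top_label[OF D'] r(2) by simp
    have "act d cs = act d' cs" if "cs \<in> colourings C y" for cs
      using r(1)[of cs "act d cs"] that holonomy_iff[OF D] holonomy_iff[OF D'] by auto
    then show ?thesis unfolding fun_eq_iff word_diagram_def
      using holonomy_iff[OF D] holonomy_iff[OF D'] r(2,3) assms y by auto
  qed
qed

text \<open>A dipole removal preserves the pairs of colourings that a diagram relates; the converse holds because these pairs form the
  graph of a function on all colourings of the top word.\<close>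

theorem equiv_holonomy:
  assumes "diagram_equiv P D D'"
  shows "holonomy D = holonomy D' \<and> (word_diagram P u v D \<longleftrightarrow> word_diagram P u v D')"
  using assms unfolding diagram_equiv_def
proof (induction rule: equivclp_induct)
  case (step D' D'')
  then show ?case using equiv_step[of D' D'' u v] equiv_step[of D'' D' u v] by auto
qed simp

lemma deriv_eq_act:
  assumes "deriv_eq P y z d d'" "word P y" "cs \<in> colourings C y"
  shows "act d cs = act d' cs"
proof -
  obtain D where D: "built P y d D" using derivation_built deriv_eq_deriv[OF assms(1)] assms(2) by blast
  obtain D' where D': "built P y d' D'" using derivation_built deriv_eq_deriv[OF assms(1)] assms(2) by blast
  have "holonomy D = holonomy D'"
    using equiv_holonomy deriv_eq_diagram_equiv[OF assms(1,2) D D'] by blast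
  then show ?thesis using holonomy_iff[OF D] holonomy_iff[OF D'] assms(3) by metis
qed

end

section \<open>Expansions\<close>

lemma deriv_eq_commute:
  assumes "(u, v) \<in> sym_rels P" "(u', v') \<in> sym_rels P"
  shows "deriv_eq P (\<alpha> @ u @ \<kappa> @ u' @ \<beta>) (\<alpha> @ v @ \<kappa> @ v' @ \<beta>)
     [(length \<alpha>, u, v), (length \<alpha> + length v + length \<kappa>, u', v')]
     [(length \<alpha> + length u + length \<kappa>, u', v'), (length \<alpha>, u, v)]"
proof -
  have "derivation P (\<alpha> @ u @ \<kappa> @ u' @ \<beta>)
     ([] @ [(length \<alpha>, u, v), (length \<alpha> + length v + length \<kappa>, u', v')] @ []) (\<alpha> @ v @ \<kappa> @ v' @ \<beta>)"
    unfolding append_Nil append_Nil2 deriv_Cons_iff deriv_Nil_iff using assms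
    by (intro exI[of _ \<alpha>] exI[of _ "\<kappa> @ u' @ \<beta>"] exI[of _ "\<alpha> @ v @ \<kappa>"] exI[of _ \<beta>] conjI) auto
  from deq_exchange[OF this] show ?thesis by simp
qed

text \<open>A presentation in which every relation expands a single letter, and each letter in at most one
  way.\<close>

locale expansion_presentation = representation P C T
  for P :: "'s presentation" and C :: "'s \<Rightarrow> 'c set" and T +
  fixes active :: "'s set" and expand :: "'s \<Rightarrow> 's list"
  assumes rels_expand: "rels P = (\<lambda>x. ([x], expand x)) ` active"
    and expand_length: "x \<in> active \<Longrightarrow> 2 \<le> length (expand x)"
begin

definition expansions :: "'s step list \<Rightarrow> bool" where
  "expansions d \<longleftrightarrow> (\<forall>(i, u, v)\<in>set d. \<exists>x\<in>active. u = [x] \<and> v = expand x)"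

lemma expansions_simps [simp]: "expansions []"
  "expansions ((i, u, v) # d) \<longleftrightarrow> (\<exists>x\<in>active. u = [x] \<and> v = expand x) \<and> expansions d"
  "expansions (d @ d') \<longleftrightarrow> expansions d \<and> expansions d'"
  by (simp_all add: expansions_def ball_Un)

lemma expand_rel: "x \<in> active \<Longrightarrow> ([x], expand x) \<in> sym_rels P"
  by (auto simp: sym_rels_def rels_expand)

lemma expansions_length:
  assumes "derivation P y d z" "expansions d"
  shows "length y \<le> length z" "d \<noteq> [] \<Longrightarrow> length y < length z"
proof -
  have "length y + length d \<le> length z" using assms
  proof (induction rule: derivation.induct)
    case (deriv_Cons u v \<alpha> \<beta> d z)
    then show ?case using expand_length by fastforce
  qed simp
  then show "length y \<le> length z" "d \<noteq> [] \<Longrightarrow> length y < length z" by (auto simp: less_le_trans)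
      (metis add_leE length_greater_0_conv less_add_same_cancel1 less_le_trans)
qed

text \<open>The expansion of a letter \<open>x\<close> of \<open>y\<close> is confronted with a sequence \<open>E\<close> of expansions. Either \<open>E\<close>
  expands \<open>x\<close> at some point, and then it may do so at the very beginning; or \<open>x\<close> survives in \<open>u\<close>, and can be
  expanded before or after \<open>E\<close>. In the second case \<open>x\<close> keeps its colour. The reason is that each letter has
  only one expansion, so that two expansions of a word are equal or take place at disjoint positions.\<close>

lemma expansions_strip:
  "derivation P y E u \<Longrightarrow> expansions E \<Longrightarrow> y = \<alpha> @ [x] @ \<beta> \<Longrightarrow> x \<in> active \<Longrightarrow>
   (\<exists>E'. expansions E' \<and> deriv_eq P y u E ((length \<alpha>, [x], expand x) # E')) \<or>
   (\<exists>\<gamma> \<delta> E'. u = \<gamma> @ [x] @ \<delta> \<and> expansions E' \<and>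
      deriv_eq P y (\<gamma> @ expand x @ \<delta>) (E @ [(length \<gamma>, [x], expand x)]) ((length \<alpha>, [x], expand x) # E') \<and>
      (\<forall>cs\<in>colourings C y. act E cs ! length \<gamma> = cs ! length \<alpha>))"
proof (induction arbitrary: \<alpha> \<beta> rule: derivation.induct)
  case (deriv_Nil y)
  have "derivation P y [(length \<alpha>, [x], expand x)] (\<alpha> @ expand x @ \<beta>)"
    using deriv_Nil expand_rel by (auto simp: deriv_Cons_iff)
  then show ?case using deriv_Nil
    by (intro disjI2 exI[of _ \<alpha>] exI[of _ \<beta>] exI[of _ "[]"]) (auto intro: deq_refl)
next
  case (deriv_Cons u' v' \<alpha>1 \<beta>1 E u)
  obtain x1 where x1: "x1 \<in> active" "u' = [x1]" "v' = expand x1" using deriv_Cons.prems(1) by auto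
  have E: "expansions E" using deriv_Cons.prems(1) by simp
  let ?y = "\<alpha>1 @ u' @ \<beta>1" and ?s = "(length \<alpha>1, [x1], expand x1)" and ?e = "(length \<alpha>, [x], expand x)"
  have s: "derivation P ?y [?s] (\<alpha>1 @ v' @ \<beta>1)"
    using x1 expand_rel by (auto simp: deriv_Cons_iff)
  note rel = expand_rel[OF x1(1)] expand_rel[OF deriv_Cons.prems(3)]
  have yeq: "\<alpha>1 @ [x1] @ \<beta>1 = \<alpha> @ [x] @ \<beta>" using deriv_Cons.prems(2) x1 by simp
  \<comment> \<open>The first step of \<open>E\<close> and the expansion of \<open>x\<close> are exchanged; it remains to treat the other steps
    of \<open>E\<close>, with \<open>x\<close> at its new position \<open>length \<alpha>'\<close>.\<close>
  have transfer:
    "(\<exists>E'. expansions E' \<and> deriv_eq P ?y u (?s # E) (?e # E')) \<or>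
     (\<exists>\<gamma> \<delta> E'. u = \<gamma> @ [x] @ \<delta> \<and> expansions E' \<and>
      deriv_eq P ?y (\<gamma> @ expand x @ \<delta>) (?s # E @ [(length \<gamma>, [x], expand x)]) (?e # E') \<and>
      (\<forall>cs\<in>colourings C ?y. act (?s # E) cs ! length \<gamma> = cs ! length \<alpha>))"
    if y1: "\<alpha>1 @ v' @ \<beta>1 = \<alpha>' @ [x] @ \<beta>'"
      and comm: "deriv_eq P ?y y2 [?s, (length \<alpha>', [x], expand x)] [?e, s']"
      and y2: "y2 = \<alpha>' @ expand x @ \<beta>'"
      and s': "expansions [s']"
      and col: "\<And>cs. cs \<in> colourings C ?y \<Longrightarrow> act [?s] cs ! length \<alpha>' = cs ! length \<alpha>"
    for \<alpha>' \<beta>' y2 s'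
  proof -
    let ?e' = "(length \<alpha>', [x], expand x)"
    have e': "derivation P (\<alpha>1 @ v' @ \<beta>1) [?e'] y2" unfolding y1 y2
      using rel(2) by (auto simp: deriv_Cons_iff)
    have step: "deriv_eq P ?y z (?s # F) (?e # s' # E')"
      if F: "deriv_eq P (\<alpha>1 @ v' @ \<beta>1) z F (?e' # E')" for z F E'
    proof -
      have 1: "deriv_eq P ?y z ([?s] @ F) ([?s] @ (?e' # E'))"
        by (rule deriv_eq_append_left[OF F s])
      have "derivation P (\<alpha>1 @ v' @ \<beta>1) ([?e'] @ E') z" using deriv_eq_deriv[OF F] by simp
      then obtain y3 where "derivation P (\<alpha>1 @ v' @ \<beta>1) [?e'] y3" "derivation P y3 E' z"
        unfolding deriv_append by blast
      then have "derivation P y2 E' z" using e' deriv_functional by metis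
      from deriv_eq_append_right[OF comm this] 1 show ?thesis by (auto intro: deq_trans)
    qed
    from deriv_Cons.IH[OF E y1 deriv_Cons.prems(3)] show ?thesis
    proof
      assume "\<exists>E'. expansions E' \<and> deriv_eq P (\<alpha>1 @ v' @ \<beta>1) u E (?e' # E')"
      then obtain E' where "expansions E'" "deriv_eq P (\<alpha>1 @ v' @ \<beta>1) u E (?e' # E')" by blast
      from step[OF this(2)] this(1) s' have "\<exists>E'. expansions E' \<and> deriv_eq P ?y u (?s # E) (?e # E')"
        by (intro exI[of _ "s' # E'"]) (cases s', auto)
      then show ?thesis ..
    next
      assume "\<exists>\<gamma> \<delta> E'. u = \<gamma> @ [x] @ \<delta> \<and> expansions E' \<and>
        deriv_eq P (\<alpha>1 @ v' @ \<beta>1) (\<gamma> @ expand x @ \<delta>) (E @ [(length \<gamma>, [x], expand x)]) (?e' # E') \<and>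
        (\<forall>cs\<in>colourings C (\<alpha>1 @ v' @ \<beta>1). act E cs ! length \<gamma> = cs ! length \<alpha>')"
      then obtain \<gamma> \<delta> E' where *: "u = \<gamma> @ [x] @ \<delta>" "expansions E'"
        "deriv_eq P (\<alpha>1 @ v' @ \<beta>1) (\<gamma> @ expand x @ \<delta>) (E @ [(length \<gamma>, [x], expand x)]) (?e' # E')"
        "\<forall>cs\<in>colourings C (\<alpha>1 @ v' @ \<beta>1). act E cs ! length \<gamma> = cs ! length \<alpha>'" by blast
      have "act (?s # E) cs ! length \<gamma> = cs ! length \<alpha>" if cs: "cs \<in> colourings C ?y" for cs
      proof -
        have "act (?s # E) cs = act E (act [?s] cs)" using act_append[of "[?s]" E cs] by simp
        then show ?thesis using *(4) act_colourings[OF s cs] col[OF cs] by metis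
      qed
      then show ?thesis using *(1,2) step[OF *(3)] s'
        by (intro disjI2 exI[of _ \<gamma>] exI[of _ \<delta>] exI[of _ "s' # E'"]) (cases s', auto)
    qed
  qed
  consider "length \<alpha>1 = length \<alpha>" | "length \<alpha> < length \<alpha>1" | "length \<alpha>1 < length \<alpha>" by linarith
  then show ?case
  proof cases
    case 1
    then have "\<alpha>1 = \<alpha>" "x1 = x" using yeq by auto
    moreover have "derivation P ?y (?s # E) u"
      using derivation.deriv_Cons[OF rel(1), of \<alpha>1 \<beta>1 E u] deriv_Cons.hyps(2) x1 by simp
    ultimately show ?thesis using E x1 by (intro disjI1 exI[of _ E]) (auto intro: deq_refl)
  next
    case 2
    have "\<exists>\<kappa>. \<alpha>1 = (\<alpha> @ [x]) @ \<kappa> \<and> \<beta> = \<kappa> @ ([x1] @ \<beta>1)"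
      using yeq 2 by (intro append_prefix_split) auto
    then obtain \<kappa> where \<kappa>: "\<alpha>1 = \<alpha> @ [x] @ \<kappa>" "\<beta> = \<kappa> @ [x1] @ \<beta>1" by auto
    have "(\<exists>E'. expansions E' \<and> deriv_eq P ?y u (?s # E) (?e # E')) \<or>
     (\<exists>\<gamma> \<delta> E'. u = \<gamma> @ [x] @ \<delta> \<and> expansions E' \<and>
      deriv_eq P ?y (\<gamma> @ expand x @ \<delta>) (?s # E @ [(length \<gamma>, [x], expand x)]) (?e # E') \<and>
      (\<forall>cs\<in>colourings C ?y. act (?s # E) cs ! length \<gamma> = cs ! length \<alpha>))"
    proof (rule transfer[of \<alpha> "\<kappa> @ expand x1 @ \<beta>1" "\<alpha> @ expand x @ \<kappa> @ expand x1 @ \<beta>1"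
          "(length \<alpha> + length (expand x) + length \<kappa>, [x1], expand x1)"])
      show "deriv_eq P ?y (\<alpha> @ expand x @ \<kappa> @ expand x1 @ \<beta>1) [?s, ?e]
          [?e, (length \<alpha> + length (expand x) + length \<kappa>, [x1], expand x1)]"
        using deq_sym[OF deriv_eq_commute[OF rel(2,1), of \<alpha> \<kappa> \<beta>1]] \<kappa> x1 by simp
      show "act [?s] cs ! length \<alpha> = cs ! length \<alpha>" if "cs \<in> colourings C ?y" for cs
        using 2 colourings_length[OF that] by (simp add: nth_append)
    qed (use \<kappa> x1 in auto)
    then show ?thesis using x1 by simp
  next
    case 3
    have "\<exists>\<kappa>. \<alpha> = (\<alpha>1 @ [x1]) @ \<kappa> \<and> \<beta>1 = \<kappa> @ ([x] @ \<beta>)"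
      using yeq 3 by (intro append_prefix_split) auto
    then obtain \<kappa> where \<kappa>: "\<alpha> = \<alpha>1 @ [x1] @ \<kappa>" "\<beta>1 = \<kappa> @ [x] @ \<beta>" by auto
    have "(\<exists>E'. expansions E' \<and> deriv_eq P ?y u (?s # E) (?e # E')) \<or>
     (\<exists>\<gamma> \<delta> E'. u = \<gamma> @ [x] @ \<delta> \<and> expansions E' \<and>
      deriv_eq P ?y (\<gamma> @ expand x @ \<delta>) (?s # E @ [(length \<gamma>, [x], expand x)]) (?e # E') \<and>
      (\<forall>cs\<in>colourings C ?y. act (?s # E) cs ! length \<gamma> = cs ! length \<alpha>))"
    proof (rule transfer[of "\<alpha>1 @ expand x1 @ \<kappa>" \<beta> "\<alpha>1 @ expand x1 @ \<kappa> @ expand x @ \<beta>" ?s])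
      show "deriv_eq P ?y (\<alpha>1 @ expand x1 @ \<kappa> @ expand x @ \<beta>)
          [?s, (length (\<alpha>1 @ expand x1 @ \<kappa>), [x], expand x)] [?e, ?s]"
        using deriv_eq_commute[OF rel(1,2), of \<alpha>1 \<kappa> \<beta>] \<kappa> x1 by (simp add: add.assoc)
      show "act [?s] cs ! length (\<alpha>1 @ expand x1 @ \<kappa>) = cs ! length \<alpha>" if cs: "cs \<in> colourings C ?y" for cs
      proof -
        from cs obtain as bs ds where sp: "cs = as @ bs @ ds" "as \<in> colourings C \<alpha>1" "bs \<in> colourings C u'"
          "ds \<in> colourings C \<beta>1" "length as = length \<alpha>1" "length bs = length u'"
          by (rule colourings_split)
        have "length (T [x1] (expand x1) bs) = length (expand x1)"
          using transport[OF rel(1)] sp(3) x1 colourings_length by blast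
        moreover have "act [?s] cs = as @ T [x1] (expand x1) bs @ ds"
          unfolding sp(1) using act_Cons_split[of as "length \<alpha>1" bs "[x1]" "expand x1" "[]" ds] sp(5,6) x1 by simp
        ultimately show ?thesis unfolding sp(1) using sp(5,6) x1 \<kappa> by (simp add: nth_append)
      qed
    qed (use \<kappa> x1 in auto)
    then show ?thesis using x1 by simp
  qed
qed

text \<open>A contraction at the end of \<open>d\<close> is undone by one more expansion in \<open>E2\<close>; an expansion at the end of \<open>d\<close> is
  moved past \<open>E2\<close>.\<close>

theorem derivation_fraction:
  "derivation P w d v \<Longrightarrow> \<exists>E1 E2 u. expansions E1 \<and> expansions E2 \<and> derivation P w E1 u \<and>
     derivation P v E2 u \<and> deriv_eq P w u (d @ E2) E1"
proof (induction d arbitrary: v rule: rev_induct)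
  case Nil
  then show ?case by (intro exI[of _ "[]"] exI[of _ v]) (auto intro: deq_refl)
next
  case (snoc s d)
  obtain i a b where s: "s = (i, a, b)" by (cases s)
  from snoc.prems obtain v0 where v0: "derivation P w d v0" "derivation P v0 [s] v"
    by (auto simp: deriv_append)
  from snoc.IH[OF v0(1)] obtain E1 E2 u where E: "expansions E1" "expansions E2" "derivation P w E1 u"
    "derivation P v0 E2 u" "deriv_eq P w u (d @ E2) E1" by blast
  from v0(2) obtain \<alpha> \<beta> where ab: "v0 = \<alpha> @ a @ \<beta>" "v = \<alpha> @ b @ \<beta>" "i = length \<alpha>" "(a, b) \<in> sym_rels P"
    by (auto simp: s deriv_Cons_iff)
  from ab(4) consider (contract) x where "x \<in> active" "b = [x]" "a = expand x"
    | (expand) x where "x \<in> active" "a = [x]" "b = expand x"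
    by (auto simp: sym_rels_def rels_expand)
  then show ?case
  proof cases
    case contract
    let ?s' = "(i, b, a)"
    have s': "derivation P v [?s'] v0" using ab sym_relsD[OF ab(4)] by (auto simp: deriv_Cons_iff)
    have "derivation P v0 ([] @ [(i, a, b), (i, b, a)] @ E2) u"
      using deriv_append[of P v0 "[s]" "[?s'] @ E2" u] deriv_append[of P v "[?s']" E2 u] v0(2) s' E(4) s by auto
    from deq_cancel[OF this] have "deriv_eq P v0 u ([s, ?s'] @ E2) E2" by (simp add: s)
    from deriv_eq_append_left[OF this v0(1)] E(5)
    have "deriv_eq P w u ((d @ [s]) @ (?s' # E2)) E1" by (auto intro: deq_trans)
    moreover have "derivation P v (?s' # E2) u" using deriv_append[of P v "[?s']" E2 u] s' E(4) by auto
    ultimately show ?thesis using E contract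
      by (intro exI[of _ E1] exI[of _ "?s' # E2"] exI[of _ u]) auto
  next
    case expand
    have "s = (length \<alpha>, [x], expand x)" "v0 = \<alpha> @ [x] @ \<beta>" using s ab expand by simp_all
    note strip = expansions_strip[OF E(4,2) this(2) expand(1), folded this(1)]
    have tail: "derivation P v E' z" if "deriv_eq P v0 z F (s # E')" for z F E'
    proof -
      have "derivation P v0 ([s] @ E') z" using deriv_eq_deriv[OF that] by simp
      then obtain y3 where "derivation P v0 [s] y3" "derivation P y3 E' z" unfolding deriv_append by blast
      then show ?thesis using v0(2) deriv_functional by metis
    qed
    from strip show ?thesis
    proof (elim disjE exE conjE)
      fix E' assume E': "expansions E'" "deriv_eq P v0 u E2 (s # E')"
      have "deriv_eq P w u (d @ (s # E')) E1"
        using deriv_eq_append_left[OF deq_sym[OF E'(2)] v0(1)] E(5) by (rule deq_trans)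
      then show ?thesis using E E'(1) tail[OF E'(2)]
        by (intro exI[of _ E1] exI[of _ E'] exI[of _ u]) auto
    next
      fix \<gamma> \<delta> E' assume u: "u = \<gamma> @ [x] @ \<delta>" and E': "expansions E'"
        "deriv_eq P v0 (\<gamma> @ expand x @ \<delta>) (E2 @ [(length \<gamma>, [x], expand x)]) (s # E')"
      let ?e = "(length \<gamma>, [x], expand x)"
      have e: "derivation P u [?e] (\<gamma> @ expand x @ \<delta>)" unfolding u
        using expand_rel[OF expand(1)] by (auto simp: deriv_Cons_iff)
      have "deriv_eq P w (\<gamma> @ expand x @ \<delta>) (d @ (s # E')) (d @ (E2 @ [?e]))"
        by (rule deriv_eq_append_left[OF deq_sym[OF E'(2)] v0(1)])
      moreover have "deriv_eq P w (\<gamma> @ expand x @ \<delta>) ((d @ E2) @ [?e]) (E1 @ [?e])"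
        by (rule deriv_eq_append_right[OF E(5) e])
      ultimately have "deriv_eq P w (\<gamma> @ expand x @ \<delta>) (d @ (s # E')) (E1 @ [?e])"
        by (auto intro: deq_trans)
      moreover have "derivation P w (E1 @ [?e]) (\<gamma> @ expand x @ \<delta>)" using E(3) e deriv_append by blast
      ultimately show ?thesis using E E'(1) tail[OF E'(2)] expand(1)
        by (intro exI[of _ "E1 @ [?e]"] exI[of _ E'] exI[of _ "\<gamma> @ expand x @ \<delta>"]) auto
    qed
  qed
qed

end

section \<open>Expansions realised by maps of a set\<close>

text \<open>Charts are partial functions; \<open>post g c\<close> is the chart \<open>c\<close> followed by the map \<open>g\<close>.\<close>

definition post :: "('x \<Rightarrow> 'x) \<Rightarrow> ('x \<Rightarrow> 'x option) \<Rightarrow> 'x \<Rightarrow> 'x option" where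
  "post g c = map_option g \<circ> c"

lemma post_apply: "post g c t = map_option g (c t)" by (simp add: post_def)

lemma post_comp: "post g (post h c) = post (g \<circ> h) c"
  by (simp add: post_apply fun_eq_iff option.map_comp)

lemma dom_post [simp]: "dom (post g c) = dom c" by (auto simp: post_apply dom_def)

lemma ran_post: "ran (post g c) = g ` ran c" by (force simp: post_apply ran_def)

lemma post_cong: "(\<And>t. t \<in> ran c \<Longrightarrow> g t = h t) \<Longrightarrow> post g c = post h c"
  by (auto simp: post_apply fun_eq_iff ran_def intro: option.map_cong0 elim: option.set_cases)

lemma post_ident: "(\<And>t. t \<in> ran c \<Longrightarrow> g t = t) \<Longrightarrow> post g c = c"
  using post_cong[of c g id] by (simp add: post_apply fun_eq_iff option.map_id)

text \<open>The set \<open>X\<close> is partitioned by \<open>loc\<close> into pieces named by letters. For an active letter \<open>x\<close> the maps \<open>merge x\<close>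
  and \<open>split x\<close> are inverse bijections between the union of the pieces that occur in \<open>expand x\<close> and the
  piece \<open>x\<close>. The last assumption says that no single piece exhausts this union. It is the source of
  faithfulness.\<close>

locale expansion_dynamics = semigroup_presentation P for P :: "'s presentation" +
  fixes active :: "'s set" and expand :: "'s \<Rightarrow> 's list"
    and X :: "'x set" and loc :: "'x \<Rightarrow> 's" and merge split :: "'s \<Rightarrow> 'x \<Rightarrow> 'x"
  assumes rels_expand': "rels P = (\<lambda>x. ([x], expand x)) ` active"
    and expand_length': "x \<in> active \<Longrightarrow> 2 \<le> length (expand x)"
    and distinct_expand: "x \<in> active \<Longrightarrow> distinct (expand x)"
    and merge: "x \<in> active \<Longrightarrow> t \<in> X \<Longrightarrow> loc t \<in> set (expand x) \<Longrightarrow>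
      merge x t \<in> X \<and> loc (merge x t) = x \<and> split x (merge x t) = t"
    and split: "x \<in> active \<Longrightarrow> t \<in> X \<Longrightarrow> loc t = x \<Longrightarrow>
      split x t \<in> X \<and> loc (split x t) \<in> set (expand x) \<and> merge x (split x t) = t"
    and proper: "x \<in> active \<Longrightarrow> l \<in> set (expand x) \<Longrightarrow> \<exists>t\<in>X. loc t \<in> set (expand x) \<and> loc t \<noteq> l"
begin

definition region :: "'s \<Rightarrow> 'x set" where "region l = {t \<in> X. loc t = l}"

definition charts :: "'s \<Rightarrow> ('x \<Rightarrow> 'x option) set" where
  "charts l = {c. dom c = region l \<and> ran c \<subseteq> X}"

text \<open>The chart of a letter \<open>x\<close> induces one on each letter of its expansion, by way of \<open>merge x\<close>. Conversely charts of the letters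
  of the expansion are glued to a chart of \<open>x\<close>.\<close>

definition refine :: "'s \<Rightarrow> ('x \<Rightarrow> 'x option) \<Rightarrow> 's \<Rightarrow> 'x \<Rightarrow> 'x option" where
  "refine x c l = (\<lambda>t. if t \<in> region l then c (merge x t) else None)"

definition glue :: "'s list \<Rightarrow> ('x \<Rightarrow> 'x option) list \<Rightarrow> 's \<Rightarrow> 'x \<Rightarrow> 'x option" where
  "glue u cs x = (\<lambda>t. if t \<in> region x
     then Option.bind (map_of (zip u cs) (loc (split x t))) (\<lambda>c. c (split x t)) else None)"

definition rechart :: "'s list \<Rightarrow> 's list \<Rightarrow> ('x \<Rightarrow> 'x option) list \<Rightarrow> ('x \<Rightarrow> 'x option) list" where
  "rechart u v cs = (if length u = 1 then map (refine (hd u) (hd cs)) v else map (glue u cs) v)"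

lemma sym_rels_cases:
  assumes "(u, v) \<in> sym_rels P"
  obtains x where "x \<in> active" "u = [x]" "v = expand x" | x where "x \<in> active" "u = expand x" "v = [x]"
  using assms by (auto simp: sym_rels_def rels_expand')

lemma rechart_expand: "rechart [x] (expand x) [c] = map (refine x c) (expand x)"
  by (simp add: rechart_def)

lemma rechart_contract: "x \<in> active \<Longrightarrow> rechart (expand x) [x] cs = [glue (expand x) cs x]"
  using expand_length'[of x] by (auto simp: rechart_def)

lemma regionD: "t \<in> region l \<Longrightarrow> t \<in> X \<and> loc t = l" by (simp add: region_def)

lemma merge_region: "x \<in> active \<Longrightarrow> l \<in> set (expand x) \<Longrightarrow> t \<in> region l \<Longrightarrow> merge x t \<in> region x"
  using merge[of x t] by (auto simp: region_def)

lemma refine_chart: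
  assumes "x \<in> active" "l \<in> set (expand x)" "c \<in> charts x"
  shows "refine x c l \<in> charts l"
proof -
  have "c (merge x t) \<noteq> None" if "t \<in> region l" for t
    using merge_region[OF assms(1,2) that] assms(3) by (auto simp: charts_def dom_def)
  then have "dom (refine x c l) = region l" by (auto simp: refine_def dom_def)
  moreover have "ran (refine x c l) \<subseteq> ran c" by (auto simp: refine_def ran_def)
  ultimately show ?thesis using assms(3) by (auto simp: charts_def)
qed

lemma colourings_distinct_map_of:
  assumes "cs \<in> colourings C u" "l \<in> set u" "distinct u"
  obtains i where "i < length u" "u ! i = l" "map_of (zip u cs) l = Some (cs ! i)" "cs ! i \<in> C l"
proof -
  obtain i where i: "i < length u" "u ! i = l" using assms(2) by (auto simp: in_set_conv_nth)
  have len: "length u = length cs" using colourings_length[OF assms(1)] by simp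
  have "map_of (zip u cs) (u ! i) = Some (cs ! i)"
    by (rule map_of_zip_nth) (use len assms(3) i in auto)
  then show thesis using that[OF i] colourings_nth[OF assms(1) i(1)] i(2) by simp
qed

lemma glue_chart:
  assumes x: "x \<in> active" and cs: "cs \<in> colourings charts (expand x)"
  shows "glue (expand x) cs x \<in> charts x"
proof -
  have *: "\<exists>s\<in>X. glue (expand x) cs x t = Some s" if t: "t \<in> region x" for t
  proof -
    have s: "split x t \<in> X" "loc (split x t) \<in> set (expand x)"
      using split[OF x] regionD[OF t] by auto
    from colourings_distinct_map_of[OF cs s(2) distinct_expand[OF x]] obtain i where
      i: "map_of (zip (expand x) cs) (loc (split x t)) = Some (cs ! i)" "cs ! i \<in> charts (loc (split x t))" by metis
    have "split x t \<in> dom (cs ! i)" using i(2) s(1) by (simp add: charts_def region_def)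
    then obtain s' where "(cs ! i) (split x t) = Some s'" by blast
    then show ?thesis using i t by (auto simp: glue_def charts_def ran_def)
  qed
  then have "dom (glue (expand x) cs x) = region x" by (auto simp: glue_def dom_def split: if_splits)
  moreover have "ran (glue (expand x) cs x) \<subseteq> X"
  proof
    fix s assume "s \<in> ran (glue (expand x) cs x)"
    then obtain t where t: "glue (expand x) cs x t = Some s" by (auto simp: ran_def)
    then have "t \<in> region x" by (auto simp: glue_def split: if_splits)
    from *[OF this] t show "s \<in> X" by auto
  qed
  ultimately show ?thesis by (simp add: charts_def)
qed

sublocale expansion_presentation P charts rechart active expand
proof
  fix u v and cs :: "('x \<Rightarrow> 'x option) list"
  assume uv: "(u, v) \<in> sym_rels P" and cs: "cs \<in> colourings charts u"
  from uv show "rechart u v cs \<in> colourings charts v"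
  proof (cases rule: sym_rels_cases)
    case (1 x)
    then obtain c where c: "cs = [c]" "c \<in> charts x" using cs by (auto simp: colourings_def list_all2_Cons2)
    show ?thesis unfolding 1(2,3) c(1) rechart_expand colourings_def
      using refine_chart[OF 1(1) _ c(2)] by (simp add: list_all2_map1 list_all2_same)
  next
    case (2 x)
    then show ?thesis using glue_chart[OF 2(1)] cs rechart_contract[OF 2(1)] by (simp add: colourings_def)
  qed
  from uv show "rechart v u (rechart u v cs) = cs"
  proof (cases rule: sym_rels_cases)
    case (1 x)
    then obtain c where c: "cs = [c]" "c \<in> charts x" using cs by (auto simp: colourings_def list_all2_Cons2)
    have "glue (expand x) (map (refine x c) (expand x)) x t = c t" for t
    proof (cases "t \<in> region x")
      case True
      have s: "split x t \<in> X" "loc (split x t) \<in> set (expand x)" "merge x (split x t) = t"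
        using split[OF 1(1)] regionD[OF True] by auto
      then show ?thesis using True by (simp add: glue_def map_of_zip_map refine_def region_def)
    next
      case False
      then have "c t = None" using c(2) by (auto simp: charts_def)
      then show ?thesis using False by (simp add: glue_def)
    qed
    then show ?thesis using 1 c(1) rechart_contract[OF 1(1)] rechart_expand by auto
  next
    case (2 x)
    have "map (refine x (glue (expand x) cs x)) (expand x) = cs"
    proof (rule nth_equalityI)
      show len: "length (map (refine x (glue (expand x) cs x)) (expand x)) = length cs"
        using colourings_length[OF cs] 2(2) by simp
      fix i assume "i < length (map (refine x (glue (expand x) cs x)) (expand x))"
      then have i: "i < length (expand x)" by simp
      let ?l = "expand x ! i"
      have ci: "cs ! i \<in> charts ?l" using colourings_nth[OF cs] 2(2) i by simp
      have "refine x (glue (expand x) cs x) ?l t = (cs ! i) t" for t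
      proof (cases "t \<in> region ?l")
        case True
        have m: "merge x t \<in> region x" "split x (merge x t) = t" "loc t = ?l"
          using merge[OF 2(1), of t] regionD[OF True] i by (auto simp: region_def)
        have "map_of (zip (expand x) cs) ?l = Some (cs ! i)"
          by (rule map_of_zip_nth) (use distinct_expand[OF 2(1)] len i in auto)
        then show ?thesis using True m by (simp add: refine_def glue_def)
      next
        case False
        then have "(cs ! i) t = None" using ci by (auto simp: charts_def)
        then show ?thesis using False by (simp add: refine_def)
      qed
      then show "map (refine x (glue (expand x) cs x)) (expand x) ! i = cs ! i" using i by auto
    qed
    then show ?thesis using 2 rechart_contract[OF 2(1)] rechart_expand by simp
  qed
qed (fact rels_expand' expand_length')+

lemma rechart_post:
  assumes "(u, v) \<in> sym_rels P" "length cs = length u"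
  shows "rechart u v (map (post g) cs) = map (post g) (rechart u v cs)"
  using assms(1)
proof (cases rule: sym_rels_cases)
  case (1 x)
  then obtain c where "cs = [c]" using assms(2) by (auto simp: length_Suc_conv)
  then show ?thesis using 1 by (auto simp: post_apply rechart_expand refine_def fun_eq_iff)
next
  case (2 x)
  have "map_of (zip (expand x) (map (post g) cs)) = map_option (post g) \<circ> map_of (zip (expand x) cs)"
    by (simp add: zip_map2 map_of_map)
  then have "glue (expand x) (map (post g) cs) x t = post g (glue (expand x) cs x) t" for t
    by (cases "map_of (zip (expand x) cs) (loc (split x t))") (simp_all add: post_apply glue_def)
  then show ?thesis using 2 by (simp add: rechart_contract fun_eq_iff)
qed

text \<open>Derivations change charts at their sources, so they commute with maps applied to the values.\<close>

lemma act_post: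
  "derivation P y d z \<Longrightarrow> cs \<in> colourings charts y \<Longrightarrow> act d (map (post g) cs) = map (post g) (act d cs)"
proof (induction arbitrary: cs rule: derivation.induct)
  case (deriv_Cons u v \<alpha> \<beta> d z)
  from deriv_Cons.prems obtain as bs ds where s: "cs = as @ bs @ ds" "as \<in> colourings charts \<alpha>"
    "bs \<in> colourings charts u" "ds \<in> colourings charts \<beta>" "length as = length \<alpha>" "length bs = length u"
    by (rule colourings_split)
  have "as @ rechart u v bs @ ds \<in> colourings charts (\<alpha> @ v @ \<beta>)"
    unfolding colourings_append using s transport[OF deriv_Cons(1) s(3)] by blast
  note IH = deriv_Cons.IH[OF this]
  have "act ((length \<alpha>, u, v) # d) (map (post g) cs) =
      act d (map (post g) as @ rechart u v (map (post g) bs) @ map (post g) ds)"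
    unfolding s(1) map_append by (rule act_Cons_split) (use s(5,6) in simp_all)
  also have "\<dots> = act d (map (post g) (as @ rechart u v bs @ ds))"
    by (simp only: rechart_post[OF deriv_Cons(1) s(6)] map_append)
  also have "\<dots> = map (post g) (act d (as @ rechart u v bs @ ds))" by (rule IH)
  also have "\<dots> = map (post g) (act ((length \<alpha>, u, v) # d) cs)"
    by (simp only: s(1) act_Cons_split[OF s(5,6)])
  finally show ?case .
qed simp

definition disjoint_charts :: "('x \<Rightarrow> 'x option) list \<Rightarrow> bool" where
  "disjoint_charts cs \<longleftrightarrow> (\<forall>c\<in>set cs. inj_on c (dom c)) \<and> sorted_wrt (\<lambda>c c'. ran c \<inter> ran c' = {}) cs"

lemma ran_refine: "ran (refine x c l) \<subseteq> ran c"
  by (auto simp: refine_def ran_def)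

lemma refine_SomeD: "refine x c l t = Some s \<Longrightarrow> t \<in> region l \<and> c (merge x t) = Some s"
  by (auto simp: refine_def split: if_splits)

lemma merge_inj:
  assumes "x \<in> active" "t \<in> X" "loc t \<in> set (expand x)" "t' \<in> X" "loc t' \<in> set (expand x)"
    "c (merge x t) = Some s" "c (merge x t') = Some s" "inj_on c (dom c)"
  shows "t = t'"
proof -
  have "merge x t = merge x t'" using assms(6-8) by (auto simp: inj_on_def dom_def)
  then show ?thesis using merge[OF assms(1-3)] merge[OF assms(1,4,5)] by metis
qed

lemma act_expand_split:
  assumes "x \<in> active" "cs \<in> colourings charts (\<alpha> @ [x] @ \<beta>)"
  obtains as c ds where "cs = as @ [c] @ ds" "length as = length \<alpha>" "c \<in> charts x"
    "act [(length \<alpha>, [x], expand x)] cs = as @ map (refine x c) (expand x) @ ds"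
proof -
  from assms(2) obtain as bs ds where s: "cs = as @ bs @ ds" "as \<in> colourings charts \<alpha>"
    "bs \<in> colourings charts [x]" "ds \<in> colourings charts \<beta>" "length as = length \<alpha>" "length bs = length [x]"
    by (rule colourings_split)
  then obtain c where c: "bs = [c]" "c \<in> charts x" by (auto simp: colourings_def list_all2_Cons2)
  from that[OF s(1)[unfolded c(1)] s(5) c(2)] act_Cons_split[OF s(5,6), of "expand x" "[]" ds] s(1) c(1)
  show thesis by (simp add: rechart_expand)
qed

lemma disjoint_charts_expand:
  assumes x: "x \<in> active" and d: "disjoint_charts (as @ [c] @ ds)" and c: "c \<in> charts x"
  shows "disjoint_charts (as @ map (refine x c) (expand x) @ ds)"
proof -
  have inj: "inj_on c (dom c)" using d by (simp add: disjoint_charts_def)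
  have "inj_on (refine x c l) (dom (refine x c l))" if l: "l \<in> set (expand x)" for l
  proof (rule inj_onI)
    fix t t' assume t: "t \<in> dom (refine x c l)" "t' \<in> dom (refine x c l)" "refine x c l t = refine x c l t'"
    then obtain s where "refine x c l t = Some s" "refine x c l t' = Some s" by auto
    then show "t = t'" using refine_SomeD regionD merge_inj[OF x _ _ _ _ _ _ inj, of t t' s] l by metis
  qed
  moreover have "sorted_wrt (\<lambda>l l'. ran (refine x c l) \<inter> ran (refine x c l') = {}) (expand x)"
    unfolding sorted_wrt_iff_nth_less
  proof (intro allI impI)
    fix i j assume ij: "i < j" "j < length (expand x)"
    let ?l = "expand x ! i" and ?l' = "expand x ! j"
    have ne: "?l \<noteq> ?l'" using distinct_expand[OF x] ij by (simp add: nth_eq_iff_index_eq)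
    have l: "?l \<in> set (expand x)" "?l' \<in> set (expand x)" using ij by auto
    show "ran (refine x c ?l) \<inter> ran (refine x c ?l') = {}"
    proof (rule equals0I)
      fix s assume "s \<in> ran (refine x c ?l) \<inter> ran (refine x c ?l')"
      then obtain t t' where "refine x c ?l t = Some s" "refine x c ?l' t' = Some s" by (auto simp: ran_def)
      then have t: "t \<in> X" "loc t = ?l" "t' \<in> X" "loc t' = ?l'" "c (merge x t) = Some s" "c (merge x t') = Some s"
        using refine_SomeD regionD by metis+
      then have "t = t'" using merge_inj[OF x _ _ _ _ _ _ inj, of t t' s] l by simp
      then show False using t ne by simp
    qed
  qed
  ultimately show ?thesis using d ran_refine[of x c]
    by (auto simp: disjoint_charts_def sorted_wrt_append sorted_wrt_map) blast+
qed

text \<open>Expansions cut the range of a chart into parts.\<close>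

lemma expansions_refine:
  "derivation P y E u \<Longrightarrow> expansions E \<Longrightarrow> cs \<in> colourings charts y \<Longrightarrow>
   \<forall>c'\<in>set (act E cs). \<exists>c\<in>set cs. ran c' \<subseteq> ran c"
proof (induction arbitrary: cs rule: derivation.induct)
  case (deriv_Cons u v \<alpha> \<beta> d z)
  then obtain x where x: "x \<in> active" "u = [x]" "v = expand x" by auto
  from act_expand_split[OF x(1) deriv_Cons.prems(2)[unfolded x(2)]] obtain as c ds where
    s: "cs = as @ [c] @ ds" "act [(length \<alpha>, [x], expand x)] cs = as @ map (refine x c) (expand x) @ ds" by metis
  have "derivation P (\<alpha> @ u @ \<beta>) [(length \<alpha>, u, v)] (\<alpha> @ v @ \<beta>)"
    using deriv_Cons(1) by (auto simp: deriv_Cons_iff)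
  from act_colourings[OF this deriv_Cons.prems(2)]
  have "as @ map (refine x c) (expand x) @ ds \<in> colourings charts (\<alpha> @ v @ \<beta>)"
    by (simp only: x(2,3) s(2))
  from deriv_Cons.IH[OF _ this] deriv_Cons.prems(1)
  have *: "\<forall>c'\<in>set (act d (as @ map (refine x c) (expand x) @ ds)).
      \<exists>c''\<in>set (as @ map (refine x c) (expand x) @ ds). ran c' \<subseteq> ran c''"
    by simp
  have "act ((length \<alpha>, u, v) # d) cs = act d (as @ map (refine x c) (expand x) @ ds)"
    using act_append[of "[(length \<alpha>, u, v)]" d cs] s(2) x by simp
  moreover have "\<exists>c0\<in>set cs. ran c'' \<subseteq> ran c0" if "c'' \<in> set (as @ map (refine x c) (expand x) @ ds)" for c''
  proof -
    from that consider "c'' \<in> set as \<union> set ds" | l where "c'' = refine x c l" by auto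
    then show ?thesis
    proof cases
      case 1 then show ?thesis unfolding s(1) by (intro bexI[of _ c'']) auto
    next
      case 2 then show ?thesis unfolding s(1) using ran_refine by (intro bexI[of _ c]) auto
    qed
  qed
  ultimately show ?case using *
    by (simp only:) (intro ballI, drule (1) bspec, elim bexE, meson subset_trans)
qed auto

text \<open>The ping-pong argument, by induction on \<open>E1\<close>. If \<open>E2\<close> also expands the letter \<open>x\<close> that \<open>E1\<close> expands first, this
  step is cancelled. Otherwise \<open>x\<close> survives \<open>E2\<close> with its chart \<open>c\<close>, so \<open>c\<close> also occurs among the charts that \<open>E1\<close>
  produces. But their ranges are contained in ranges that are disjoint from \<open>ran c\<close> or, for the letters of
  the expansion of \<open>x\<close>, properly contained in it.\<close>

theorem expansions_faithful:
  "derivation P y E1 u \<Longrightarrow> expansions E1 \<Longrightarrow> word P y \<Longrightarrow> derivation P y E2 u \<Longrightarrow> expansions E2 \<Longrightarrow>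
   cs \<in> colourings charts y \<Longrightarrow> disjoint_charts cs \<Longrightarrow> act E1 cs = act E2 cs \<Longrightarrow> deriv_eq P y u E1 E2"
proof (induction arbitrary: E2 cs rule: derivation.induct)
  case (deriv_Nil y)
  then have "E2 = []" using expansions_length(2)[OF deriv_Nil(3,4)] by auto
  then show ?case by (simp add: deq_refl)
next
  case (deriv_Cons u v \<alpha> \<beta> E z)
  then obtain x where x: "x \<in> active" "u = [x]" "v = expand x" by auto
  let ?y = "\<alpha> @ [x] @ \<beta>" and ?y1 = "\<alpha> @ expand x @ \<beta>" and ?s = "(length \<alpha>, [x], expand x)"
  have cs: "cs \<in> colourings charts ?y" using deriv_Cons.prems(5) x by simp
  from act_expand_split[OF x(1) cs] obtain as c ds where
    s: "cs = as @ [c] @ ds" "act [?s] cs = as @ map (refine x c) (expand x) @ ds" "length as = length \<alpha>"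
      "c \<in> charts x" by metis
  let ?cs1 = "as @ map (refine x c) (expand x) @ ds"
  have step: "derivation P ?y [?s] ?y1" using expand_rel[OF x(1)] by (auto simp: deriv_Cons_iff)
  have cs1: "?cs1 \<in> colourings charts ?y1" using act_colourings[OF step cs] s(2) by simp
  have d1: "disjoint_charts ?cs1"
    using disjoint_charts_expand[OF x(1) _ s(4)] deriv_Cons.prems(6) s(1) by simp
  have actE: "act (?s # F) cs = act F ?cs1" for F
    using act_append[of "[?s]" F cs] s(2) by simp
  have w: "word P ?y" using deriv_Cons.prems(2) x by simp
  have E2: "derivation P ?y E2 z" using deriv_Cons.prems(3) x by simp
  have eq: "act E ?cs1 = act E2 cs" using deriv_Cons.prems(7) actE x by simp
  have Eexp: "expansions E" using deriv_Cons.prems(1) by simp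
  have Eder: "derivation P ?y1 E z" using deriv_Cons.hyps(2) x by simp
  from expansions_strip[OF E2 deriv_Cons.prems(4) refl x(1)] show ?case
  proof (elim disjE exE conjE)
    fix E' assume E': "expansions E'" "deriv_eq P ?y z E2 (?s # E')"
    have "derivation P ?y ([?s] @ E') z" using deriv_eq_deriv[OF E'(2)] by simp
    then obtain y3 where "derivation P ?y [?s] y3" "derivation P y3 E' z" unfolding deriv_append by blast
    then have E'd: "derivation P ?y1 E' z" using step deriv_functional by metis
    have "act E ?cs1 = act E' ?cs1"
      using eq deriv_eq_act[OF E'(2) w cs] actE by simp
    then have "deriv_eq P ?y1 z E E'"
      using deriv_Cons.IH[unfolded x(2,3), OF Eexp derivation_word[OF step w] E'd E'(1) cs1 d1] by simp
    from deriv_eq_append_left[OF this step] deq_sym[OF E'(2)] show ?thesis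
      using x by (auto intro: deq_trans)
  next
    fix \<gamma> \<delta> E' assume z: "z = \<gamma> @ [x] @ \<delta>"
      and keep: "\<forall>cs\<in>colourings charts ?y. act E2 cs ! length \<gamma> = cs ! length \<alpha>"
    have "length (act E2 cs) = length z" using colourings_length[OF act_colourings[OF E2 cs]] .
    then have "act E2 cs ! length \<gamma> \<in> set (act E2 cs)" using z by simp
    moreover have "act E2 cs ! length \<gamma> = c" using keep cs s(1,3) by (simp add: nth_append)
    ultimately have "c \<in> set (act E ?cs1)" using eq by simp
    with expansions_refine[OF Eder Eexp cs1] obtain c' where c': "c' \<in> set ?cs1" "ran c \<subseteq> ran c'" by blast
    have inj: "inj_on c (dom c)" and disj: "c'' \<in> set as \<union> set ds \<Longrightarrow> ran c \<inter> ran c'' = {}" for c''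
      using deriv_Cons.prems(6) unfolding s(1) disjoint_charts_def by (auto simp: sorted_wrt_append)
    have pt: "\<exists>s. c (merge x t) = Some s" if "t \<in> X" "loc t \<in> set (expand x)" for t
      using merge[OF x(1) that] s(4) by (auto simp: charts_def region_def dom_def)
    from c'(1) consider "c' \<in> set as \<union> set ds" | l where "l \<in> set (expand x)" "c' = refine x c l" by auto
    then have False
    proof cases
      case 1
      have "expand x \<noteq> []" using expand_length'[OF x(1)] by auto
      then obtain t where "t \<in> X" "loc t \<in> set (expand x)" using proper[OF x(1)] hd_in_set by metis
      from pt[OF this] obtain s' where "s' \<in> ran c" by (auto simp: ran_def)
      then show False using disj[OF 1] c'(2) by auto
    next
      case 2
      from proper[OF x(1) 2(1)] obtain t where t: "t \<in> X" "loc t \<in> set (expand x)" "loc t \<noteq> l" by blast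
      from pt[OF t(1,2)] obtain s' where s': "c (merge x t) = Some s'" ..
      then have "s' \<in> ran c'" using c'(2) by (auto simp: ran_def)
      then obtain t' where "refine x c l t' = Some s'" unfolding 2(2) by (auto simp: ran_def)
      then have t': "t' \<in> X" "loc t' = l" "c (merge x t') = Some s'"
        using refine_SomeD regionD by metis+
      have "t = t'" using merge_inj[OF x(1) t(1,2) t'(1) _ s' t'(3) inj] t'(2) 2(1) by simp
      then show False using t(3) t'(2) by simp
    qed
    then show ?thesis ..
  qed
qed

definition ident :: "'s \<Rightarrow> 'x \<Rightarrow> 'x option" where
  "ident l = (\<lambda>t. if t \<in> region l then Some t else None)"

lemma ran_ident [simp]: "ran (ident l) = region l"
  by (auto simp: ident_def ran_def)

lemma ident_charts: "ident l \<in> charts l"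
proof -
  have "dom (ident l) = region l" by (auto simp: ident_def dom_def)
  then show ?thesis by (auto simp: charts_def regionD)
qed

lemma ident_colourings: "map ident w \<in> colourings charts w"
  by (simp add: colourings_def list_all2_map1 list_all2_same ident_charts)

lemma disjoint_charts_ident:
  assumes "distinct w" shows "disjoint_charts (map ident w)"
proof -
  have "inj_on (ident l) (dom (ident l))" for l
    by (auto simp: inj_on_def ident_def split: if_splits)
  moreover have "sorted_wrt (\<lambda>l l'. region l \<inter> region l' = {}) w"
    using assms by (auto simp: sorted_wrt_iff_nth_less nth_eq_iff_index_eq dest!: regionD)
  ultimately show ?thesis by (simp add: disjoint_charts_def sorted_wrt_map)
qed

text \<open>The loop \<open>d @ deriv_inv d'\<close> acts trivially on the identity charts. Written as a fraction, it has equal numerator and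
  denominator by faithfulness of expansions.\<close>

theorem loops_faithful:
  assumes w: "word P w" "distinct w" and d: "derivation P w d w" and d': "derivation P w d' w"
    and eq: "act d (map ident w) = act d' (map ident w)"
  shows "deriv_eq P w w d d'"
proof -
  let ?I = "map ident w" and ?l = "d @ deriv_inv d'"
  have d'': "derivation P w (deriv_inv d') w" by (rule deriv_deriv_inv[OF d'])
  have l: "derivation P w ?l w" using d d'' by (auto simp: deriv_append)
  have "act (d' @ deriv_inv d') ?I = act [] ?I"
    by (rule deriv_eq_act[OF deriv_eq_inv[OF d'] w(1) ident_colourings])
  then have act_l: "act ?l ?I = ?I" using eq by simp
  obtain E1 E2 u where E: "expansions E1" "expansions E2" "derivation P w E1 u"
    "derivation P w E2 u" "deriv_eq P w u (?l @ E2) E1" using derivation_fraction[OF l] by blast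
  have "act E1 ?I = act E2 ?I"
    using deriv_eq_act[OF E(5) w(1) ident_colourings] act_l by simp
  then have "deriv_eq P w u E1 E2"
    using expansions_faithful[OF E(3,1) w(1) E(4,2) ident_colourings disjoint_charts_ident[OF w(2)]] by simp
  then have "deriv_eq P w u (?l @ E2) ([] @ E2)" using E(5) by (auto intro: deq_trans)
  from deriv_eq_cancel_right[OF this l _ E(4)] have l_triv: "deriv_eq P w w ?l []" by simp
  have "deriv_eq P w w (?l @ d') ([] @ d')" by (rule deriv_eq_append_right[OF l_triv d'])
  moreover have "deriv_eq P w w (d @ (deriv_inv d' @ d')) (d @ [])"
    by (rule deriv_eq_append_left[OF deriv_eq_inv'[OF d'] d])
  ultimately show ?thesis by (auto intro: deq_trans deq_sym)
qed

end

section \<open>Bumps with disjoint feet, combinatorially\<close>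

text \<open>What remains of a fast set of bumps when intervals are replaced by numbered pieces of a set: the feet of
  the bump \<open>f i\<close> with inverse \<open>f' i\<close> are the pieces \<open>p i\<close> and \<open>q i\<close>. The assumption \<open>gap\<close> records that the piece after a
  left foot is not a right foot.\<close>

locale fast_chain =
  fixes m :: nat and F :: "'i set" and p q :: "'i \<Rightarrow> nat" and X :: "'x set" and loc :: "'x \<Rightarrow> nat"
    and f f' :: "'i \<Rightarrow> 'x \<Rightarrow> 'x"
  assumes finite_F: "finite F" and m_pos: "0 < m"
    and p_q: "i \<in> F \<Longrightarrow> p i + 2 \<le> q i" and q_less: "i \<in> F \<Longrightarrow> q i < m"
    and inj_p: "inj_on p F" and inj_q: "inj_on q F"
    and p_neq_q: "i \<in> F \<Longrightarrow> j \<in> F \<Longrightarrow> p i \<noteq> q j"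
    and gap: "i \<in> F \<Longrightarrow> j \<in> F \<Longrightarrow> p i + 1 \<noteq> q j"
    and loc_less: "t \<in> X \<Longrightarrow> loc t < m"
    and f_in: "i \<in> F \<Longrightarrow> t \<in> X \<Longrightarrow> f i t \<in> X" and f'_in: "i \<in> F \<Longrightarrow> t \<in> X \<Longrightarrow> f' i t \<in> X"
    and f'_f: "i \<in> F \<Longrightarrow> t \<in> X \<Longrightarrow> f' i (f i t) = t" and f_f': "i \<in> F \<Longrightarrow> t \<in> X \<Longrightarrow> f i (f' i t) = t"
    and f_fix: "i \<in> F \<Longrightarrow> t \<in> X \<Longrightarrow> loc t < p i \<or> q i < loc t \<Longrightarrow> f i t = t"
    and f_left: "i \<in> F \<Longrightarrow> t \<in> X \<Longrightarrow> loc t = p i \<Longrightarrow> p i \<le> loc (f i t) \<and> loc (f i t) < q i"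
    and f_right: "i \<in> F \<Longrightarrow> t \<in> X \<Longrightarrow> p i < loc t \<Longrightarrow> loc t \<le> q i \<Longrightarrow> loc (f i t) = q i"
    and left_nonempty: "i \<in> F \<Longrightarrow> \<exists>t\<in>X. loc t = p i"
    and middle_nonempty: "i \<in> F \<Longrightarrow> \<exists>t\<in>X. p i < loc t \<and> loc t < q i"
begin

lemma f'_fix:
  assumes "i \<in> F" "t \<in> X" "loc t < p i \<or> q i < loc t" shows "f' i t = t"
  using f'_f[OF assms(1,2)] f_fix[OF assms] by simp

lemma f'_left:
  assumes "i \<in> F" "t \<in> X" "p i \<le> loc t" "loc t < q i" shows "loc (f' i t) = p i"
proof -
  have s: "f' i t \<in> X" "f i (f' i t) = t" using assms f'_in f_f' by auto
  consider "loc (f' i t) < p i \<or> q i < loc (f' i t)" | "p i < loc (f' i t)" "loc (f' i t) \<le> q i"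
    | "loc (f' i t) = p i" by linarith
  then show ?thesis
  proof cases
    case 1 then show ?thesis using f_fix[OF assms(1) s(1)] s(2) assms by auto
  next
    case 2 then show ?thesis using f_right[OF assms(1) s(1)] s(2) assms by auto
  qed
qed

lemma f'_right:
  assumes "i \<in> F" "t \<in> X" "loc t = q i" shows "p i < loc (f' i t) \<and> loc (f' i t) \<le> q i"
proof -
  have s: "f' i t \<in> X" "f i (f' i t) = t" using assms f'_in f_f' by auto
  consider "loc (f' i t) < p i \<or> q i < loc (f' i t)" | "p i < loc (f' i t)" "loc (f' i t) \<le> q i"
    | "loc (f' i t) = p i" by linarith
  then show ?thesis
  proof cases
    case 1 then show ?thesis using f_fix[OF assms(1) s(1)] s(2) assms p_q[OF assms(1)] by auto
  next
    case 3 then show ?thesis using f_left[OF assms(1) s(1)] s(2) assms by auto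
  qed auto
qed

definition feet :: "nat set" where "feet = p ` F \<union> q ` F"

definition foot_word :: "nat \<Rightarrow> nat list" where
  "foot_word x = (if x \<in> p ` F then [x..<q (the_inv_into F p x)] else [p (the_inv_into F q x) + 1..<x + 1])"

definition foot_merge :: "nat \<Rightarrow> 'x \<Rightarrow> 'x" where
  "foot_merge x = (if x \<in> p ` F then f' (the_inv_into F p x) else f (the_inv_into F q x))"

definition foot_split :: "nat \<Rightarrow> 'x \<Rightarrow> 'x" where
  "foot_split x = (if x \<in> p ` F then f (the_inv_into F p x) else f' (the_inv_into F q x))"

definition chain_presentation :: "nat presentation" where
  "chain_presentation = \<lparr>gens = {..<m}, rels = (\<lambda>x. ([x], foot_word x)) ` feet\<rparr>"

lemma foot_p: "i \<in> F \<Longrightarrow> foot_word (p i) = [p i..<q i]" "i \<in> F \<Longrightarrow> foot_merge (p i) = f' i"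
    "i \<in> F \<Longrightarrow> foot_split (p i) = f i"
  by (simp_all add: foot_word_def foot_merge_def foot_split_def the_inv_into_f_f[OF inj_p])

lemma foot_q: assumes "i \<in> F" shows "foot_word (q i) = [p i + 1..<q i + 1]" "foot_merge (q i) = f i"
    "foot_split (q i) = f' i"
proof -
  have "q i \<notin> p ` F" using p_neq_q assms by (metis imageE)
  then show "foot_word (q i) = [p i + 1..<q i + 1]" "foot_merge (q i) = f i" "foot_split (q i) = f' i"
    using assms by (simp_all add: foot_word_def foot_merge_def foot_split_def the_inv_into_f_f[OF inj_q])
qed

lemma feet_cases:
  assumes "x \<in> feet" obtains i where "i \<in> F" "x = p i" | i where "i \<in> F" "x = q i"
  using assms by (auto simp: feet_def)

lemma foot_word_bounds: "x \<in> feet \<Longrightarrow> 2 \<le> length (foot_word x) \<and> set (foot_word x) \<subseteq> {..<m} \<and> x < m"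
proof (erule feet_cases)
  fix i assume i: "i \<in> F" "x = p i"
  show ?thesis unfolding i(2) foot_p(1)[OF i(1)] using p_q[OF i(1)] q_less[OF i(1)] by auto
next
  fix i assume i: "i \<in> F" "x = q i"
  show ?thesis unfolding i(2) foot_q(1)[OF i(1)] using p_q[OF i(1)] q_less[OF i(1)] by auto
qed

lemma chain_presentation_finite: "finite_semigroup_presentation chain_presentation"
proof -
  have "finite feet" using finite_F by (simp add: feet_def)
  moreover have "word chain_presentation [x] \<and> word chain_presentation (foot_word x) \<and> [x] \<noteq> foot_word x"
    if "x \<in> feet" for x
    using foot_word_bounds[OF that]
    by (auto simp: word_def chain_presentation_def dest: arg_cong[of _ _ length])
  ultimately show ?thesis by (auto simp: finite_semigroup_presentation_def chain_presentation_def)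
qed

sublocale expansion_dynamics chain_presentation feet foot_word X loc foot_merge foot_split
proof
  show "finite_semigroup_presentation chain_presentation" by (rule chain_presentation_finite)
  show "rels chain_presentation = (\<lambda>x. ([x], foot_word x)) ` feet" by (simp add: chain_presentation_def)
next
  fix x assume x: "x \<in> feet"
  show "2 \<le> length (foot_word x)" using foot_word_bounds[OF x] by simp
  show "distinct (foot_word x)" by (simp add: foot_word_def)
next
  fix x t assume x: "x \<in> feet" and t: "t \<in> X" "loc t \<in> set (foot_word x)"
  from x show "foot_merge x t \<in> X \<and> loc (foot_merge x t) = x \<and> foot_split x (foot_merge x t) = t"
  proof (cases rule: feet_cases)
    case (1 i) then show ?thesis using t f'_in f'_left f_f' by (simp add: foot_p)
  next
    case (2 i)
    then have "p i < loc t" "loc t \<le> q i" using t(2) by (auto simp: foot_q)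
    then show ?thesis using 2 t f_in f_right f'_f by (simp add: foot_q)
  qed
next
  fix x t assume x: "x \<in> feet" and t: "t \<in> X" "loc t = x"
  from x show "foot_split x t \<in> X \<and> loc (foot_split x t) \<in> set (foot_word x) \<and> foot_merge x (foot_split x t) = t"
  proof (cases rule: feet_cases)
    case (1 i) then show ?thesis using t f_in f_left f'_f by (simp add: foot_p)
  next
    case (2 i) then show ?thesis using t f'_in f'_right[OF 2(1) t(1)] f_f' by (auto simp: foot_q)
  qed
next
  fix x l assume x: "x \<in> feet" and l: "l \<in> set (foot_word x)"
  from x show "\<exists>t\<in>X. loc t \<in> set (foot_word x) \<and> loc t \<noteq> l"
  proof (cases rule: feet_cases)
    case (1 i)
    obtain s t where st: "s \<in> X" "loc s = p i" "t \<in> X" "p i < loc t" "loc t < q i"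
      using left_nonempty middle_nonempty 1(1) by metis
    show ?thesis unfolding 1(2) foot_p(1)[OF 1(1)]
      using st by (intro bexI[of _ "if l = p i then t else s"]) auto
  next
    case (2 i)
    obtain t where t: "t \<in> X" "p i < loc t" "loc t < q i" using middle_nonempty 2(1) by metis
    then have "f i t \<in> X" "loc (f i t) = q i" using f_in f_right 2(1) by auto
    then show ?thesis unfolding 2(2) foot_q(1)[OF 2(1)]
      using t p_q[OF 2(1)] by (intro bexI[of _ "if l = q i then t else f i t"]) auto
  qed
qed

abbreviation top_word :: "nat list" where "top_word \<equiv> [0..<m]"

lemma word_top: "word chain_presentation top_word"
  using m_pos by (auto simp: word_def chain_presentation_def)

subsection \<open>The group generated by the bumps\<close>

inductive_set generated :: "('x \<Rightarrow> 'x) set" where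
  gen_id: "id \<in> generated"
| gen_f: "i \<in> F \<Longrightarrow> g \<in> generated \<Longrightarrow> f i \<circ> g \<in> generated"
| gen_f': "i \<in> F \<Longrightarrow> g \<in> generated \<Longrightarrow> f' i \<circ> g \<in> generated"

lemma generated_comp: "g \<in> generated \<Longrightarrow> h \<in> generated \<Longrightarrow> g \<circ> h \<in> generated"
  by (induction rule: generated.induct) (auto simp: comp_assoc intro: generated.intros)

lemma generated_f: "i \<in> F \<Longrightarrow> f i \<in> generated" "i \<in> F \<Longrightarrow> f' i \<in> generated"
  using gen_f[OF _ gen_id] gen_f'[OF _ gen_id] by simp_all

lemma generated_in: "g \<in> generated \<Longrightarrow> t \<in> X \<Longrightarrow> g t \<in> X"
  by (induction arbitrary: t rule: generated.induct) (auto simp: f_in f'_in)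

lemma generated_inverse:
  "g \<in> generated \<Longrightarrow> \<exists>h\<in>generated. \<forall>t\<in>X. h (g t) = t \<and> g (h t) = t"
proof (induction rule: generated.induct)
  case gen_id show ?case by (intro bexI[of _ id]) (auto intro: generated.gen_id)
next
  case (gen_f i g)
  then obtain h where h: "h \<in> generated" "\<forall>t\<in>X. h (g t) = t \<and> g (h t) = t" by blast
  have "h \<circ> f' i \<in> generated" by (rule generated_comp[OF h(1) generated_f(2)[OF gen_f(1)]])
  moreover have "\<forall>t\<in>X. (h \<circ> f' i) ((f i \<circ> g) t) = t \<and> (f i \<circ> g) ((h \<circ> f' i) t) = t"
    using h(2) gen_f(1,2) f'_f f_f' f'_in generated_in by simp
  ultimately show ?case by blast
next
  case (gen_f' i g)
  then obtain h where h: "h \<in> generated" "\<forall>t\<in>X. h (g t) = t \<and> g (h t) = t" by blast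
  have "h \<circ> f i \<in> generated" by (rule generated_comp[OF h(1) generated_f(1)[OF gen_f'(1)]])
  moreover have "\<forall>t\<in>X. (h \<circ> f i) ((f' i \<circ> g) t) = t \<and> (f' i \<circ> g) ((h \<circ> f i) t) = t"
    using h(2) gen_f'(1,2) f'_f f_f' f_in generated_in by simp
  ultimately show ?case by blast
qed

text \<open>The canonical charts of the words spelt by a reader who is about to read the letter \<open>k\<close>, reads the letters in increasing
  order and may jump from \<open>q i\<close> to \<open>p i + 1\<close>. Jumps correspond to expansions of right feet; left feet are never
  expanded.\<close>

inductive scan :: "nat \<Rightarrow> nat list \<Rightarrow> ('x \<Rightarrow> 'x option) list \<Rightarrow> bool" where
  scan_end: "scan m [] []"
| scan_read: "k < m \<Longrightarrow> scan (Suc k) u ns \<Longrightarrow> scan k (k # u) (ident k # ns)"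
| scan_jump: "i \<in> F \<Longrightarrow> scan (Suc (p i)) u ns \<Longrightarrow> scan (q i) u (map (post (f i)) ns)"

lemma scan_charts: "scan k u ns \<Longrightarrow> ns \<in> colourings charts u"
proof (induction rule: scan.induct)
  case (scan_read k u ns)
  then show ?case using ident_charts by (simp add: colourings_def)
next
  case (scan_jump i u ns)
  have "post (f i) c \<in> charts l" if "c \<in> charts l" for c l
    using that f_in[OF scan_jump(1)] by (auto simp: charts_def ran_post)
  then show ?case using scan_jump by (auto simp: colourings_def list_all2_map1 elim: list_all2_mono)
qed (simp add: colourings_def)

lemma colourings_ran: "cs \<in> colourings charts u \<Longrightarrow> c \<in> set cs \<Longrightarrow> ran c \<subseteq> X"
  by (auto simp: colourings_def charts_def list_all2_conv_all_nth in_set_conv_nth)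

lemma scan_support: "scan k u ns \<Longrightarrow> c \<in> set ns \<Longrightarrow> t \<in> ran c \<Longrightarrow> t \<in> X \<and> k \<le> loc t"
proof (induction arbitrary: c t rule: scan.induct)
  case (scan_read k u ns)
  then show ?case by (fastforce simp: region_def)
next
  case (scan_jump i u ns)
  then obtain c0 t0 where c0: "c0 \<in> set ns" "t0 \<in> ran c0" "t = f i t0" by (auto simp: ran_post)
  then have t0: "t0 \<in> X" "Suc (p i) \<le> loc t0" using scan_jump.IH by auto
  have "q i \<le> loc (f i t0)"
    using f_right[OF scan_jump(1) t0(1)] f_fix[OF scan_jump(1) t0(1)] t0(2)
    by (cases "loc t0 \<le> q i") auto
  then show ?case using c0(3) f_in[OF scan_jump(1) t0(1)] by simp
qed simp

lemma scan_cover: "scan k u ns \<Longrightarrow> t \<in> X \<Longrightarrow> k \<le> loc t \<Longrightarrow> \<exists>c\<in>set ns. t \<in> ran c"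
proof (induction arbitrary: t rule: scan.induct)
  case scan_end
  then show ?case using loc_less by fastforce
next
  case (scan_read k u ns)
  then show ?case by (cases "loc t = k") (auto simp: region_def)
next
  case (scan_jump i u ns)
  have "f' i t \<in> X" using f'_in scan_jump by simp
  moreover have "Suc (p i) \<le> loc (f' i t)"
    using f'_right[OF scan_jump(1), of t] f'_fix[OF scan_jump(1), of t] scan_jump.prems p_q[OF scan_jump(1)]
    by (cases "loc t = q i") auto
  ultimately obtain c where "c \<in> set ns" "f' i t \<in> ran c" using scan_jump.IH by blast
  then show ?case using f_f'[OF scan_jump(1), of t] scan_jump.prems 
    by (intro bexI[of _ "post (f i) c"]) (auto simp: ran_post intro!: image_eqI[of _ _ "f' i t"])
qed

lemma scan_not_q: "scan k u ns \<Longrightarrow> k \<notin> q ` F \<Longrightarrow>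
    (k = m \<and> u = [] \<and> ns = []) \<or> (\<exists>u0 ns0. k < m \<and> u = k # u0 \<and> ns = ident k # ns0 \<and> scan (Suc k) u0 ns0)"
  by (erule scan.cases) auto

lemma scan_after_jump:
  assumes "i \<in> F" "scan (Suc (p i)) u ns"
  shows "\<exists>u0. u = Suc (p i) # u0"
proof -
  have "Suc (p i) \<notin> q ` F" using gap[OF assms(1)] by auto
  moreover have "Suc (p i) < m" using p_q[OF assms(1)] q_less[OF assms(1)] by simp
  ultimately show ?thesis using scan_not_q[OF assms(2)] by auto
qed

text \<open>The next letter of the word tells whether the reader jumps, because \<open>p i + 1\<close> is not a right foot and so must
  be read after a jump.\<close>

lemma scan_unique: "scan k u ns \<Longrightarrow> scan k u ns' \<Longrightarrow> ns = ns'"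
proof (induction arbitrary: ns' rule: scan.induct)
  case scan_end
  show ?case using scan_end
    by (cases rule: scan.cases) (use q_less in auto)
next
  case (scan_read k u ns)
  from scan_read.prems show ?case
  proof (cases rule: scan.cases)
    case (scan_jump i ns0)
    from scan_after_jump[OF scan_jump(3,4)] scan_jump(1) p_q[OF scan_jump(3)] show ?thesis by auto
  qed (use scan_read in auto)
next
  case (scan_jump i u ns)
  obtain u0 where u0: "u = Suc (p i) # u0" using scan_after_jump[OF scan_jump(1,2)] by blast
  from scan_jump.prems show ?case
  proof (cases rule: scan.cases)
    case scan_end then show ?thesis using q_less[OF scan_jump(1)] by simp
  next
    case (scan_read u1 ns1)
    then show ?thesis using u0 p_q[OF scan_jump(1)] by auto
  next
    case (scan_jump j ns1)
    then have "j = i" using inj_q \<open>i \<in> F\<close> by (auto simp: inj_on_def)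
    then show ?thesis using scan_jump scan_jump.IH by auto
  qed
qed

lemma scan_run: "scan j u ns \<Longrightarrow> k \<le> j \<Longrightarrow> j \<le> m \<Longrightarrow> scan k ([k..<j] @ u) (map ident [k..<j] @ ns)"
proof (induction "j - k" arbitrary: k)
  case (Suc n)
  then have "k < j" by simp
  have "scan (Suc k) ([Suc k..<j] @ u) (map ident [Suc k..<j] @ ns)" using Suc by simp
  from scan_read[OF _ this] \<open>k < j\<close> Suc.prems show ?case by (simp add: upt_conv_Cons)
qed simp

lemma refine_ident:
  assumes "x \<in> feet" "l \<in> set (foot_word x)"
  shows "refine x (ident x) l = post (foot_merge x) (ident l)"
  using merge_region[OF assms] by (auto simp: refine_def ident_def fun_eq_iff post_apply)

lemma rechart_ident:
  "x \<in> feet \<Longrightarrow> rechart [x] (foot_word x) [ident x] = map (\<lambda>l. post (foot_merge x) (ident l)) (foot_word x)"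
  using refine_ident by (simp add: rechart_expand)

lemma post_id [simp]: "post id c = c" "post (\<lambda>t. t) c = c"
  by (simp_all add: post_ident)

lemma post_ident_eq: "(\<And>t. t \<in> X \<Longrightarrow> loc t = l \<Longrightarrow> g t = t) \<Longrightarrow> post g (ident l) = ident l"
  by (rule post_ident) (auto simp: region_def)

text \<open>After one more expansion the charts are again canonical up to a factor \<open>g\<close>. For a right foot \<open>q i\<close> about
  to be read, the expansion is a jump of the reader, and \<open>g\<close> is the identity. For a left foot \<open>p i\<close> the canonical charts of the new
  word use a jump from \<open>q i\<close> instead of the expansion of \<open>p i\<close>; the charts differ by \<open>f' i\<close>. The factor has to pass
  the letters and jumps read before: it fixes the pieces to the left of \<open>k\<close>, so it commutes with reading,
  and a jump conjugates it by the bump.\<close>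

lemma scan_expand:
  "scan k u ns \<Longrightarrow> u = \<alpha> @ [x] @ \<beta> \<Longrightarrow> x \<in> feet \<Longrightarrow>
   \<exists>g\<in>generated. (\<forall>t\<in>X. loc t < k \<longrightarrow> g t = t) \<and>
     (\<exists>ns'. scan k (\<alpha> @ foot_word x @ \<beta>) ns' \<and> act [(length \<alpha>, [x], foot_word x)] ns = map (post g) ns')"
proof (induction arbitrary: \<alpha> rule: scan.induct)
  case scan_end then show ?case by simp
next
  case (scan_read k u ns)
  show ?case
  proof (cases \<alpha>)
    case Nil
    then have x: "x = k" "\<beta> = u" using scan_read.prems by auto
    have act: "act [(length \<alpha>, [x], foot_word x)] (ident k # ns) =
        map (\<lambda>l. post (foot_merge x) (ident l)) (foot_word x) @ ns"
      using refine_ident[OF scan_read.prems(2)] Nil x by (simp add: rechart_expand)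
    from scan_read.prems(2) show ?thesis
    proof (cases rule: feet_cases)
      case (1 i)
      have k: "k = p i" using 1 x by simp
      let ?ns = "map ident [p i..<q i] @ map (post (f i)) ns"
      have "scan (Suc (p i)) u ns" using scan_read.hyps(2) k by simp
      from scan_run[OF scan.scan_jump[OF 1(1) this], of "p i"] p_q[OF 1(1)] q_less[OF 1(1)]
      have "scan k ([p i..<q i] @ u) ?ns" using k by simp
      moreover have "post (f' i) (post (f i) c) = c" if "c \<in> set ns" for c
        unfolding post_comp using scan_support[OF scan_read.hyps(2) that] f'_f[OF 1(1)]
        by (intro post_ident) simp
      then have "act [(length \<alpha>, [x], foot_word x)] (ident k # ns) = map (post (f' i)) ?ns"
        unfolding act unfolding 1(2) foot_p[OF 1(1)] by (simp add: map_idI)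
      moreover have "\<forall>t\<in>X. loc t < k \<longrightarrow> f' i t = t" using f'_fix[OF 1(1)] k by simp
      ultimately show ?thesis using generated_f(2)[OF 1(1)] Nil x 1 foot_p(1)[OF 1(1)]
        by (intro bexI[of _ "f' i"] conjI exI[of _ ?ns]) simp_all
    next
      case (2 i)
      have k: "k = q i" using 2 x by simp
      let ?ns0 = "map ident [Suc (p i)..<Suc (q i)] @ ns"
      have "scan (Suc (q i)) u ns" using scan_read.hyps(2) k by simp
      from scan_run[OF this, of "Suc (p i)"] p_q[OF 2(1)] q_less[OF 2(1)]
      have "scan (Suc (p i)) ([Suc (p i)..<Suc (q i)] @ u) ?ns0" by simp
      from scan.scan_jump[OF 2(1) this]
      have "scan k ([Suc (p i)..<Suc (q i)] @ u) (map (post (f i)) ?ns0)" using k by simp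
      moreover have "post (f i) c = c" if "c \<in> set ns" for c
        using scan_support[OF scan_read.hyps(2) that] f_fix[OF 2(1)] k
        by (intro post_ident) (metis Suc_le_lessD)
      then have "act [(length \<alpha>, [x], foot_word x)] (ident k # ns) = map (post id) (map (post (f i)) ?ns0)"
        unfolding act unfolding 2(2) foot_q[OF 2(1)] by (simp add: map_idI post_comp)
      ultimately have act': "act [(length \<alpha>, [x], foot_word x)] (ident k # ns) = map (post id) (map (post (f i)) ?ns0)"
        and sc: "scan k ([Suc (p i)..<Suc (q i)] @ u) (map (post (f i)) ?ns0)" by blast+
      have "foot_word x = [Suc (p i)..<Suc (q i)]" using foot_q(1)[OF 2(1)] 2(2) by simp
      then have sc': "scan k (\<alpha> @ foot_word x @ \<beta>) (map (post (f i)) ?ns0)"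
        using sc Nil x(2) by (simp del: upt_Suc)
      show ?thesis
        by (rule bexI[OF _ gen_id], intro conjI, simp, rule exI, rule conjI, rule sc', rule act')
    qed
  next
    case (Cons a \<alpha>')
    then have a: "a = k" "u = \<alpha>' @ [x] @ \<beta>" using scan_read.prems by auto
    from scan_read.IH[OF a(2) scan_read.prems(2)] obtain g ns' where g: "g \<in> generated"
      "\<forall>t\<in>X. loc t < Suc k \<longrightarrow> g t = t" "scan (Suc k) (\<alpha>' @ foot_word x @ \<beta>) ns'"
      "act [(length \<alpha>', [x], foot_word x)] ns = map (post g) ns'" by blast
    have "scan k (\<alpha> @ foot_word x @ \<beta>) (ident k # ns')"
      using scan.scan_read[OF scan_read.hyps(1) g(3)] Cons a by simp
    moreover have "act [(length \<alpha>, [x], foot_word x)] (ident k # ns) = map (post g) (ident k # ns')"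
      using g(4) Cons post_ident_eq[of k g] g(2) by simp
    ultimately show ?thesis using g(1,2) by (intro bexI[of _ g] conjI exI[of _ "ident k # ns'"]) auto
  qed
next
  case (scan_jump i u ns)
  from scan_jump.IH[OF scan_jump.prems] obtain g ns' where g: "g \<in> generated"
    "\<forall>t\<in>X. loc t < Suc (p i) \<longrightarrow> g t = t" "scan (Suc (p i)) (\<alpha> @ foot_word x @ \<beta>) ns'"
    "act [(length \<alpha>, [x], foot_word x)] ns = map (post g) ns'" by blast
  let ?h = "f i \<circ> (g \<circ> f' i)"
  have h: "?h \<in> generated"
    by (intro gen_f generated_comp g generated_f scan_jump.hyps(1))
  have "derivation chain_presentation u [(length \<alpha>, [x], foot_word x)] (\<alpha> @ foot_word x @ \<beta>)"
    using scan_jump.prems expand_rel by (auto simp: deriv_Cons_iff)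
  from act_post[OF this scan_charts[OF scan_jump.hyps(2)]]
  have "act [(length \<alpha>, [x], foot_word x)] (map (post (f i)) ns) = map (post (f i)) (map (post g) ns')"
    unfolding g(4) .
  also have "\<dots> = map (post ?h) (map (post (f i)) ns')"
    unfolding map_map
  proof (intro map_cong refl)
    fix c assume "c \<in> set ns'"
    then have "post (f i \<circ> g) c = post (?h \<circ> f i) c"
      using scan_support[OF g(3)] f'_f[OF scan_jump.hyps(1)] by (intro post_cong) simp
    then show "(post (f i) \<circ> post g) c = (post ?h \<circ> post (f i)) c" by (simp add: post_comp)
  qed
  finally have act: "act [(length \<alpha>, [x], foot_word x)] (map (post (f i)) ns) = map (post ?h) (map (post (f i)) ns')" .
  have fix_h: "?h t = t" if t: "t \<in> X" "loc t < q i" for t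
  proof -
    have "loc (f' i t) < Suc (p i)"
      using f'_left[OF scan_jump.hyps(1) t(1)] f'_fix[OF scan_jump.hyps(1) t(1)] t(2)
      by (cases "p i \<le> loc t") auto
    then have "g (f' i t) = f' i t" using g(2) f'_in[OF scan_jump.hyps(1) t(1)] by simp
    then show ?thesis using f_f'[OF scan_jump.hyps(1) t(1)] by simp
  qed
  note sc = scan.scan_jump[OF scan_jump.hyps(1) g(3)]
  show ?case
    by (rule bexI[OF _ h], intro conjI ballI impI, rule fix_h, assumption, assumption,
        rule exI, rule conjI, rule sc, rule act)
qed

lemma expansions_scan:
  "derivation chain_presentation top_word E u \<Longrightarrow> expansions E \<Longrightarrow>
   \<exists>g\<in>generated. \<exists>ns. scan 0 u ns \<and> act E (map ident top_word) = map (post g) ns"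
proof (induction E arbitrary: u rule: rev_induct)
  case Nil
  have "scan 0 ([0..<m] @ []) (map ident [0..<m] @ [])" by (rule scan_run[OF scan_end]) auto
  then have "scan 0 u (map ident top_word)" using Nil by simp
  moreover have "map ident top_word = map (post id) (map ident top_word)"
    by (simp add: post_ident)
  ultimately show ?case using gen_id
    by (intro bexI[of _ id] exI[of _ "map ident top_word"] conjI) simp_all
next
  case (snoc s E)
  obtain i a b where s: "s = (i, a, b)" by (cases s)
  from snoc.prems obtain u0 where u0: "derivation chain_presentation top_word E u0"
    "derivation chain_presentation u0 [s] u" by (auto simp: deriv_append)
  from snoc.prems(2) s obtain x where x: "x \<in> feet" "a = [x]" "b = foot_word x" by auto
  from u0(2) obtain \<alpha> \<beta> where ab: "u0 = \<alpha> @ [x] @ \<beta>" "u = \<alpha> @ foot_word x @ \<beta>" "s = (length \<alpha>, [x], foot_word x)"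
    by (auto simp: s x deriv_Cons_iff)
  from snoc.IH[OF u0(1)] snoc.prems(2) obtain g ns where g: "g \<in> generated" "scan 0 u0 ns"
    "act E (map ident top_word) = map (post g) ns" by auto
  from scan_expand[OF g(2) ab(1) x(1)] obtain h ns' where h: "h \<in> generated"
    "scan 0 u ns'" "act [s] ns = map (post h) ns'" unfolding ab(2,3) by blast
  have "act (E @ [s]) (map ident top_word) = map (post g) (act [s] ns)"
    using act_post[OF u0(2) scan_charts[OF g(2)], of g] g(3) by simp
  also have "\<dots> = map (post (g \<circ> h)) ns'" unfolding h(3) by (simp add: post_comp)
  finally show ?case using generated_comp[OF g(1) h(1)] h(2) by blast
qed

text \<open>Let \<open>H\<close> be the self-map of \<open>X\<close> given by the charts of the loop. Writing the loop as a fraction gives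
  \<open>H \<circ> g2 = g1\<close> on the ranges of the canonical charts of \<open>u\<close>. These cover \<open>X\<close>, so \<open>H\<close> lies in the group.\<close>

theorem loop_generated:
  assumes "derivation chain_presentation top_word d top_word"
  shows "\<exists>g\<in>generated. act d (map ident top_word) = map (\<lambda>l. post g (ident l)) top_word"
proof -
  let ?I = "map ident top_word" and ?cs = "act d (map ident top_word)"
  obtain E1 E2 u where E: "expansions E1" "expansions E2" "derivation chain_presentation top_word E1 u"
    "derivation chain_presentation top_word E2 u" "deriv_eq chain_presentation top_word u (d @ E2) E1"
    using derivation_fraction[OF assms] by blast
  obtain g1 ns where g1: "g1 \<in> generated" "scan 0 u ns" "act E1 ?I = map (post g1) ns"
    using expansions_scan[OF E(3,1)] by blast
  obtain g2 ns' where "g2 \<in> generated" "scan 0 u ns'" "act E2 ?I = map (post g2) ns'"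
    using expansions_scan[OF E(4,2)] by blast
  then have g2: "g2 \<in> generated" "act E2 ?I = map (post g2) ns" using scan_unique g1(2) by auto
  have cs: "?cs \<in> colourings charts top_word" by (rule act_colourings[OF assms ident_colourings])
  define H where "H t = the ((?cs ! loc t) t)" for t
  have csH: "?cs = map (post H) ?I"
  proof (rule nth_equalityI)
    show len: "length ?cs = length (map (post H) ?I)" using colourings_length[OF cs] by simp
    fix l assume "l < length ?cs"
    then have l: "l < m" using len by simp
    have c: "dom (?cs ! l) = region l" using colourings_nth[OF cs, of l] l by (simp add: charts_def)
    have "(?cs ! l) t = post H (ident l) t" for t
    proof (cases "t \<in> region l")
      case True
      then obtain s where "(?cs ! l) t = Some s" using c by blast
      then show ?thesis using True regionD[OF True] by (simp add: H_def ident_def post_apply)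
    next
      case False
      then have "(?cs ! l) t = None" using c by blast
      then show ?thesis using False by (simp add: ident_def post_apply)
    qed
    then show "?cs ! l = map (post H) ?I ! l" using l by (simp add: fun_eq_iff)
  qed
  have "act E1 ?I = act E2 ?cs"
    using deriv_eq_act[OF E(5) word_top ident_colourings] by simp
  also have "\<dots> = map (post H) (act E2 ?I)" using csH act_post[OF E(4) ident_colourings] by simp
  finally have eq: "map (post g1) ns = map (post (H \<circ> g2)) ns" using g1(3) g2(2) by (simp add: post_comp)
  have H: "H (g2 t) = g1 t" if t: "t \<in> X" for t
  proof -
    obtain c where c: "c \<in> set ns" "t \<in> ran c" using scan_cover[OF g1(2) t] by auto
    then obtain s where s: "c s = Some t" by (auto simp: ran_def)
    have "post g1 c s = post (H \<circ> g2) c s" using eq c(1) by simp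
    then show ?thesis using s by (simp add: post_apply)
  qed
  obtain h where h: "h \<in> generated" "\<forall>t\<in>X. h (g2 t) = t \<and> g2 (h t) = t"
    using generated_inverse[OF g2(1)] by blast
  have "post H (ident l) = post (g1 \<circ> h) (ident l)" for l
  proof (rule post_cong)
    fix t assume "t \<in> ran (ident l)"
    then have t: "t \<in> X" by (simp add: region_def)
    show "H t = (g1 \<circ> h) t" using H[OF generated_in[OF h(1) t]] h(2) t by simp
  qed
  then have "?cs = map (\<lambda>l. post (g1 \<circ> h) (ident l)) top_word" unfolding csH by simp
  then show ?thesis using generated_comp[OF g1(1) h(1)] by blast
qed

lemma loop_comp:
  assumes "derivation chain_presentation top_word d top_word" "derivation chain_presentation top_word d' top_word"
    "act d (map ident top_word) = map (\<lambda>l. post g (ident l)) top_word"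
    "act d' (map ident top_word) = map (\<lambda>l. post g' (ident l)) top_word"
  shows "act (d @ d') (map ident top_word) = map (\<lambda>l. post (g \<circ> g') (ident l)) top_word"
proof -
  have "act (d @ d') (map ident top_word) = act d' (map (post g) (map ident top_word))"
    using assms(3) by (simp add: comp_def)
  also have "\<dots> = map (post g) (act d' (map ident top_word))"
    by (rule act_post[OF assms(2) ident_colourings])
  finally show ?thesis using assms(4) by (simp add: post_comp comp_def)
qed

text \<open>The loop expands the left foot, \<open>p i = p i \<dots> (q i - 1)\<close>, and then contracts \<open>(p i + 1) \<dots> q i\<close> to the right foot;
  both steps apply \<open>f' i\<close>.\<close>

lemma loop_f':
  assumes i: "i \<in> F"
  obtains d where "derivation chain_presentation top_word d top_word"
    "act d (map ident top_word) = map (\<lambda>l. post (f' i) (ident l)) top_word"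
proof -
  let ?p = "p i" and ?q = "q i"
  have b: "?p + 2 \<le> ?q" "?q < m" using p_q[OF i] q_less[OF i] by auto
  define A B R where "A = [0..<?p]" and "B = [Suc ?p..<?q]" and "R = [Suc ?q..<m]"
  have top: "top_word = A @ [?p] @ B @ [?q] @ R"
  proof -
    have app: "[a..<c] = [a..<b] @ [b..<c]" if "a \<le> b" "b \<le> c" for a b c :: nat
      using upt_add_eq_append[OF that(1), of "c - b"] that(2) by simp
    have "[0..<m] = [0..<?p] @ [?p..<m]" using b by (intro app) auto
    also have "[?p..<m] = ?p # [Suc ?p..<m]" using b by (simp add: upt_conv_Cons)
    also have "[Suc ?p..<m] = [Suc ?p..<?q] @ [?q..<m]" using b by (intro app) auto
    also have "[?q..<m] = ?q # [Suc ?q..<m]" using b by (simp add: upt_conv_Cons)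
    finally show ?thesis by (simp add: A_def B_def R_def)
  qed
  have words: "foot_word ?p = ?p # B" "foot_word ?q = B @ [?q]"
    using b unfolding foot_p(1)[OF i] foot_q(1)[OF i] B_def by (simp_all add: upt_conv_Cons)
  let ?s1 = "(length A, [?p], foot_word ?p)" and ?s2 = "(length (A @ foot_word ?p), foot_word ?q, [?q])"
  have feet: "?p \<in> feet" "?q \<in> feet" using i by (auto simp: feet_def)
  have d1: "derivation chain_presentation top_word [?s1] (A @ foot_word ?p @ B @ [?q] @ R)"
    unfolding top using expand_rel[OF feet(1)] by (auto simp: deriv_Cons_iff)
  have d2: "derivation chain_presentation ((A @ foot_word ?p) @ foot_word ?q @ R) [?s2] ((A @ foot_word ?p) @ [?q] @ R)"
    using sym_relsD[OF expand_rel[OF feet(2)]] unfolding deriv_Cons_iff deriv_Nil_iff by blast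
  have d: "derivation chain_presentation top_word ([?s1] @ [?s2]) top_word"
    unfolding deriv_append using d1 d2 by (intro exI[of _ "A @ foot_word ?p @ B @ [?q] @ R"]) (simp add: top words)
  have fix_f': "post (f' i) (ident l) = ident l" if "l \<in> set A \<union> set R" for l
    using that f'_fix[OF i] by (intro post_ident_eq) (auto simp: A_def R_def)
  have a1: "act [?s1] (map ident top_word) =
      (map ident A @ map (\<lambda>l. post (f' i) (ident l)) (foot_word ?p)) @ map ident (foot_word ?q) @ map ident R"
  proof -
    have I: "map ident top_word = map ident A @ [ident ?p] @ (map ident (foot_word ?q) @ map ident R)"
      by (simp add: top words(2))
    have r: "rechart [?p] (foot_word ?p) [ident ?p] = map (\<lambda>l. post (f' i) (ident l)) (foot_word ?p)"
      using rechart_ident[OF feet(1)] foot_p(2)[OF i] by simp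
    show ?thesis unfolding I by (subst act_Cons_split) (simp_all add: r)
  qed
  have glue: "glue (foot_word ?q) (map ident (foot_word ?q)) ?q = post (f' i) (ident ?q)"
  proof
    fix t show "glue (foot_word ?q) (map ident (foot_word ?q)) ?q t = post (f' i) (ident ?q) t"
    proof (cases "t \<in> region ?q")
      case True
      then have "f' i t \<in> X" "loc (f' i t) \<in> set (foot_word ?q)"
        using split[OF feet(2), of t] foot_q[OF i] regionD[OF True] by auto
      then show ?thesis using True
        by (simp add: glue_def ident_def foot_q(3)[OF i] map_of_zip_map region_def post_apply)
    qed (simp add: glue_def ident_def post_apply)
  qed
  have "act ([?s1] @ [?s2]) (map ident top_word) =
      act [?s2] ((map ident A @ map (\<lambda>l. post (f' i) (ident l)) (foot_word ?p)) @ map ident (foot_word ?q) @ map ident R)"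
    by (simp only: act_append a1)
  also have "\<dots> = (map ident A @ map (\<lambda>l. post (f' i) (ident l)) (foot_word ?p)) @ [post (f' i) (ident ?q)] @ map ident R"
    using act_Cons_split[of "map ident A @ map (\<lambda>l. post (f' i) (ident l)) (foot_word ?p)" _ "map ident (foot_word ?q)"
        "foot_word ?q" "[?q]" "[]" "map ident R"] rechart_contract[OF feet(2)] glue by simp
  also have "\<dots> = map (\<lambda>l. post (f' i) (ident l)) top_word"
    unfolding top words(1) using fix_f' by simp
  finally show thesis using that[OF d] by simp
qed

text \<open>Loops compose, and the inverse of the loop for \<open>f' i\<close> is one for \<open>f i\<close>.\<close>

theorem generated_loop:
  "g \<in> generated \<Longrightarrow> \<exists>d. derivation chain_presentation top_word d top_word \<and>
     act d (map ident top_word) = map (\<lambda>l. post g (ident l)) top_word"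
proof (induction rule: generated.induct)
  case gen_id
  then show ?case by (intro exI[of _ "[]"]) (simp add: post_ident)
next
  case (gen_f' i g)
  obtain d where "derivation chain_presentation top_word d top_word"
    "act d (map ident top_word) = map (\<lambda>l. post (f' i) (ident l)) top_word" using loop_f'[OF gen_f'(1)] .
  moreover obtain e where "derivation chain_presentation top_word e top_word"
    "act e (map ident top_word) = map (\<lambda>l. post g (ident l)) top_word" using gen_f'.IH by blast
  ultimately show ?case using loop_comp[of d e "f' i" g]
    by (intro exI[of _ "d @ e"] conjI) (auto simp only: deriv_append)
next
  case (gen_f i g)
  obtain d where d: "derivation chain_presentation top_word d top_word"
    "act d (map ident top_word) = map (\<lambda>l. post (f' i) (ident l)) top_word" using loop_f'[OF gen_f(1)] .
  let ?d = "deriv_inv d" and ?I = "map ident top_word"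
  have d': "derivation chain_presentation top_word ?d top_word" by (rule deriv_deriv_inv[OF d(1)])
  have "?I = act (d @ ?d) ?I"
    using deriv_eq_act[OF deriv_eq_inv[OF d(1)] word_top ident_colourings] by simp
  also have "\<dots> = act ?d (map (post (f' i)) ?I)" using d(2) by (simp add: comp_def)
  also have "\<dots> = map (post (f' i)) (act ?d ?I)" by (rule act_post[OF d' ident_colourings])
  finally have "map (post (f i)) ?I = map (post (f i)) (map (post (f' i)) (act ?d ?I))" by simp
  also have "\<dots> = act ?d ?I"
    unfolding map_map
  proof (rule map_idI)
    fix c assume "c \<in> set (act ?d ?I)"
    then have "ran c \<subseteq> X" using colourings_ran[OF act_colourings[OF d' ident_colourings]] by simp
    then show "(post (f i) \<circ> post (f' i)) c = c"
      using f_f'[OF gen_f(1)] by (auto simp: post_comp intro!: post_ident)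
  qed
  finally have "act ?d ?I = map (\<lambda>l. post (f i) (ident l)) top_word" by (simp add: comp_def)
  moreover obtain e where "derivation chain_presentation top_word e top_word"
    "act e ?I = map (\<lambda>l. post g (ident l)) top_word" using gen_f.IH by blast
  ultimately show ?case using d' loop_comp[of ?d e "f i" g]
    by (intro exI[of _ "?d @ e"] conjI) (auto simp only: deriv_append)
qed

subsection \<open>Holonomy of loops\<close>

text \<open>The charts on the bottom path form the map \<open>g\<close>, which matters on \<open>X\<close> only.\<close>

definition hol :: "nat diag \<Rightarrow> ('x \<Rightarrow> 'x) \<Rightarrow> bool" where
  "hol D g \<longleftrightarrow> word_diagram chain_presentation top_word top_word D \<and>
     holonomy D (map ident top_word) (map (\<lambda>l. post g (ident l)) top_word)"

lemma word_diagram_built: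
  assumes "word_diagram chain_presentation top_word top_word D"
  obtains d where "built chain_presentation top_word d D" "derivation chain_presentation top_word d top_word"
proof -
  from assms have D: "diagram chain_presentation D" "path_label D (top_path D) = top_word"
    "path_label D (bot_path D) = top_word" by (auto simp: word_diagram_def)
  obtain y d where b: "built chain_presentation y d D" using diagram_built[OF D(1)] by blast
  then have "y = top_word" using built_top_label[OF b] D(2) by simp
  then show thesis using that b built_bot_label[OF b] D(3) by simp
qed

lemma hol_iff:
  assumes "built chain_presentation top_word d D" "derivation chain_presentation top_word d top_word"
  shows "hol D g \<longleftrightarrow> act d (map ident top_word) = map (\<lambda>l. post g (ident l)) top_word"
proof -
  have "word_diagram chain_presentation top_word top_word D"
    unfolding word_diagram_def using assms built_diagram built_top_label built_bot_label deriv_functional by blast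
  then show ?thesis unfolding hol_def holonomy_iff[OF assms(1)] using ident_colourings by auto
qed

lemma hol_exists:
  assumes "word_diagram chain_presentation top_word top_word D"
  shows "\<exists>g\<in>generated. hol D g"
proof -
  from assms obtain d where d: "built chain_presentation top_word d D"
    "derivation chain_presentation top_word d top_word" by (rule word_diagram_built)
  then show ?thesis using loop_generated hol_iff by blast
qed

lemma hol_realised: "g \<in> generated \<Longrightarrow> \<exists>D. hol D g"
  using generated_loop derivation_built word_top hol_iff by metis

lemma post_ident_cong: "(\<forall>l\<in>set top_word. post g (ident l) = post g' (ident l)) \<longleftrightarrow> (\<forall>t\<in>X. g t = g' t)"
proof
  assume *: "\<forall>l\<in>set top_word. post g (ident l) = post g' (ident l)"
  show "\<forall>t\<in>X. g t = g' t"
  proof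
    fix t assume t: "t \<in> X"
    then have "post g (ident (loc t)) t = post g' (ident (loc t)) t" using * loc_less by auto
    then show "g t = g' t" using t by (simp add: ident_def region_def post_apply)
  qed
next
  assume "\<forall>t\<in>X. g t = g' t"
  then show "\<forall>l\<in>set top_word. post g (ident l) = post g' (ident l)"
    by (auto intro!: post_cong simp: region_def)
qed

text \<open>Here faithfulness is turned into a statement about diagrams.\<close>

lemma hol_equiv:
  assumes "hol D g" "hol D' g'"
  shows "diagram_equiv chain_presentation D D' \<longleftrightarrow> (\<forall>t\<in>X. g t = g' t)"
proof
  assume "diagram_equiv chain_presentation D D'"
  then have "hol D' g" using assms(1) equiv_holonomy unfolding hol_def by metis
  with assms(2) obtain d where d: "built chain_presentation top_word d D'"
    "derivation chain_presentation top_word d top_word"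
    using word_diagram_built unfolding hol_def by metis
  have "map (\<lambda>l. post g (ident l)) top_word = map (\<lambda>l. post g' (ident l)) top_word"
    using \<open>hol D' g\<close> assms(2) hol_iff[OF d] by metis
  then show "\<forall>t\<in>X. g t = g' t" unfolding post_ident_cong[symmetric] by simp
next
  assume eq: "\<forall>t\<in>X. g t = g' t"
  obtain d where d: "built chain_presentation top_word d D" "derivation chain_presentation top_word d top_word"
    using assms(1) word_diagram_built unfolding hol_def by metis
  obtain d' where d': "built chain_presentation top_word d' D'" "derivation chain_presentation top_word d' top_word"
    using assms(2) word_diagram_built unfolding hol_def by metis
  have "map (\<lambda>l. post g (ident l)) top_word = map (\<lambda>l. post g' (ident l)) top_word"
    using eq unfolding post_ident_cong[symmetric] by simp
  then have "act d (map ident top_word) = act d' (map ident top_word)"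
    using hol_iff[OF d] hol_iff[OF d'] assms by metis
  from loops_faithful[OF word_top _ d(2) d'(2) this]
  show "diagram_equiv chain_presentation D D'"
    using deriv_eq_diagram_equiv[OF _ word_top d(1) d'(1)] by simp
qed

lemma hol_transfer: "hol D g \<Longrightarrow> diagram_equiv chain_presentation D D' \<Longrightarrow> hol D' g"
  using equiv_holonomy unfolding hol_def by metis

lemma hol_comp:
  assumes "hol D1 g1" "hol D2 g2" "composable D1 D2"
  shows "hol (diag_comp D1 D2) (g1 \<circ> g2)"
proof -
  obtain d1 where d1: "built chain_presentation top_word d1 D1" "derivation chain_presentation top_word d1 top_word"
    using assms(1) word_diagram_built unfolding hol_def by metis
  obtain d2 where d2: "built chain_presentation top_word d2 D2" "derivation chain_presentation top_word d2 top_word"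
    using assms(2) word_diagram_built unfolding hol_def by metis
  have b: "built chain_presentation top_word (d1 @ d2) (diag_comp D1 D2)"
    by (rule built_comp[OF d1(1) d2(1) assms(3)])
  have d: "derivation chain_presentation top_word (d1 @ d2) top_word"
    unfolding deriv_append using d1(2) d2(2) by blast
  show ?thesis unfolding hol_iff[OF b d]
    by (rule loop_comp[OF d1(2) d2(2)]) (use hol_iff[OF d1] hol_iff[OF d2] assms in simp_all)
qed

lemma hol_composable:
  assumes "hol D1 g1" "hol D2 g2"
  obtains D2' where "hol D2' g2" "composable D1 D2'"
proof -
  obtain d1 where d1: "built chain_presentation top_word d1 D1" "derivation chain_presentation top_word d1 top_word"
    using assms(1) word_diagram_built unfolding hol_def by metis
  obtain d2 where d2: "built chain_presentation top_word d2 D2" "derivation chain_presentation top_word d2 top_word"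
    using assms(2) word_diagram_built unfolding hol_def by metis
  have "path_label D1 (bot_path D1) = path_label D2 (top_path D2)"
    using assms by (simp add: hol_def word_diagram_def)
  from composable_copy[OF built_wf[OF d1(1)] built_wf[OF d2(1)] this]
  obtain D2' where D2': "isotopic D2 D2'" "composable D1 D2'" .
  have "hol D2' g2" using hol_iff[OF built_isotopic[OF d2(1) D2'(1)] d2(2)] hol_iff[OF d2] assms(2) by simp
  then show thesis using that D2'(2) by blast
qed

end

section \<open>Fast sets of bumps of the unit interval\<close>

subsection \<open>Positive bumps\<close>

text \<open>The fixed points of \<open>f\<close> form a closed set, so there is a last one before \<open>t\<close> and a first one after \<open>t\<close>.\<close>

lemma orbital_of_moved_point:
  assumes cont: "continuous_on {0..1} f" and f0: "f 0 = 0" and f1: "f 1 = 1"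
    and t: "t \<in> {0..1}" "f t \<noteq> (t::real)"
  obtains lo hi where "orbital f {lo<..<hi}" "lo < t" "t < hi"
proof -
  have comp: "compact {s \<in> {x..y}. f s = s}" if "{x..y} \<subseteq> {0..1}" for x y
  proof -
    have "continuous_on {x..y} (\<lambda>s. f s - s)"
      using continuous_on_subset[OF cont that] by (intro continuous_intros)
    then have "closed {s \<in> {x..y}. f s - s = 0}"
      by (intro continuous_closed_preimage_constant) auto
    moreover have "bounded {s \<in> {x..y}. f s - s = 0}"
      by (rule bounded_subset[OF bounded_closed_interval[of x y]]) auto
    ultimately show ?thesis by (simp add: compact_eq_bounded_closed)
  qed
  have "{s \<in> {0..t}. f s = s} \<noteq> {}" using t f0 by auto
  from compact_attains_sup[OF comp this] t obtain lo where lo: "0 \<le> lo" "lo \<le> t" "f lo = lo"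
    "\<And>s. 0 \<le> s \<Longrightarrow> s \<le> t \<Longrightarrow> f s = s \<Longrightarrow> s \<le> lo" by auto
  have "{s \<in> {t..1}. f s = s} \<noteq> {}" using t f1 by auto
  from compact_attains_inf[OF comp this] t obtain hi where hi: "t \<le> hi" "hi \<le> 1" "f hi = hi"
    "\<And>s. t \<le> s \<Longrightarrow> s \<le> 1 \<Longrightarrow> f s = s \<Longrightarrow> hi \<le> s" by auto
  have lt: "lo < t" "t < hi" using lo(2,3) hi(1,3) t(2) by (auto simp: less_le)
  have free: "f s \<noteq> s" if "s \<in> {lo<..<hi}" for s
  proof
    assume "f s = s"
    then show False using that lo(1) lo(4)[of s] hi(2) hi(4)[of s] by (cases "s \<le> t") simp_all
  qed
  have "fixfree_interval f {lo<..<hi}"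
    unfolding fixfree_interval_def
  proof (intro conjI exI ballI)
    show "lo < hi" using lt by simp
    show "{lo<..<hi} \<subseteq> {0..1}" using lo(1) hi(2) by auto
  qed (use free in auto)
  moreover have "J = {lo<..<hi}" if J: "fixfree_interval f J" "{lo<..<hi} \<subseteq> J" for J
  proof -
    from J(1) obtain x y where xy: "J = {x<..<y}" "\<forall>z\<in>J. f z \<noteq> z" by (auto simp: fixfree_interval_def)
    have tJ: "x < t" "t < y" using J(2) lt xy(1) by auto
    have "z \<in> {lo<..<hi}" if z: "z \<in> J" for z
    proof -
      have "\<not> z \<le> lo" using z xy lo(3) lt tJ by (auto dest!: bspec[of _ _ lo])
      moreover have "\<not> hi \<le> z" using z xy hi(3) lt tJ by (auto dest!: bspec[of _ _ hi])
      ultimately show ?thesis by simp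
    qed
    then show ?thesis using J(2) by blast
  qed
  ultimately have "orbital f {lo<..<hi}" by (auto simp: orbital_def)
  then show thesis using that lt by blast
qed

lemma homeo_groupD:
  assumes "f \<in> carrier homeo_group"
  shows "bij_betw f {0..1} {0..1}" "continuous_on {0..1} f" "f \<in> extensional {0..1}" "f \<in> Bij {0..1}"
  using assms by (auto simp: homeo_group_def Bij_def homeomorphism_def)

text \<open>A moved point outside \<open>(a, b)\<close> would lie in a second orbital.\<close>

lemma positive_bump_props:
  assumes f: "positive_bump f" and orb: "orbital f {a<..<b}" and ab: "a < b"
  shows "0 \<le> a" "b \<le> 1" "\<And>t. t \<in> {0..1} \<Longrightarrow> t \<le> a \<or> b \<le> t \<Longrightarrow> f t = t"
    "\<And>t. a < t \<Longrightarrow> t < b \<Longrightarrow> t < f t"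
    "\<And>s t. s \<in> {0..1} \<Longrightarrow> t \<in> {0..1} \<Longrightarrow> f s < f t \<longleftrightarrow> s < t"
proof -
  have h: "f \<in> carrier homeo_group" and mono: "strict_mono_on {0..1} f" and uniq: "\<exists>!I. orbital f I"
    and pos: "\<forall>x\<in>{0..1}. x \<le> f x"
    using f by (auto simp: positive_bump_def bump_def)
  note h = homeo_groupD[OF h]
  show less: "f s < f t \<longleftrightarrow> s < t" if "s \<in> {0..1}" "t \<in> {0..1}" for s t
    using strict_mono_onD[OF mono that] strict_mono_onD[OF mono that(2,1)]
    by (cases s t rule: linorder_cases) auto
  have img: "f ` {0..1} = {0..1}" using h(1) by (simp add: bij_betw_def)
  have f0: "f 0 = 0"
  proof -
    have "0 \<in> f ` {0..1}" using img by simp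
    then obtain s where s: "s \<in> {0..1}" "f s = 0" by auto
    have "f 0 \<in> {0..1}" using img by auto
    then show ?thesis using less[of 0 s] s by (cases "s = 0") auto
  qed
  have f1: "f 1 = 1"
  proof -
    have "1 \<in> f ` {0..1}" using img by simp
    then obtain s where s: "s \<in> {0..1}" "f s = 1" by auto
    have "f 1 \<in> {0..1}" using img by auto
    then show ?thesis using less[of s 1] s by (cases "s = 1") auto
  qed
  have free: "{a<..<b} \<subseteq> {0..1}" "\<forall>t\<in>{a<..<b}. f t \<noteq> t"
    using orb by (auto simp: orbital_def fixfree_interval_def)
  then show "0 \<le> a" "b \<le> 1" using ab by (auto simp: greaterThanLessThan_subseteq_atLeastAtMost_iff)
  show "t < f t" if "a < t" "t < b" for t
  proof -
    have "t \<in> {a<..<b}" using that by simp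
    then have "f t \<noteq> t" "t \<le> f t" using free pos by blast+
    then show ?thesis by simp
  qed
  show "f t = t" if t: "t \<in> {0..1}" "t \<le> a \<or> b \<le> t" for t
  proof (rule ccontr)
    assume "f t \<noteq> t"
    from orbital_of_moved_point[OF h(2) f0 f1 t(1) this] obtain lo hi where
      lh: "orbital f {lo<..<hi}" "lo < t" "t < hi" .
    then have "{lo<..<hi} = {a<..<b}" using uniq orb by auto
    then have "t \<in> {a<..<b}" using lh(2,3) by auto
    then show False using t(2) by auto
  qed
qed

lemma disjoint_open_intervals:
  fixes u v x y :: real
  assumes "{u<..<v} \<inter> {x<..<y} = {}" "u < v" "x < y"
  shows "v \<le> x \<or> y \<le> u"
proof (rule ccontr)
  assume "\<not> (v \<le> x \<or> y \<le> u)"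
  then have "max u x < min v y" using assms(2,3) by auto
  then obtain z where "max u x < z" "z < min v y" using dense by blast
  then have "z \<in> {u<..<v} \<inter> {x<..<y}" by auto
  then show False using assms(1) by blast
qed

subsection \<open>Reading the feet from left to right\<close>

text \<open>The feet of \<open>f\<close> are \<open>(a f, c f)\<close> and \<open>(f (c f), b f)\<close>. Disjointness of feet is expressed by the order of their
  ends.\<close>

locale fast_feet =
  fixes F :: "(real \<Rightarrow> real) set" and a b c :: "(real \<Rightarrow> real) \<Rightarrow> real"
  assumes finite_F: "finite F"
    and bij: "f \<in> F \<Longrightarrow> bij_betw f {0..1} {0..1}"
    and mono: "f \<in> F \<Longrightarrow> s \<in> {0..1} \<Longrightarrow> t \<in> {0..1} \<Longrightarrow> f s < f t \<longleftrightarrow> s < t"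
    and outside: "f \<in> F \<Longrightarrow> t \<in> {0..1} \<Longrightarrow> t \<le> a f \<or> b f \<le> t \<Longrightarrow> f t = t"
    and inside: "f \<in> F \<Longrightarrow> a f < t \<Longrightarrow> t < b f \<Longrightarrow> t < f t"
    and order: "f \<in> F \<Longrightarrow> 0 \<le> a f" "f \<in> F \<Longrightarrow> a f < c f" "f \<in> F \<Longrightarrow> c f < b f" "f \<in> F \<Longrightarrow> b f \<le> 1"
    and left_left: "f \<in> F \<Longrightarrow> g \<in> F \<Longrightarrow> f \<noteq> g \<Longrightarrow> c g \<le> a f \<or> c f \<le> a g"
    and left_right: "f \<in> F \<Longrightarrow> g \<in> F \<Longrightarrow> f \<noteq> g \<Longrightarrow> b g \<le> a f \<or> c f \<le> g (c g)"
    and right_right: "f \<in> F \<Longrightarrow> g \<in> F \<Longrightarrow> f \<noteq> g \<Longrightarrow> b g \<le> f (c f) \<or> b f \<le> g (c g)"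
begin

definition d :: "(real \<Rightarrow> real) \<Rightarrow> real" where "d f = f (c f)"

lemma feet_order:
  assumes "f \<in> F"
  shows "0 \<le> a f" "a f < c f" "c f < d f" "d f < b f" "b f \<le> 1"
proof -
  note o = order[OF assms]
  have "f (c f) < f (b f)" using mono[OF assms, of "c f" "b f"] o by auto
  moreover have "f (b f) = b f" using outside[OF assms, of "b f"] o by auto
  ultimately show "d f < b f" by (simp add: d_def)
  show "c f < d f" unfolding d_def using inside[OF assms, of "c f"] o by simp
qed (use order[OF assms] in auto)

text \<open>The letter of a point counts the ends of feet that have been passed on the way from \<open>0\<close> to the point. The choice
  between \<open><\<close> and \<open>\<le>\<close> makes left feet open and right feet half-open, \<open>[d f, b f)\<close>, as is needed for \<open>f\<close> to map
  the points from \<open>c f\<close> up to \<open>b f\<close> onto the right foot.\<close>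

definition ends :: "(real \<Rightarrow> real) \<Rightarrow> real \<Rightarrow> nat" where
  "ends f t = of_bool (a f < t) + of_bool (c f \<le> t) + of_bool (d f \<le> t) + of_bool (b f \<le> t)"

definition loc :: "real \<Rightarrow> nat" where "loc t = (\<Sum>f\<in>F. ends f t)"

lemma ends_mono: "s \<le> t \<Longrightarrow> ends f s \<le> ends f t"
  by (auto simp: ends_def intro!: add_mono)

lemma loc_strict:
  assumes "f \<in> F" "s \<le> t" "ends f s < ends f t" shows "loc s < loc t"
  unfolding loc_def by (rule sum_strict_mono_ex1[OF finite_F]) (use assms ends_mono in auto)

lemma ends_values:
  assumes "f \<in> F"
  shows "a f < t \<Longrightarrow> t < c f \<Longrightarrow> ends f t = 1" "d f \<le> t \<Longrightarrow> t < b f \<Longrightarrow> ends f t = 3"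
    "t \<le> a f \<Longrightarrow> ends f t = 0" "c f \<le> t \<Longrightarrow> t < d f \<Longrightarrow> ends f t = 2" "b f \<le> t \<Longrightarrow> ends f t = 4"
  using feet_order[OF assms] by (simp_all add: ends_def)

definition mid_left :: "(real \<Rightarrow> real) \<Rightarrow> real" where "mid_left f = (a f + c f) / 2"
definition mid_right :: "(real \<Rightarrow> real) \<Rightarrow> real" where "mid_right f = (d f + b f) / 2"

lemma mids:
  assumes "f \<in> F"
  shows "a f < mid_left f" "mid_left f < c f" "d f < mid_right f" "mid_right f < b f"
  using feet_order[OF assms] by (auto simp: mid_left_def mid_right_def)

definition p :: "(real \<Rightarrow> real) \<Rightarrow> nat" where "p f = loc (mid_left f)"
definition q :: "(real \<Rightarrow> real) \<Rightarrow> nat" where "q f = loc (mid_right f)"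

text \<open>Another bump \<open>g\<close> has no end inside a foot of \<open>f\<close>, and each foot of \<open>g\<close> that has been passed contributes
  two ends.\<close>

lemma ends_other:
  assumes f: "f \<in> F" and g: "g \<in> F" and ne: "g \<noteq> f"
  shows "\<exists>n. even n \<and> (\<forall>t. a f < t \<and> t < c f \<longrightarrow> ends g t = n)"
    "\<exists>n. even n \<and> (\<forall>t. d f \<le> t \<and> t < b f \<longrightarrow> ends g t = n)"
proof -
  note o = feet_order[OF f] feet_order[OF g]
  have ll: "c g \<le> a f \<or> c f \<le> a g" using left_left[OF f g] ne by auto
  have lr: "b g \<le> a f \<or> c f \<le> d g" using left_right[OF f g] ne by (auto simp: d_def)
  have rl: "b f \<le> a g \<or> c g \<le> d f" using left_right[OF g f ne] by (auto simp: d_def)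
  have rr: "b g \<le> d f \<or> b f \<le> d g" using right_right[OF f g] ne by (auto simp: d_def)
  from ll lr consider "c g \<le> a f" "b g \<le> a f" | "c g \<le> a f" "c f \<le> d g" | "c f \<le> a g" "c f \<le> d g"
    using o by linarith
  then show "\<exists>n. even n \<and> (\<forall>t. a f < t \<and> t < c f \<longrightarrow> ends g t = n)"
  proof cases
    case 1 then show ?thesis using o ends_values(5)[OF g] by (intro exI[of _ 4]) auto
  next
    case 2 then show ?thesis using o ends_values(4)[OF g] by (intro exI[of _ 2]) auto
  next
    case 3 then show ?thesis using o ends_values(3)[OF g] by (intro exI[of _ 0]) auto
  qed
  from rl rr consider "c g \<le> d f" "b g \<le> d f" | "c g \<le> d f" "b f \<le> d g" | "b f \<le> a g"
    using o by linarith
  then show "\<exists>n. even n \<and> (\<forall>t. d f \<le> t \<and> t < b f \<longrightarrow> ends g t = n)"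
  proof cases
    case 1 then show ?thesis using o ends_values(5)[OF g] by (intro exI[of _ 4]) auto
  next
    case 2 then show ?thesis using o ends_values(4)[OF g] by (intro exI[of _ 2]) auto
  next
    case 3 then show ?thesis using o ends_values(3)[OF g] by (intro exI[of _ 0]) auto
  qed
qed

lemma loc_left: assumes "f \<in> F" "a f < t" "t < c f" shows "loc t = p f"
  unfolding p_def loc_def
proof (intro sum.cong refl)
  fix g assume g: "g \<in> F"
  show "ends g t = ends g (mid_left f)"
  proof (cases "g = f")
    case True
    then show ?thesis using ends_values(1)[OF assms(1)] assms mids[OF assms(1)] by simp
  next
    case False
    then show ?thesis using ends_other(1)[OF assms(1) g] assms mids[OF assms(1)] by metis
  qed
qed

lemma loc_right: assumes "f \<in> F" "d f \<le> t" "t < b f" shows "loc t = q f"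
  unfolding q_def loc_def
proof (intro sum.cong refl)
  fix g assume g: "g \<in> F"
  show "ends g t = ends g (mid_right f)"
  proof (cases "g = f")
    case True
    then show ?thesis using ends_values(2)[OF assms(1)] assms mids[OF assms(1)] by simp
  next
    case False
    then show ?thesis using ends_other(2)[OF assms(1) g] assms mids[OF assms(1)]
      by (metis less_imp_le)
  qed
qed

text \<open>Inside a foot of \<open>f\<close> the bump \<open>f\<close> itself contributes one or three ends.\<close>

lemma odd_feet: assumes f: "f \<in> F" shows "odd (p f)" "odd (q f)"
proof -
  have split: "loc t = ends f t + (\<Sum>g\<in>F - {f}. ends g t)" for t
    unfolding loc_def by (rule sum.remove[OF finite_F f])
  have "even (\<Sum>g\<in>F - {f}. ends g (mid_left f))"
    using ends_other(1)[OF f] mids[OF f] by (intro dvd_sum) (metis DiffE singletonI)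
  then show "odd (p f)" unfolding p_def split[of "mid_left f"]
    using ends_values(1)[OF f] mids[OF f] by simp
  have "even (\<Sum>g\<in>F - {f}. ends g (mid_right f))"
    using ends_other(2)[OF f] mids[OF f] by (intro dvd_sum) (metis DiffE singletonI less_imp_le)
  then show "odd (q f)" unfolding q_def split[of "mid_right f"]
    using ends_values(2)[OF f] mids[OF f] by simp
qed

lemma loc_iff:
  assumes f: "f \<in> F"
  shows "loc t < p f \<longleftrightarrow> t \<le> a f" "loc t = p f \<longleftrightarrow> a f < t \<and> t < c f" "loc t < q f \<longleftrightarrow> t < d f"
    "loc t = q f \<longleftrightarrow> d f \<le> t \<and> t < b f"
proof -
  note o = feet_order[OF f] and m = mids[OF f] and e = ends_values[OF f]
  have em: "ends f (mid_left f) = 1" "ends f (mid_right f) = 3" using e m by auto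
  have 1: "loc t < p f" if "t \<le> a f"
    unfolding p_def by (rule loc_strict[OF f]) (use that m e(3) em in auto)
  have 2: "p f < loc t" if "c f \<le> t"
    unfolding p_def by (rule loc_strict[OF f])
      (use that m o e(2,4,5)[of t] em in \<open>(cases "t < d f"; cases "t < b f"; auto)+\<close>)
  have 3: "loc t < q f" if "t < d f"
    unfolding q_def by (rule loc_strict[OF f])
      (use that m o e(1,3,4)[of t] em in \<open>(cases "t \<le> a f"; cases "t < c f"; auto)+\<close>)
  have 4: "q f < loc t" if "b f \<le> t"
    unfolding q_def by (rule loc_strict[OF f]) (use that m e(5) em in auto)
  note 5 = loc_left[OF f, of t] and 6 = loc_right[OF f, of t]
  show "loc t < p f \<longleftrightarrow> t \<le> a f" "loc t = p f \<longleftrightarrow> a f < t \<and> t < c f"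
    using 1 2 5 by (cases "t \<le> a f"; cases "t < c f"; force)+
  show "loc t < q f \<longleftrightarrow> t < d f" "loc t = q f \<longleftrightarrow> d f \<le> t \<and> t < b f"
    using 3 4 6 by (cases "t < d f"; cases "t < b f"; force)+
qed

lemma bij_inv:
  assumes "f \<in> F" "t \<in> {0..1}"
  shows "f t \<in> {0..1}" "inv_into {0..1} f t \<in> {0..1}" "inv_into {0..1} f (f t) = t"
    "f (inv_into {0..1} f t) = t"
  using bij[OF assms(1)] assms(2)
  by (auto simp: bij_betw_def inv_into_into inv_into_f_f f_inv_into_f simp del: atLeastAtMost_iff)

sublocale fast_chain "4 * card F + 1" F p q "{0..1}" loc "\<lambda>f. f" "\<lambda>f. inv_into {0..1} f"
proof
  show "finite F" by (rule finite_F)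
  show "0 < 4 * card F + 1" by simp
  have "ends f t \<le> 4" for f t by (auto simp: ends_def of_bool_def)
  then show bound: "loc t < 4 * card F + 1" for t
    using sum_bounded_above[of F "\<lambda>f. ends f t" 4] by (simp add: loc_def)
  show "q f < 4 * card F + 1" if "f \<in> F" for f unfolding q_def by (rule bound)
  show "inj_on p F"
  proof (rule inj_onI, rule ccontr)
    fix f g assume *: "f \<in> F" "g \<in> F" "p f = p g" "f \<noteq> g"
    then have "loc (mid_left g) = p f" by (simp add: p_def)
    then show False using loc_iff(2)[OF *(1)] left_left[OF *(1,2,4)] mids[OF *(2)] by auto
  qed
  show "inj_on q F"
  proof (rule inj_onI, rule ccontr)
    fix f g assume *: "f \<in> F" "g \<in> F" "q f = q g" "f \<noteq> g"
    then have "loc (mid_right g) = q f" by (simp add: q_def)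
    then show False using loc_iff(4)[OF *(1)] right_right[OF *(1,2,4)] mids[OF *(2)] by (auto simp: d_def)
  qed
  show "p f \<noteq> q g" if fg: "f \<in> F" "g \<in> F" for f g
  proof
    assume "p f = q g"
    then have *: "loc (mid_right g) = p f" by (simp add: q_def)
    show False
    proof (cases "f = g")
      case True
      then show False using * loc_iff(2)[OF fg(1)] mids[OF fg(2)] feet_order[OF fg(2)] by auto
    next
      case False
      then show False using * loc_iff(2)[OF fg(1)] left_right[OF fg] mids[OF fg(2)] by (auto simp: d_def)
    qed
  qed
  show "p f + 1 \<noteq> q g" if "f \<in> F" "g \<in> F" for f g
    using odd_feet that by (metis even_plus_one_iff)
next
  fix f assume f: "f \<in> F"
  note o = feet_order[OF f] and l = loc_iff[OF f]
  have c: "p f < loc (c f)" "loc (c f) < q f" using l(1-3)[of "c f"] o by auto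
  then show "p f + 2 \<le> q f" by simp
  show "\<exists>t\<in>{0..1}. p f < loc t \<and> loc t < q f" using c o by (intro bexI[of _ "c f"]) auto
  show "\<exists>t\<in>{0..1}. loc t = p f" using mids[OF f] o by (intro bexI[of _ "mid_left f"]) (auto simp: p_def)
  fix t :: real assume t: "t \<in> {0..1}"
  show "f t \<in> {0..1}" "inv_into {0..1} f t \<in> {0..1}" "inv_into {0..1} f (f t) = t"
    "f (inv_into {0..1} f t) = t" using bij_inv[OF f t] by simp_all
  have b1: "b f \<in> {0..1}" "c f \<in> {0..1}" "f (b f) = b f" using o outside[OF f, of "b f"] by auto
  show "f t = t" if "loc t < p f \<or> q f < loc t"
    using that l(1,3,4)[of t] outside[OF f t] by force
  show "p f \<le> loc (f t) \<and> loc (f t) < q f" if "loc t = p f"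
  proof -
    have t': "a f < t" "t < c f" using that l(2) by auto
    then have "t < f t" "f t < d f" unfolding d_def using inside[OF f, of t] mono[OF f t b1(2)] o by auto
    then show ?thesis using l(1,3)[of "f t"] t' by (simp flip: not_less)
  qed
  show "loc (f t) = q f" if "p f < loc t" "loc t \<le> q f"
  proof -
    have "\<not> t \<le> a f" "\<not> (a f < t \<and> t < c f)" using that(1) l(1,2)[of t] by auto
    moreover have "loc t < q f \<or> loc t = q f" using that(2) by auto
    ultimately have t': "c f \<le> t" "t < b f" using l(3,4)[of t] o by auto
    then have "d f \<le> f t" "f t < b f"
      unfolding d_def using mono[OF f t b1(2)] mono[OF f t b1(1)] b1(3) by (auto simp flip: not_less)
    then show ?thesis using l(4) by simp
  qed
qed

end

subsection \<open>The group of homeomorphisms\<close>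

text \<open>Gives the group structure of \<^const>\<open>homeo_group\<close>, in particular its inverses.\<close>

lemma homeo_subgroup:
  "subgroup {f \<in> Bij {0..1::real}. \<exists>g. homeomorphism {0..1} {0..1} f g} (BijGroup {0..1})"
  (is "subgroup ?H ?G")
proof -
  interpret group ?G by (rule group_BijGroup)
  have cong: "homeomorphism {0..1::real} {0..1} h' k" if "homeomorphism {0..1} {0..1} h k" "\<And>x. x \<in> {0..1} \<Longrightarrow> h' x = h x"
    for h h' k using homeomorphism_cong[OF that(1)] that(2) by auto
  show ?thesis
  proof (rule subgroupI)
    show "?H \<subseteq> carrier ?G" by (auto simp: BijGroup_def)
    have "(\<lambda>x\<in>{0..1::real}. x) \<in> ?H"
      using id_Bij cong[OF homeomorphism_ident, of "\<lambda>x\<in>{0..1}. x"] by auto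
    then show "?H \<noteq> {}" by blast
  next
    fix f assume f: "f \<in> ?H"
    then obtain g where g: "homeomorphism {0..1} {0..1} f g" by auto
    have inv: "inv\<^bsub>?G\<^esub> f = (\<lambda>x\<in>{0..1}. inv_into {0..1} f x)" using f by (intro inv_BijGroup) auto
    have "(\<lambda>x\<in>{0..1}. inv_into {0..1} f x) x = g x" if "x \<in> {0..1}" for x
    proof -
      have "g x \<in> {0..1}" "f (g x) = x" using g that by (auto simp: homeomorphism_def)
      moreover have "inj_on f {0..1}" using f by (auto simp: Bij_def bij_betw_def)
      ultimately show ?thesis using that by (metis inv_into_f_f restrict_apply')
    qed
    then have "homeomorphism {0..1} {0..1} (inv\<^bsub>?G\<^esub> f) f"
      unfolding inv using cong[OF homeomorphism_symD[OF g]] by simp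
    then show "inv\<^bsub>?G\<^esub> f \<in> ?H" unfolding inv using f restrict_inv_into_Bij by blast
  next
    fix f g assume fg: "f \<in> ?H" "g \<in> ?H"
    then obtain f' g' where h: "homeomorphism {0..1} {0..1} f f'" "homeomorphism {0..1} {0..1} g g'" by auto
    have m: "f \<otimes>\<^bsub>?G\<^esub> g = compose {0..1} f g" using fg by (simp add: BijGroup_def)
    have "homeomorphism {0..1} {0..1} (compose {0..1} f g) (g' \<circ> f')"
      by (rule cong[OF homeomorphism_compose[OF h(2,1)]]) (simp add: compose_eq)
    then show "f \<otimes>\<^bsub>?G\<^esub> g \<in> ?H" unfolding m using fg compose_Bij by blast
  qed
qed

lemma homeo_group_simps:
  shows "group homeo_group" "\<one>\<^bsub>homeo_group\<^esub> = (\<lambda>x\<in>{0..1}. x)"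
    "f \<in> carrier homeo_group \<Longrightarrow> g \<in> carrier homeo_group \<Longrightarrow> f \<otimes>\<^bsub>homeo_group\<^esub> g = compose {0..1} f g"
    "f \<in> carrier homeo_group \<Longrightarrow> inv\<^bsub>homeo_group\<^esub> f = (\<lambda>x\<in>{0..1}. inv_into {0..1} f x)"
proof -
  show "group homeo_group" unfolding homeo_group_def
    by (rule subgroup.subgroup_is_group[OF homeo_subgroup group_BijGroup])
  show "\<one>\<^bsub>homeo_group\<^esub> = (\<lambda>x\<in>{0..1}. x)" by (simp add: homeo_group_def BijGroup_def)
  show "f \<otimes>\<^bsub>homeo_group\<^esub> g = compose {0..1} f g" if "f \<in> carrier homeo_group" "g \<in> carrier homeo_group"
    using that by (simp add: homeo_group_def BijGroup_def)
  show "inv\<^bsub>homeo_group\<^esub> f = (\<lambda>x\<in>{0..1}. inv_into {0..1} f x)" if "f \<in> carrier homeo_group"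
    using that group.m_inv_consistent[OF group_BijGroup homeo_subgroup, of f] inv_BijGroup[of f "{0..1}"]
    by (simp add: homeo_group_def)
qed

subsection \<open>The isomorphism\<close>

context fast_feet
begin

lemma generated_homeo:
  assumes F: "F \<subseteq> carrier homeo_group"
  shows "carrier (fast_group F) = (\<lambda>g. restrict g {0..1}) ` generated"
proof -
  interpret group homeo_group by (rule homeo_group_simps(1))
  have car: "carrier (fast_group F) = generate homeo_group F"
    using F by (simp add: fast_group_def carrier_subgroup_generated Int_absorb1)
  have res: "restrict f {0..1} = f" if "f \<in> F" for f
    using homeo_groupD(3)[of f] F that by (auto simp: extensional_restrict)
  have comp: "compose {0..1} (restrict g {0..1}) (restrict h {0..1}) = restrict (g \<circ> h) {0..1}"
    if "h \<in> generated" for g h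
    using generated_in[OF that] by (auto simp: compose_def restrict_def fun_eq_iff)
  show ?thesis unfolding car
  proof (intro equalityI subsetI)
    fix h assume "h \<in> generate homeo_group F"
    then show "h \<in> (\<lambda>g. restrict g {0..1}) ` generated"
    proof (induction rule: generate.induct)
      case one
      then show ?case using gen_id by (intro image_eqI[of _ _ id]) (auto simp: homeo_group_simps)
    next
      case (incl h)
      then show ?case using generated_f(1)[OF incl] res[OF incl] by (intro image_eqI[of _ _ h]) auto
    next
      case (inv h)
      then show ?case using generated_f(2)[OF inv] F
        by (intro image_eqI[of _ _ "inv_into {0..1} h"]) (auto simp: homeo_group_simps)
    next
      case (eng h1 h2)
      obtain g1 where g1: "h1 = restrict g1 {0..1}" "g1 \<in> generated" using eng(3) by (rule imageE)
      obtain g2 where g2: "h2 = restrict g2 {0..1}" "g2 \<in> generated" using eng(4) by (rule imageE)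
      note g = g1 g2
      have "h1 \<in> carrier homeo_group" "h2 \<in> carrier homeo_group"
        using eng(1,2) generate_in_carrier[OF F] by auto
      then have "h1 \<otimes>\<^bsub>homeo_group\<^esub> h2 = restrict (g1 \<circ> g2) {0..1}"
        using comp[OF g(4)] g by (simp add: homeo_group_simps)
      then show ?case using generated_comp[OF g(2,4)] by blast
    qed
  next
    fix h assume "h \<in> (\<lambda>g. restrict g {0..1}) ` generated"
    then obtain g where g: "g \<in> generated" "h = restrict g {0..1}" by auto
    from g(1) have "restrict g {0..1} \<in> generate homeo_group F"
    proof (induction rule: generated.induct)
      case gen_id
      have "\<one>\<^bsub>homeo_group\<^esub> = restrict id {0..1::real}" by (auto simp: homeo_group_simps)
      then show ?case using generate.one[of homeo_group F] by (simp only:)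
    next
      case (gen_f f g)
      have "f \<otimes>\<^bsub>homeo_group\<^esub> restrict g {0..1} \<in> generate homeo_group F"
        by (rule generate.eng[OF generate.incl[OF gen_f(1)] gen_f(3)])
      moreover have "f \<otimes>\<^bsub>homeo_group\<^esub> restrict g {0..1} = restrict (f \<circ> g) {0..1}"
        using comp[OF gen_f(2), of f] subsetD[OF F gen_f(1)]
        unfolding res[OF gen_f(1)] by (simp only: homeo_group_simps(3)[OF _ generate_in_carrier[OF F gen_f(3)]])
      ultimately show ?case by (simp only:)
    next
      case (gen_f' f g)
      have fc: "f \<in> carrier homeo_group" using F gen_f'(1) by auto
      have "inv\<^bsub>homeo_group\<^esub> f \<otimes>\<^bsub>homeo_group\<^esub> restrict g {0..1} \<in> generate homeo_group F"
        by (rule generate.eng[OF generate.inv[OF gen_f'(1)] gen_f'(3)])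
      moreover have "inv\<^bsub>homeo_group\<^esub> f \<otimes>\<^bsub>homeo_group\<^esub> restrict g {0..1} = restrict (inv_into {0..1} f \<circ> g) {0..1}"
        using comp[OF gen_f'(2), of "inv_into {0..1} f"]
          homeo_group_simps(3)[OF inv_closed[OF fc] generate_in_carrier[OF F gen_f'(3)]]
        unfolding homeo_group_simps(4)[OF fc] by (simp only:)
      ultimately show ?case by (simp only:)
    qed
    then show "h \<in> generate homeo_group F" using g(2) by simp
  qed
qed

lemma hol_cong: "hol D g \<Longrightarrow> (\<And>t. t \<in> {0..1} \<Longrightarrow> g t = g' t) \<Longrightarrow> hol D g'"
proof -
  assume h: "hol D g" and eq: "\<And>t. t \<in> {0..1} \<Longrightarrow> g t = g' t"
  then have "map (\<lambda>l. post g (ident l)) top_word = map (\<lambda>l. post g' (ident l)) top_word"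
    using post_ident_cong[of g g'] by simp
  then show "hol D g'" using h unfolding hol_def by metis
qed

text \<open>The isomorphism sends \<open>h\<close> to the set of all diagrams with holonomy \<open>h\<close>, which is one equivalence class.\<close>

theorem fast_group_iso:
  assumes F: "F \<subseteq> carrier homeo_group"
  shows "fast_group F \<cong> diagram_group chain_presentation top_word"
proof -
  let ?P = chain_presentation and ?w = top_word and ?G = "fast_group F"
  interpret H: group homeo_group by (rule homeo_group_simps(1))
  define \<Phi> where "\<Phi> = (\<lambda>h. {D. hol D h})"
  have G: "carrier ?G = (\<lambda>g. restrict g {0..1}) ` generated" by (rule generated_homeo[OF F])
  have Gh: "carrier ?G \<subseteq> carrier homeo_group"
    unfolding fast_group_def by (rule H.carrier_subgroup_generated_subset)
  have mult: "h \<otimes>\<^bsub>?G\<^esub> k = compose {0..1} h k" if "h \<in> carrier ?G" "k \<in> carrier ?G" for h k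
    using that Gh homeo_group_simps(3) by (auto simp: fast_group_def)
  have ext: "h \<in> extensional {0..1}" "h ` {0..1} \<subseteq> {0..1}" if "h \<in> carrier ?G" for h
    using that homeo_groupD(1,3)[of h] Gh by (auto simp: bij_betw_def)
  have real: "\<exists>D. hol D h" if h: "h \<in> carrier ?G" for h
  proof -
    obtain g where g: "g \<in> generated" "h = restrict g {0..1}" using h G by auto
    obtain D where "hol D g" using hol_realised[OF g(1)] by blast
    then show ?thesis using hol_cong[of D g h] g(2) by auto
  qed
  have class_eq: "{(D, D'). diagram_equiv ?P D D'} `` {D} = \<Phi> h" if "hol D h" for D h
    using hol_equiv[OF that] hol_transfer[OF that] by (auto simp: \<Phi>_def)
  have car: "carrier (diagram_group ?P ?w) = \<Phi> ` carrier ?G"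
  proof (intro equalityI subsetI)
    fix X assume "X \<in> carrier (diagram_group ?P ?w)"
    then obtain D where D: "word_diagram ?P ?w ?w D" "X = {(D, D'). diagram_equiv ?P D D'} `` {D}"
      by (auto simp: diagram_group_def quotient_def)
    obtain g where g: "g \<in> generated" "hol D g" using hol_exists[OF D(1)] by blast
    have "hol D (restrict g {0..1})" by (rule hol_cong[OF g(2)]) simp
    from class_eq[OF this] D(2) have "X = \<Phi> (restrict g {0..1})" by simp
    then show "X \<in> \<Phi> ` carrier ?G" using g(1) G by blast
  next
    fix X assume "X \<in> \<Phi> ` carrier ?G"
    then obtain h where h: "h \<in> carrier ?G" "X = \<Phi> h" by auto
    obtain D where D: "hol D h" using real[OF h(1)] by blast
    have "X = {(D, D'). diagram_equiv ?P D D'} `` {D}" using class_eq[OF D] h(2) by simp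
    moreover have "word_diagram ?P ?w ?w D" using D unfolding hol_def by (elim conjE)
    ultimately show "X \<in> carrier (diagram_group ?P ?w)" by (auto simp: diagram_group_def quotient_def)
  qed
  have "inj_on \<Phi> (carrier ?G)"
  proof (rule inj_onI)
    fix h k assume h: "h \<in> carrier ?G" and k: "k \<in> carrier ?G" and eq: "\<Phi> h = \<Phi> k"
    obtain D where D: "hol D h" using real[OF h] by blast
    then have "hol D k" using eq by (auto simp: \<Phi>_def)
    then have "\<forall>t\<in>{0..1}. h t = k t" using hol_equiv[OF D] diagram_equiv_refl by blast
    then show "h = k" using ext(1)[OF h] ext(1)[OF k] by (auto intro: extensionalityI)
  qed
  moreover have "\<Phi> (h \<otimes>\<^bsub>?G\<^esub> k) = \<Phi> h \<otimes>\<^bsub>diagram_group ?P ?w\<^esub> \<Phi> k"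
    if hk: "h \<in> carrier ?G" "k \<in> carrier ?G" for h k
  proof -
    have c: "compose {0..1} h k t = (h \<circ> k) t" if "t \<in> {0..1}" for t using that by (simp add: compose_eq)
    obtain D1 where D1: "hol D1 h" using real[OF hk(1)] by blast
    obtain D2 where "hol D2 k" using real[OF hk(2)] by blast
    from hol_composable[OF D1 this] obtain D2 where D2: "hol D2 k" "composable D1 D2" .
    have "hol D (h \<circ> k) \<longleftrightarrow> (\<exists>D1 D2. hol D1 h \<and> hol D2 k \<and> composable D1 D2 \<and>
        diagram_equiv ?P (diag_comp D1 D2) D)" for D
    proof
      assume D: "hol D (h \<circ> k)"
      have "diagram_equiv ?P (diag_comp D1 D2) D"
        using hol_equiv[OF hol_comp[OF D1 D2] D] by simp
      then show "\<exists>D1 D2. hol D1 h \<and> hol D2 k \<and> composable D1 D2 \<and> diagram_equiv ?P (diag_comp D1 D2) D"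
        using D1 D2 by blast
    next
      assume "\<exists>D1 D2. hol D1 h \<and> hol D2 k \<and> composable D1 D2 \<and> diagram_equiv ?P (diag_comp D1 D2) D"
      then show "hol D (h \<circ> k)" using hol_comp hol_transfer by blast
    qed
    moreover have "hol D (h \<otimes>\<^bsub>?G\<^esub> k) \<longleftrightarrow> hol D (h \<circ> k)" for D
      unfolding mult[OF hk] using hol_cong[of D _ _] c by metis
    ultimately show ?thesis by (auto simp: \<Phi>_def diagram_group_def)
  qed
  ultimately have "\<Phi> \<in> iso ?G (diagram_group ?P ?w)"
    using car by (auto simp: iso_def hom_def bij_betw_def)
  then show ?thesis by (auto simp: is_iso_def)
qed

end

text \<open>Feet of a fast set are open intervals, so their disjointness can be read off from the order of their
  ends; the isomorphism then applies.\<close>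

theorem theorem1p2:
  fixes F :: "(real \<Rightarrow> real) set"
  assumes "fast F"
  shows "\<exists>(P :: nat presentation) w. finite_semigroup_presentation P \<and> word P w \<and>
           fast_group F \<cong> diagram_group P w"
proof -
  from assms have fin: "finite F" and pb: "\<And>f. f \<in> F \<Longrightarrow> positive_bump f"
    by (auto simp: fast_def)
  from assms obtain L R where LR: "\<forall>f\<in>F. pair_of_feet f (L f) (R f) \<and> L f \<inter> R f = {}"
    "\<forall>f\<in>F. \<forall>g\<in>F. f \<noteq> g \<longrightarrow> (L f \<union> R f) \<inter> (L g \<union> R g) = {}"
    unfolding fast_def by (elim conjE exE)
  have feet: "pair_of_feet f (L f) (R f)" if "f \<in> F" for f using LR(1) that by simp
  have disj: "(L f \<union> R f) \<inter> (L g \<union> R g) = {}" if "f \<in> F" "g \<in> F" "f \<noteq> g" for f g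
    using LR(2) that by simp
  have "\<forall>f\<in>F. \<exists>a b c. orbital f {a<..<b} \<and> c \<in> {a<..<b} \<and> L f = {a<..<c} \<and> R f = {f c<..<b}"
    using feet by (simp add: pair_of_feet_def)
  then obtain a b c where choice: "\<forall>f\<in>F. orbital f {a f<..<b f} \<and> c f \<in> {a f<..<b f} \<and>
      L f = {a f<..<c f} \<and> R f = {f (c f)<..<b f}"
    unfolding bchoice_iff by (elim exE)
  have abc: "orbital f {a f<..<b f}" "a f < c f" "c f < b f" "L f = {a f<..<c f}" "R f = {f (c f)<..<b f}"
    if "f \<in> F" for f
    using bspec[OF choice that] by simp_all
  have car: "F \<subseteq> carrier homeo_group" using pb by (auto simp: positive_bump_def bump_def)
  note props = positive_bump_props[OF pb abc(1)]
  have ab: "a f < b f" if "f \<in> F" for f using abc(2,3)[OF that] by simp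
  have right: "f (c f) < b f" if f: "f \<in> F" for f
  proof -
    have "c f \<in> {0..1}" "b f \<in> {0..1}"
      using props(1,2)[OF f f ab[OF f]] abc(2,3)[OF f] by auto
    then show ?thesis using props(5)[OF f f ab[OF f], of "c f" "b f"] props(3)[OF f f ab[OF f], of "b f"] abc(3)[OF f]
      by simp
  qed
  interpret fast_feet F a b c
  proof
    show "finite F" by (rule fin)
  next
    fix f assume f: "f \<in> F"
    note pr = props[OF f f ab[OF f]]
    show "bij_betw f {0..1} {0..1}" using homeo_groupD(1) car f by blast
    show "0 \<le> a f" "b f \<le> 1" "a f < c f" "c f < b f" using pr(1,2) abc(2,3) f by auto
    show "f s < f t \<longleftrightarrow> s < t" if "s \<in> {0..1}" "t \<in> {0..1}" for s t by (rule pr(5)[OF that])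
    show "f t = t" if "t \<in> {0..1}" "t \<le> a f \<or> b f \<le> t" for t by (rule pr(3)[OF that])
    show "t < f t" if "a f < t" "t < b f" for t by (rule pr(4)[OF that])
  next
    fix f g assume fg: "f \<in> F" "g \<in> F" "f \<noteq> g"
    have d: "L f \<inter> L g = {}" "L f \<inter> R g = {}" "R f \<inter> R g = {}" using disj[OF fg] by auto
    show "c g \<le> a f \<or> c f \<le> a g"
      using disjoint_open_intervals[OF d(1)[unfolded abc(4)[OF fg(1)] abc(4)[OF fg(2)]]] abc(2) fg by auto
    show "b g \<le> a f \<or> c f \<le> g (c g)"
      using disjoint_open_intervals[OF d(2)[unfolded abc(4)[OF fg(1)] abc(5)[OF fg(2)]]] abc(2) right fg by auto
    show "b g \<le> f (c f) \<or> b f \<le> g (c g)"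
      using disjoint_open_intervals[OF d(3)[unfolded abc(5)[OF fg(1)] abc(5)[OF fg(2)]]] right fg by auto
  qed
  show ?thesis using chain_presentation_finite word_top fast_group_iso[OF car] by blast
qed

end
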